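(* If a region $\mathcal{R}$ of a space-time $(M,g_{ab})$ admits a causal Killing vector field, then $\mathcal{R}$ cannot contain an entire marginally trapped surface (MTS) leaf $\mathcal{S}$ of a dynamical horizon segment (DHS) $\mathcal{H}$. In particular, $\mathcal{R}$ cannot contain a DHS $\mathcal{H}$.
   Context: Space-times $(M,g_{ab})$ are smooth, 4-dimensional, time-oriented Lorentzian manifolds of signature $(-,+,+,+)$ with Levi-Civita derivative $\nabla_a$; all fields and submanifolds are smooth. Curvature conventions: $R_{abc}{}^{d}V_d = 2\nabla_{[a}\nabla_{b]}V_c$, $R_{ac}=R_{abc}{}^{b}$. A region is a connected open subset of $M$. A causal Killing field on $\mathcal{R}$ is a Killing field $\xi^a$ on $\mathcal{R}$, not identically zero, which at every point of $\mathcal{R}$ is timelike or null (its causal character may vary from point to point) or zero. Let $\mathcal{S}$ be a closed (compact without boundary) spacelike 2-dimensional submanifold of $M$, with intrinsic metric $q_{ab}$. It has two future-directed null normal fields $k^a,\underline{k}^a$, normalized by $k^a\underline{k}_a=-1$; the remaining freedom is $k^a\to f k^a$, $\underline{k}^a\to f^{-1}\underline{k}^a$ with $f>0$, and all notions below are insensitive to it. The expansions are $\Theta_{(k)}=q^{ab}\nabla_a k_b$ and $\Theta_{(\underline{k})}=q^{ab}\nabla_a\underline{k}_b$, and the shear of $k^a$ is $\sigma^{(k)}_{ab}=\left(q_a{}^c q_b{}^d-\tfrac12 q_{ab}q^{cd}\right)\nabla_{(c}k_{d)}$. $\mathcal{S}$ is a marginally trapped surface (MTS) if the expansion of one of its null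 normals, denoted $k^a$, vanishes identically: $\Theta_{(k)}=0$. On an MTS set $\mathcal{E}=\sigma^{(k)}_{ab}\sigma_{(k)}^{ab}+R_{ab}k^ak^b$. A dynamical horizon segment (DHS) is a connected 3-dimensional submanifold $\mathcal{H}$ of $M$ which is nowhere null and such that: (1) $\mathcal{H}$ is foliated by MTSs $\mathcal{S}$, each with topology $S^2$, with $k^a$ denoting the future-pointing null normal satisfying $\Theta_{(k)}=0$; (2) if $\underline{k}^a$ is the other future-pointing null normal to the leaves, $\Theta_{(\underline{k})}$ is nowhere vanishing; (3) $\mathcal{E}$ does not vanish identically on any leaf $\mathcal{S}$. "An MTS of $\mathcal{H}$" means a leaf of this foliation. *)

theory Defs
  imports "HOL-Analysis.Analysis"
begin

section \<open>Smooth maps between Euclidean spaces\<close>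

primrec Ck_on :: "nat \<Rightarrow> ('a::real_normed_vector \<Rightarrow> 'b::real_normed_vector) \<Rightarrow> 'a set \<Rightarrow> bool" where
  "Ck_on 0 f X \<longleftrightarrow> continuous_on X f"
| "Ck_on (Suc k) f X \<longleftrightarrow>
     (\<forall>x\<in>X. f differentiable (at x)) \<and> (\<forall>v. Ck_on k (\<lambda>x. frechet_derivative f (at x) v) X)"

text \<open>Only used for open \<open>X\<close>.\<close>
definition smooth_on :: "('a::real_normed_vector \<Rightarrow> 'b::real_normed_vector) \<Rightarrow> 'a set \<Rightarrow> bool" where
  "smooth_on f X \<longleftrightarrow> (\<forall>k. Ck_on k f X)"


section \<open>Manifolds and tensor fields\<close>

text \<open>
  The manifold is a whole topological type \<open>'p\<close>, equipped with a smooth atlas. A chart is a pair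
  of its domain and its coordinate map; the values of the map outside the domain are irrelevant.
\<close>

type_synonym ('p, 'n) chart = "'p set \<times> ('p \<Rightarrow> real ^ 'n)"

abbreviation chart_dom :: "('p, 'n::finite) chart \<Rightarrow> 'p set" where
  "chart_dom c \<equiv> fst c"

abbreviation coords :: "('p, 'n::finite) chart \<Rightarrow> 'p \<Rightarrow> real ^ 'n" where
  "coords c \<equiv> snd c"

definition chart_inv :: "('p, 'n::finite) chart \<Rightarrow> real ^ 'n \<Rightarrow> 'p" where
  "chart_inv c = inv_into (chart_dom c) (coords c)"

definition is_chart :: "('p::topological_space, 'n::finite) chart \<Rightarrow> bool" where
  "is_chart c \<longleftrightarrow> open (chart_dom c) \<and> open (coords c ` chart_dom c) \<and>
     homeomorphism (chart_dom c) (coords c ` chart_dom c) (coords c) (chart_inv c)"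

definition transition :: "('p, 'n::finite) chart \<Rightarrow> ('p, 'n) chart \<Rightarrow> real ^ 'n \<Rightarrow> real ^ 'n" where
  "transition c c' = coords c' \<circ> chart_inv c"

definition smooth_atlas :: "('p::topological_space, 'n::finite) chart set \<Rightarrow> bool" where
  "smooth_atlas A \<longleftrightarrow> (\<forall>c\<in>A. is_chart c) \<and> (\<Union>c\<in>A. chart_dom c) = UNIV \<and>
     (\<forall>c\<in>A. \<forall>c'\<in>A. smooth_on (transition c c') (coords c ` (chart_dom c \<inter> chart_dom c')))"

definition jacobian :: "('p, 'n::finite) chart \<Rightarrow> ('p, 'n) chart \<Rightarrow> 'p \<Rightarrow> real ^ 'n ^ 'n" where
  "jacobian c c' p = matrix (frechet_derivative (transition c c') (at (coords c p)))"

text \<open>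
  A tensor field is the family of its component functions in the charts of the atlas,
  subject to the tensorial transformation law: \<open>v c p\<close> is the tuple of components at \<open>p\<close>
  in the coordinate basis of \<open>c\<close>.
\<close>

type_synonym ('p, 'n) vector_field = "('p, 'n) chart \<Rightarrow> 'p \<Rightarrow> real ^ 'n"
type_synonym ('p, 'n) bilinear_field = "('p, 'n) chart \<Rightarrow> 'p \<Rightarrow> real ^ 'n ^ 'n"

definition vector_on :: "('p, 'n::finite) chart set \<Rightarrow> 'p set \<Rightarrow> ('p, 'n) vector_field \<Rightarrow> bool" where
  "vector_on A X v \<longleftrightarrow>
     (\<forall>c\<in>A. \<forall>c'\<in>A. \<forall>p \<in> X \<inter> chart_dom c \<inter> chart_dom c'. v c' p = jacobian c c' p *v v c p)"

definition bilinear_on :: "('p, 'n::finite) chart set \<Rightarrow> 'p set \<Rightarrow> ('p, 'n) bilinear_field \<Rightarrow> bool" where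
  "bilinear_on A X b \<longleftrightarrow>
     (\<forall>c\<in>A. \<forall>c'\<in>A. \<forall>p \<in> X \<inter> chart_dom c \<inter> chart_dom c'.
        b c p = transpose (jacobian c c' p) ** b c' p ** jacobian c c' p)"

definition smooth_field_on ::
  "('p, 'n::finite) chart set \<Rightarrow> 'p set \<Rightarrow> (('p, 'n) chart \<Rightarrow> 'p \<Rightarrow> 'b::real_normed_vector) \<Rightarrow> bool" where
  "smooth_field_on A X f \<longleftrightarrow>
     (\<forall>c\<in>A. smooth_on (f c \<circ> chart_inv c) (coords c ` (chart_dom c \<inter> X)))"

definition smooth_vector_field_on :: "('p, 'n::finite) chart set \<Rightarrow> 'p set \<Rightarrow> ('p, 'n) vector_field \<Rightarrow> bool" where
  "smooth_vector_field_on A X v \<longleftrightarrow> vector_on A X v \<and> smooth_field_on A X v"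

text \<open>\<open>g_prod g c p v w\<close> is \<open>g\<^sub>a\<^sub>b v\<^sup>a w\<^sup>b\<close> at \<open>p\<close>, for components in the chart \<open>c\<close>.\<close>
definition g_prod ::
  "('p, 'n::finite) bilinear_field \<Rightarrow> ('p, 'n) chart \<Rightarrow> 'p \<Rightarrow> real ^ 'n \<Rightarrow> real ^ 'n \<Rightarrow> real" where
  "g_prod g c p v w = v \<bullet> (g c p *v w)"


section \<open>Space-times\<close>

definition minkowski :: "real ^ 4 ^ 4" where
  "minkowski = (\<chi> i j. if i = j then (if i = 0 then -1 else 1) else 0)"

definition lorentz_metric :: "('p, 4) chart set \<Rightarrow> ('p, 4) bilinear_field \<Rightarrow> bool" where
  "lorentz_metric A g \<longleftrightarrow> bilinear_on A UNIV g \<and> smooth_field_on A UNIV g \<and>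
     (\<forall>c\<in>A. \<forall>p \<in> chart_dom c. \<exists>P. invertible P \<and> transpose P ** g c p ** P = minkowski)"

text \<open>The time orientation is represented by a timelike vector field \<open>T\<close>, declared future-directed.\<close>
definition spacetime ::
  "('p::{t2_space,second_countable_topology}, 4) chart set \<Rightarrow> ('p, 4) bilinear_field \<Rightarrow>
   ('p, 4) vector_field \<Rightarrow> bool" where
  "spacetime A g T \<longleftrightarrow> smooth_atlas A \<and> lorentz_metric A g \<and> smooth_vector_field_on A UNIV T \<and>
     (\<forall>c\<in>A. \<forall>p \<in> chart_dom c. g_prod g c p (T c p) (T c p) < 0)"

definition future_null ::
  "('p, 4) bilinear_field \<Rightarrow> ('p, 4) vector_field \<Rightarrow> ('p, 4) chart \<Rightarrow> 'p \<Rightarrow> real ^ 4 \<Rightarrow> bool" where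
  "future_null g T c p v \<longleftrightarrow> v \<noteq> 0 \<and> g_prod g c p v v = 0 \<and> g_prod g c p v (T c p) < 0"


section \<open>Levi-Civita derivative and curvature\<close>

definition pderiv_chart ::
  "('p, 'n::finite) chart \<Rightarrow> 'n \<Rightarrow> ('p \<Rightarrow> real) \<Rightarrow> 'p \<Rightarrow> real" where
  "pderiv_chart c i f p = frechet_derivative (f \<circ> chart_inv c) (at (coords c p)) (axis i 1)"

text \<open>\<open>\<Gamma>\<^sup>k\<^sub>i\<^sub>j\<close>\<close>
definition christoffel ::
  "('p, 'n::finite) bilinear_field \<Rightarrow> ('p, 'n) chart \<Rightarrow> 'p \<Rightarrow> 'n \<Rightarrow> 'n \<Rightarrow> 'n \<Rightarrow> real" where
  "christoffel g c p k i j = 1/2 * (\<Sum>l\<in>UNIV. matrix_inv (g c p) $ k $ l *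
     (pderiv_chart c i (\<lambda>x. g c x $ j $ l) p + pderiv_chart c j (\<lambda>x. g c x $ i $ l) p
      - pderiv_chart c l (\<lambda>x. g c x $ i $ j) p))"

text \<open>
  \<open>nabla1 g c V p $ a $ b\<close> is \<open>\<nabla>\<^sub>a V\<^sub>b\<close>, and \<open>nabla2 g c t p a b d\<close> is \<open>\<nabla>\<^sub>a t\<^sub>b\<^sub>d\<close>, for a covector field
  \<open>V\<close> and a covariant 2-tensor field \<open>t\<close> given by their components in the chart \<open>c\<close>.
\<close>
definition nabla1 ::
  "('p, 'n::finite) bilinear_field \<Rightarrow> ('p, 'n) chart \<Rightarrow> ('p \<Rightarrow> real ^ 'n) \<Rightarrow> 'p \<Rightarrow> real ^ 'n ^ 'n" where
  "nabla1 g c V p = (\<chi> a b. pderiv_chart c a (\<lambda>x. V x $ b) p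
     - (\<Sum>e\<in>UNIV. christoffel g c p e a b * V p $ e))"

definition nabla2 ::
  "('p, 'n::finite) bilinear_field \<Rightarrow> ('p, 'n) chart \<Rightarrow> ('p \<Rightarrow> real ^ 'n ^ 'n) \<Rightarrow> 'p \<Rightarrow>
   'n \<Rightarrow> 'n \<Rightarrow> 'n \<Rightarrow> real" where
  "nabla2 g c t p a b d = pderiv_chart c a (\<lambda>x. t x $ b $ d) p
     - (\<Sum>e\<in>UNIV. christoffel g c p e a b * t p $ e $ d)
     - (\<Sum>e\<in>UNIV. christoffel g c p e a d * t p $ b $ e)"

text \<open>
  \<open>riemann g c p a b e d\<close> is \<open>R\<^sub>a\<^sub>b\<^sub>e\<^sup>d\<close> for the convention
  \<open>R\<^sub>a\<^sub>b\<^sub>e\<^sup>d V\<^sub>d = \<nabla>\<^sub>a\<nabla>\<^sub>b V\<^sub>e - \<nabla>\<^sub>b\<nabla>\<^sub>a V\<^sub>e\<close>: the components are read off by taking for \<open>V\<close> the coordinate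
  covector field \<open>dx\<^sup>d\<close>, which has the constant components \<open>axis d 1\<close>.
\<close>
definition riemann ::
  "('p, 'n::finite) bilinear_field \<Rightarrow> ('p, 'n) chart \<Rightarrow> 'p \<Rightarrow> 'n \<Rightarrow> 'n \<Rightarrow> 'n \<Rightarrow> 'n \<Rightarrow> real" where
  "riemann g c p a b e d =
     nabla2 g c (nabla1 g c (\<lambda>_. axis d 1)) p a b e - nabla2 g c (nabla1 g c (\<lambda>_. axis d 1)) p b a e"

definition ricci :: "('p, 'n::finite) bilinear_field \<Rightarrow> ('p, 'n) bilinear_field" where
  "ricci g c p = (\<chi> a e. \<Sum>b\<in>UNIV. riemann g c p a b e b)"


section \<open>Causal Killing fields on a region\<close>

definition region :: "'p::topological_space set \<Rightarrow> bool" where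
  "region R \<longleftrightarrow> open R \<and> connected R"

definition killing_on ::
  "('p, 'n::finite) chart set \<Rightarrow> ('p, 'n) bilinear_field \<Rightarrow> 'p set \<Rightarrow> ('p, 'n) vector_field \<Rightarrow> bool" where
  "killing_on A g R \<xi> \<longleftrightarrow> smooth_vector_field_on A R \<xi> \<and>
     (\<forall>c\<in>A. \<forall>p \<in> R \<inter> chart_dom c. \<forall>a b.
        nabla1 g c (\<lambda>x. g c x *v \<xi> c x) p $ a $ b + nabla1 g c (\<lambda>x. g c x *v \<xi> c x) p $ b $ a = 0)"

definition causal_killing_on ::
  "('p, 4) chart set \<Rightarrow> ('p, 4) bilinear_field \<Rightarrow> 'p set \<Rightarrow> ('p, 4) vector_field \<Rightarrow> bool" where
  "causal_killing_on A g R \<xi> \<longleftrightarrow> killing_on A g R \<xi> \<and>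
     (\<exists>c\<in>A. \<exists>p \<in> R \<inter> chart_dom c. \<xi> c p \<noteq> 0) \<and>
     (\<forall>c\<in>A. \<forall>p \<in> R \<inter> chart_dom c. g_prod g c p (\<xi> c p) (\<xi> c p) \<le> 0)"


section \<open>Submanifolds\<close>

text \<open>
  \<open>local_param A S W \<psi>\<close>: \<open>\<psi>\<close> is a smooth immersion of the open set \<open>W\<close>, and a homeomorphism onto a
  (relatively) open piece of \<open>S\<close>. An embedded submanifold without boundary is a set covered by
  such pieces; its dimension \<open>CARD('m)\<close> is passed as \<open>TYPE('m)\<close>.
\<close>
definition local_param ::
  "('p::topological_space, 'n::finite) chart set \<Rightarrow> 'p set \<Rightarrow> (real ^ 'm::finite) set \<Rightarrow>
   (real ^ 'm \<Rightarrow> 'p) \<Rightarrow> bool" where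
  "local_param A S W \<psi> \<longleftrightarrow> open W \<and> openin (top_of_set S) (\<psi> ` W) \<and>
     (\<exists>h. homeomorphism W (\<psi> ` W) \<psi> h) \<and>
     (\<forall>c\<in>A. smooth_on (coords c \<circ> \<psi>) {u \<in> W. \<psi> u \<in> chart_dom c} \<and>
        (\<forall>u\<in>W. \<psi> u \<in> chart_dom c \<longrightarrow> inj (frechet_derivative (coords c \<circ> \<psi>) (at u))))"

definition submanifold ::
  "'m::finite itself \<Rightarrow> ('p::topological_space, 'n::finite) chart set \<Rightarrow> 'p set \<Rightarrow> bool" where
  "submanifold _ A S \<longleftrightarrow>
     (\<forall>p\<in>S. \<exists>W (\<psi> :: real ^ 'm \<Rightarrow> 'p). local_param A S W \<psi> \<and> p \<in> \<psi> ` W)"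

definition tangent_space ::
  "'m::finite itself \<Rightarrow> ('p::topological_space, 'n::finite) chart set \<Rightarrow> 'p set \<Rightarrow> ('p, 'n) chart \<Rightarrow> 'p \<Rightarrow>
   (real ^ 'n) set" where
  "tangent_space _ A S c p =
     {frechet_derivative (coords c \<circ> \<psi>) (at u) v | W (\<psi> :: real ^ 'm \<Rightarrow> 'p) u v.
        local_param A S W \<psi> \<and> u \<in> W \<and> \<psi> u = p}"

definition smooth_vector_field_along ::
  "'m::finite itself \<Rightarrow> ('p::topological_space, 'n::finite) chart set \<Rightarrow> 'p set \<Rightarrow>
   ('p, 'n) vector_field \<Rightarrow> bool" where
  "smooth_vector_field_along _ A S v \<longleftrightarrow> vector_on A S v \<and>
     (\<forall>c\<in>A. \<forall>W (\<psi> :: real ^ 'm \<Rightarrow> 'p).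
        local_param A S W \<psi> \<longrightarrow> smooth_on (v c \<circ> \<psi>) {u \<in> W. \<psi> u \<in> chart_dom c})"


section \<open>Geometry of a spacelike surface\<close>

text \<open>
  The tangential objects on a surface are expressed in the coordinate frame \<open>e\<^sub>i = \<partial>\<psi>/\<partial>u\<^sub>i\<close> of a
  local parametrization \<open>\<psi>\<close>, at a parameter \<open>u\<close> with \<open>\<psi> u\<close> in the chart \<open>c\<close>. A tensor
  \<open>q\<^sub>a\<^sup>c q\<^sub>b\<^sup>d t\<^sub>c\<^sub>d\<close> projected to the surface is given by \<open>t(e\<^sub>i, e\<^sub>j)\<close>, and \<open>q\<^sup>a\<^sup>b\<close> by the inverse
  matrix of \<open>q(e\<^sub>i, e\<^sub>j)\<close>; only derivatives of \<open>k\<^sup>a\<close> tangential to the surface enter.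
\<close>

definition frame ::
  "('p, 'n::finite) chart \<Rightarrow> (real ^ 'm::finite \<Rightarrow> 'p) \<Rightarrow> real ^ 'm \<Rightarrow> 'm \<Rightarrow> real ^ 'n" where
  "frame c \<psi> u i = frechet_derivative (coords c \<circ> \<psi>) (at u) (axis i 1)"

definition induced_metric ::
  "('p, 'n::finite) bilinear_field \<Rightarrow> ('p, 'n) chart \<Rightarrow> (real ^ 'm::finite \<Rightarrow> 'p) \<Rightarrow> real ^ 'm \<Rightarrow>
   real ^ 'm ^ 'm" where
  "induced_metric g c \<psi> u = (\<chi> i j. g_prod g c (\<psi> u) (frame c \<psi> u i) (frame c \<psi> u j))"

text \<open>\<open>e\<^sub>i\<^sup>b \<nabla>\<^sub>b k\<^sup>a\<close>\<close>
definition nabla_along ::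
  "('p, 'n::finite) bilinear_field \<Rightarrow> ('p, 'n) chart \<Rightarrow> (real ^ 'm::finite \<Rightarrow> 'p) \<Rightarrow>
   ('p, 'n) vector_field \<Rightarrow> real ^ 'm \<Rightarrow> 'm \<Rightarrow> real ^ 'n" where
  "nabla_along g c \<psi> k u i = frechet_derivative (k c \<circ> \<psi>) (at u) (axis i 1)
     + (\<chi> a. \<Sum>b\<in>UNIV. \<Sum>d\<in>UNIV. christoffel g c (\<psi> u) a b d * frame c \<psi> u i $ b * k c (\<psi> u) $ d)"

text \<open>\<open>e\<^sub>i\<^sup>a e\<^sub>j\<^sup>b \<nabla>\<^sub>a k\<^sub>b\<close>\<close>
definition second_form ::
  "('p, 'n::finite) bilinear_field \<Rightarrow> ('p, 'n) chart \<Rightarrow> (real ^ 'm::finite \<Rightarrow> 'p) \<Rightarrow>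
   ('p, 'n) vector_field \<Rightarrow> real ^ 'm \<Rightarrow> real ^ 'm ^ 'm" where
  "second_form g c \<psi> k u = (\<chi> i j. g_prod g c (\<psi> u) (nabla_along g c \<psi> k u i) (frame c \<psi> u j))"

definition expansion ::
  "('p, 4) bilinear_field \<Rightarrow> ('p, 4) chart \<Rightarrow> (real ^ 2 \<Rightarrow> 'p) \<Rightarrow> ('p, 4) vector_field \<Rightarrow> real ^ 2 \<Rightarrow> real" where
  "expansion g c \<psi> k u =
     (\<Sum>i\<in>UNIV. \<Sum>j\<in>UNIV. matrix_inv (induced_metric g c \<psi> u) $ i $ j * second_form g c \<psi> k u $ i $ j)"

definition shear ::
  "('p, 4) bilinear_field \<Rightarrow> ('p, 4) chart \<Rightarrow> (real ^ 2 \<Rightarrow> 'p) \<Rightarrow> ('p, 4) vector_field \<Rightarrow> real ^ 2 \<Rightarrow>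
   real ^ 2 ^ 2" where
  "shear g c \<psi> k u = (\<chi> i j. (second_form g c \<psi> k u $ i $ j + second_form g c \<psi> k u $ j $ i) / 2
     - 1/2 * induced_metric g c \<psi> u $ i $ j * expansion g c \<psi> k u)"

text \<open>\<open>\<E> = \<sigma>\<^sub>a\<^sub>b \<sigma>\<^sup>a\<^sup>b + R\<^sub>a\<^sub>b k\<^sup>a k\<^sup>b\<close>\<close>
definition energy_flux ::
  "('p, 4) bilinear_field \<Rightarrow> ('p, 4) chart \<Rightarrow> (real ^ 2 \<Rightarrow> 'p) \<Rightarrow> ('p, 4) vector_field \<Rightarrow> real ^ 2 \<Rightarrow> real" where
  "energy_flux g c \<psi> k u =
     (\<Sum>i\<in>UNIV. \<Sum>j\<in>UNIV. \<Sum>l\<in>UNIV. \<Sum>m\<in>UNIV.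
        matrix_inv (induced_metric g c \<psi> u) $ i $ l * matrix_inv (induced_metric g c \<psi> u) $ j $ m *
        shear g c \<psi> k u $ i $ j * shear g c \<psi> k u $ l $ m)
     + k c (\<psi> u) \<bullet> (ricci g c (\<psi> u) *v k c (\<psi> u))"

text \<open>
  Expansion and \<open>\<E>\<close> at a point of the surface do not depend on the chart and parametrization used,
  so a pointwise condition on them is stated for all representations \<open>(c, \<psi>, u)\<close> of points.
\<close>
definition surface_rep ::
  "('p::topological_space, 'n::finite) chart set \<Rightarrow> 'p set \<Rightarrow>
   (('p, 'n) chart \<times> (real ^ 2 \<Rightarrow> 'p) \<times> (real ^ 2)) set" where
  "surface_rep A S =
     {(c, \<psi>, u). c \<in> A \<and> (\<exists>W. local_param A S W \<psi> \<and> u \<in> W) \<and> \<psi> u \<in> chart_dom c}"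

definition closed_spacelike_surface ::
  "('p::topological_space, 4) chart set \<Rightarrow> ('p, 4) bilinear_field \<Rightarrow> 'p set \<Rightarrow> bool" where
  "closed_spacelike_surface A g S \<longleftrightarrow> compact S \<and> submanifold TYPE(2) A S \<and>
     (\<forall>c\<in>A. \<forall>p \<in> S \<inter> chart_dom c. \<forall>v \<in> tangent_space TYPE(2) A S c p. v \<noteq> 0 \<longrightarrow> g_prod g c p v v > 0)"

definition null_normals ::
  "('p::topological_space, 4) chart set \<Rightarrow> ('p, 4) bilinear_field \<Rightarrow> ('p, 4) vector_field \<Rightarrow> 'p set \<Rightarrow>
   ('p, 4) vector_field \<Rightarrow> ('p, 4) vector_field \<Rightarrow> bool" where
  "null_normals A g T S k k' \<longleftrightarrow>
     smooth_vector_field_along TYPE(2) A S k \<and> smooth_vector_field_along TYPE(2) A S k' \<and>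
     (\<forall>c\<in>A. \<forall>p \<in> S \<inter> chart_dom c.
        future_null g T c p (k c p) \<and> future_null g T c p (k' c p) \<and>
        g_prod g c p (k c p) (k' c p) = -1 \<and>
        (\<forall>v \<in> tangent_space TYPE(2) A S c p. g_prod g c p (k c p) v = 0 \<and> g_prod g c p (k' c p) v = 0))"

text \<open>Marginally trapped surface, with \<open>k\<close> its null normal of vanishing expansion.\<close>
definition mts ::
  "('p::topological_space, 4) chart set \<Rightarrow> ('p, 4) bilinear_field \<Rightarrow> ('p, 4) vector_field \<Rightarrow> 'p set \<Rightarrow>
   ('p, 4) vector_field \<Rightarrow> ('p, 4) vector_field \<Rightarrow> bool" where
  "mts A g T S k k' \<longleftrightarrow> closed_spacelike_surface A g S \<and> null_normals A g T S k k' \<and>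
     (\<forall>(c, \<psi>, u) \<in> surface_rep A S. expansion g c \<psi> k u = 0)"


section \<open>Dynamical horizon segments\<close>

text \<open>
  \<open>L\<close> is the set of leaves of a foliation of the 3-dimensional submanifold \<open>H\<close> by surfaces: around
  every point there is a parametrization by a box whose slices of constant third
  coordinate (the plaques) are each contained in a single leaf.
\<close>
definition foliation_by_surfaces ::
  "('p::topological_space, 'n::finite) chart set \<Rightarrow> 'p set \<Rightarrow> 'p set set \<Rightarrow> bool" where
  "foliation_by_surfaces A H L \<longleftrightarrow> partition_on H L \<and>
     (\<forall>S\<in>L. submanifold TYPE(2) A S \<and> connected S) \<and>
     (\<forall>p\<in>H. \<exists>a b (\<psi> :: real ^ 3 \<Rightarrow> 'p). local_param A H (box a b) \<psi> \<and> p \<in> \<psi> ` box a b \<and>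
        (\<forall>S\<in>L. \<forall>u \<in> box a b. \<forall>v \<in> box a b. u $ 3 = v $ 3 \<longrightarrow> (\<psi> u \<in> S \<longleftrightarrow> \<psi> v \<in> S)))"

definition nowhere_null ::
  "'m::finite itself \<Rightarrow> ('p::topological_space, 4) chart set \<Rightarrow> ('p, 4) bilinear_field \<Rightarrow> 'p set \<Rightarrow> bool" where
  "nowhere_null m A g H \<longleftrightarrow>
     (\<forall>c\<in>A. \<forall>p \<in> H \<inter> chart_dom c.
        \<not> (\<exists>v \<in> tangent_space m A H c p. v \<noteq> 0 \<and> (\<forall>w \<in> tangent_space m A H c p. g_prod g c p v w = 0)))"

definition dynamical_horizon_segment ::
  "('p::topological_space, 4) chart set \<Rightarrow> ('p, 4) bilinear_field \<Rightarrow> ('p, 4) vector_field \<Rightarrow>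
   'p set \<Rightarrow> 'p set set \<Rightarrow> bool" where
  "dynamical_horizon_segment A g T H L \<longleftrightarrow>
     H \<noteq> {} \<and> connected H \<and> submanifold TYPE(3) A H \<and> nowhere_null TYPE(3) A g H \<and>
     foliation_by_surfaces A H L \<and>
     (\<forall>S\<in>L. S homeomorphic sphere (0 :: real ^ 3) 1 \<and>
        (\<exists>k k'. mts A g T S k k' \<and>
           (\<forall>(c, \<psi>, u) \<in> surface_rep A S. expansion g c \<psi> k' u \<noteq> 0) \<and>
           \<not> (\<forall>(c, \<psi>, u) \<in> surface_rep A S. energy_flux g c \<psi> k u = 0)))"

end

theory Submission
  imports Defs
begin

text \<open>
  Let \<open>S\<close> be a leaf inside the region and \<open>\<xi>\<close> the Killing field. If \<open>\<xi>\<close> vanished at a point, causality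
  would force its first derivative to vanish there too (an infinitesimal Lorentz transformation
  \<open>F\<close> has \<open>F x\<close> orthogonal to \<open>x\<close>, hence spacelike or zero for timelike \<open>x\<close>), and then \<open>\<xi> = 0\<close> on the connected
  region; so \<open>\<xi>\<close> has no zeros. Along \<open>S\<close> write \<open>\<xi> = \<alpha> k + \<beta> k' + X\<close> with \<open>X\<close> tangential. Tracing Killing's
  equation over \<open>S\<close> gives \<open>div X + \<beta> \<Theta>' = 0\<close>. Causality makes \<open>\<beta>\<close> of one sign, and \<open>\<Theta>'\<close> has one sign, so
  the divergence theorem on the closed surface \<open>S\<close> gives \<open>\<beta> = 0\<close>, whence \<open>X = 0\<close> and \<open>\<xi> = \<alpha> k\<close>. By Killing's equation \<open>k\<close> is then
  shear-free. Moreover \<open>g(\<xi>, \<xi>) \<le> 0\<close> is maximal on \<open>S\<close>, so that \<open>\<nabla>\<^sub>\<xi> \<xi> = 0\<close> there, and the contracted identity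
  \<open>R(\<xi>, \<xi>) = div (\<nabla>\<^sub>\<xi> \<xi>) - tr ((\<nabla>\<xi>)\<^sup>2)\<close> gives \<open>R(k, k) = 0\<close>, since both traces are
  of nilpotent type with respect to the null direction. So \<open>\<E> = 0\<close> on the whole leaf.
\<close>

section \<open>Continuously differentiable maps\<close>

text \<open>The null component \<beta> may vanish on the leaf, so its sign cannot be followed by
  continuity. Causality of \<xi> gives |X|^2 \<le> 2 \<alpha> \<beta>; hence \<alpha> + \<beta>
  vanishes only where \<xi> does, and \<beta> is zero or has the sign of \<alpha> + \<beta>. The
  absence of zeros of \<xi> is used here: it gives the sum a constant sign on the connected leaf.
  The null normals are fields along the leaf only, and Killing's equation is therefore used in its
  pull-back to the surface. This pull-back is expressed by the first variation \<open>strain\<close>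
  of the induced metric, which differentiates k and k' only along the leaf. Tangential fields are
  known only in local parametrisations. X enters as the vector density sqrt(det q) X, whose flux is
  compared between parametrisations by a change of variables with |det J|, the sum being organised
  by a partition of unity. A partition of class C1 is enough for one integration by parts; hence the
  calculus is built for C1 maps, with higher derivatives as iterated directional
  derivatives.\<close>

abbreviation fderiv ("\<D>") where "\<D> f x \<equiv> frechet_derivative f (at x)"

text \<open>Continuity is asked of \<open>\<D> f x v\<close> for each fixed v. In finite dimension
  this is continuity of the derivative, and no topology on linear maps is involved.\<close>

definition C1_on :: "('a::real_normed_vector \<Rightarrow> 'b::real_normed_vector) \<Rightarrow> 'a set \<Rightarrow> bool" where
  "C1_on f U \<longleftrightarrow> (\<forall>x\<in>U. f differentiable (at x)) \<and> (\<forall>v. continuous_on U (\<lambda>x. \<D> f x v))"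

lemma D_eq: "(f has_derivative f') (at x) \<Longrightarrow> \<D> f x = f'"
  by (metis frechet_derivative_at)

lemma has_D: "f differentiable (at x) \<Longrightarrow> (f has_derivative \<D> f x) (at x)"
  by (simp add: frechet_derivative_works)

lemma C1_onI:
  assumes "\<And>x. x \<in> U \<Longrightarrow> (f has_derivative f' x) (at x)" "\<And>v. continuous_on U (\<lambda>x. f' x v)"
  shows "C1_on f U"
proof -
  have "\<D> f x = f' x" if "x \<in> U" for x using assms(1)[OF that] by (rule D_eq)
  then have "continuous_on U (\<lambda>x. \<D> f x v)" for v
    using assms(2)[of v] by (simp cong: continuous_on_cong)
  then show ?thesis using assms(1) unfolding C1_on_def differentiable_def by blast
qed

lemma C1_differentiable: "C1_on f U \<Longrightarrow> x \<in> U \<Longrightarrow> f differentiable (at x)"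
  by (simp add: C1_on_def)

lemma C1_has_D: "C1_on f U \<Longrightarrow> x \<in> U \<Longrightarrow> (f has_derivative \<D> f x) (at x)"
  by (simp add: C1_on_def has_D)

lemma C1_continuous_D: "C1_on f U \<Longrightarrow> continuous_on U (\<lambda>x. \<D> f x v)"
  by (simp add: C1_on_def)

lemma C1_continuous: "C1_on f U \<Longrightarrow> continuous_on U f"
  by (meson C1_on_def continuous_at_imp_continuous_on differentiable_imp_continuous_within)

lemma C1_subset: "C1_on f U \<Longrightarrow> V \<subseteq> U \<Longrightarrow> C1_on f V"
  unfolding C1_on_def by (meson continuous_on_subset subsetD)

lemma C1_const [simp]: "C1_on (\<lambda>x. c) U"
  by (rule C1_onI[where f' = "\<lambda>x v. 0"]) auto

lemma C1_cong:
  assumes "open U" "C1_on f U" "\<And>x. x \<in> U \<Longrightarrow> f x = g x"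
  shows "C1_on g U"
proof (rule C1_onI[where f' = "\<D> f"])
  fix x assume "x \<in> U"
  then show "(g has_derivative \<D> f x) (at x)"
    using has_derivative_transform_within_open[OF C1_has_D[OF assms(2)] assms(1)] assms(3) by blast
qed (use assms(2) C1_continuous_D in blast)

lemma C1_bilinear:
  assumes "bounded_bilinear p" "C1_on f U" "C1_on g U"
  shows "C1_on (\<lambda>x. p (f x) (g x)) U"
proof (rule C1_onI[where f' = "\<lambda>x v. p (f x) (\<D> g x v) + p (\<D> f x v) (g x)"])
  interpret bounded_bilinear p by fact
  show "((\<lambda>x. p (f x) (g x)) has_derivative (\<lambda>v. p (f x) (\<D> g x v) + p (\<D> f x v) (g x))) (at x)"
    if "x \<in> U" for x
    using FDERIV[OF C1_has_D[OF assms(2) that] C1_has_D[OF assms(3) that]] .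
  show "continuous_on U (\<lambda>x. p (f x) (\<D> g x v) + p (\<D> f x v) (g x))" for v
    by (intro continuous_intros continuous_on C1_continuous C1_continuous_D assms)
qed

lemma C1_linear:
  assumes "bounded_linear l" "C1_on f U"
  shows "C1_on (\<lambda>x. l (f x)) U"
proof (rule C1_onI[where f' = "\<lambda>x v. l (\<D> f x v)"])
  interpret bounded_linear l by fact
  show "((\<lambda>x. l (f x)) has_derivative (\<lambda>v. l (\<D> f x v))) (at x)" if "x \<in> U" for x
    using has_derivative[OF C1_has_D[OF assms(2) that]] .
  show "continuous_on U (\<lambda>x. l (\<D> f x v))" for v
    by (intro continuous_on C1_continuous_D assms)
qed

lemma C1_add: "C1_on f U \<Longrightarrow> C1_on g U \<Longrightarrow> C1_on (\<lambda>x. f x + g x) U"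
  by (rule C1_onI[where f' = "\<lambda>x v. \<D> f x v + \<D> g x v"])
    (auto intro!: has_derivative_add C1_has_D continuous_intros C1_continuous_D)

lemma C1_diff: "C1_on f U \<Longrightarrow> C1_on g U \<Longrightarrow> C1_on (\<lambda>x. f x - g x) U"
  by (rule C1_onI[where f' = "\<lambda>x v. \<D> f x v - \<D> g x v"])
    (auto intro!: has_derivative_diff C1_has_D continuous_intros C1_continuous_D)

lemmas C1_mult = C1_bilinear[OF bounded_bilinear_mult]
lemmas C1_scaleR = C1_bilinear[OF bounded_bilinear_scaleR]
lemmas C1_inner = C1_bilinear[OF bounded_bilinear_inner]
lemmas C1_nth = C1_linear[OF bounded_linear_vec_nth]

lemma bounded_linear_nth_nth: "bounded_linear (\<lambda>A :: real ^ 'm ^ 'n. A $ i $ j)"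
  by (rule bounded_linear_compose[OF bounded_linear_vec_nth bounded_linear_vec_nth])

lemma C1_sum: "(\<And>i. i \<in> I \<Longrightarrow> C1_on (f i) U) \<Longrightarrow> C1_on (\<lambda>x. \<Sum>i\<in>I. f i x) U"
proof (induction I rule: infinite_finite_induct)
  case (insert i I)
  then have "C1_on (\<lambda>x. f i x + (\<Sum>i\<in>I. f i x)) U"
    by (intro C1_add) auto
  then show ?case using insert.hyps by simp
qed auto

lemma C1_prod:
  fixes f :: "'i \<Rightarrow> 'a::real_normed_vector \<Rightarrow> real"
  shows "(\<And>i. i \<in> I \<Longrightarrow> C1_on (f i) U) \<Longrightarrow> C1_on (\<lambda>x. \<Prod>i\<in>I. f i x) U"
proof (induction I rule: infinite_finite_induct)
  case (insert i I)
  then have "C1_on (\<lambda>x. f i x * (\<Prod>i\<in>I. f i x)) U"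
    by (intro C1_mult) auto
  then show ?case using insert.hyps by simp
qed auto

lemma bounded_linear_axis: "bounded_linear (\<lambda>x::'a::real_normed_vector. axis i x)"
proof (rule bounded_linear_intro[where K = 1])
  show "norm (axis i x) \<le> norm x * 1" for x :: 'a
    by (simp add: norm_vec_def L2_set_def axis_def if_distrib[of norm] if_distrib[of "\<lambda>y. y\<^sup>2"] cong: if_cong)
qed (simp_all add: axis_def vec_eq_iff)

lemma sum_axis: "(\<Sum>i\<in>UNIV. axis i (f i)) = (\<chi> i. f i)"
  by (simp add: vec_eq_iff axis_def if_distrib cong: if_cong)

lemma C1_vec: "(\<And>i. C1_on (f i) U) \<Longrightarrow> C1_on (\<lambda>x. \<chi> i. f i x) U"
  unfolding sum_axis[symmetric] by (intro C1_sum C1_linear[OF bounded_linear_axis])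

lemma D_euclidean:
  fixes f :: "'a::euclidean_space \<Rightarrow> 'b::real_normed_vector"
  assumes "f differentiable (at x)"
  shows "\<D> f x v = (\<Sum>b\<in>Basis. (v \<bullet> b) *\<^sub>R \<D> f x b)"
proof -
  have "linear (\<D> f x)"
    using assms by (simp add: linear_frechet_derivative)
  then have "\<D> f x (\<Sum>b\<in>Basis. (v \<bullet> b) *\<^sub>R b) = (\<Sum>b\<in>Basis. (v \<bullet> b) *\<^sub>R \<D> f x b)"
    by (simp add: linear_sum linear_scale)
  then show ?thesis by (simp add: euclidean_representation)
qed

text \<open>A varying direction w is expanded in the basis: linearity of \<open>\<D> f x\<close>
  reduces joint continuity to that in the finitely many basis directions.\<close>

lemma C1_continuous_D_joint:
  fixes f :: "'a::euclidean_space \<Rightarrow> 'b::real_normed_vector"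
  assumes "C1_on f V" "continuous_on U y" "continuous_on U w" "y ` U \<subseteq> V"
  shows "continuous_on U (\<lambda>x. \<D> f (y x) (w x))"
proof -
  have "continuous_on U (\<lambda>x. \<Sum>b\<in>Basis. (w x \<bullet> b) *\<^sub>R \<D> f (y x) b)"
    by (intro continuous_intros assms continuous_on_compose2[OF C1_continuous_D[OF assms(1)] assms(2)])
  moreover have "\<D> f (y x) (w x) = (\<Sum>b\<in>Basis. (w x \<bullet> b) *\<^sub>R \<D> f (y x) b)" if "x \<in> U" for x
    using that assms(1,4) by (intro D_euclidean C1_differentiable[of f V]) auto
  ultimately show ?thesis by (simp cong: continuous_on_cong)
qed

lemma D_compose:
  assumes "f differentiable (at (g x))" "g differentiable (at x)"
  shows "\<D> (\<lambda>x. f (g x)) x v = \<D> f (g x) (\<D> g x v)"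
  using frechet_derivative_compose[OF assms(2,1)] by (simp add: o_def fun_eq_iff)

lemma C1_compose:
  fixes f :: "'b::euclidean_space \<Rightarrow> 'c::real_normed_vector"
  assumes "C1_on f V" "C1_on g U" "g ` U \<subseteq> V"
  shows "C1_on (\<lambda>x. f (g x)) U"
proof (rule C1_onI[where f' = "\<lambda>x v. \<D> f (g x) (\<D> g x v)"])
  show "((\<lambda>x. f (g x)) has_derivative (\<lambda>v. \<D> f (g x) (\<D> g x v))) (at x)" if "x \<in> U" for x
    using has_derivative_compose[OF C1_has_D[OF assms(2) that] C1_has_D[OF assms(1)]] assms(3) that
    by auto
  show "continuous_on U (\<lambda>x. \<D> f (g x) (\<D> g x v))" for v
    by (intro C1_continuous_D_joint[OF assms(1)] C1_continuous C1_continuous_D assms)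
qed

lemma C1_real_compose:
  fixes g :: "'a::real_normed_vector \<Rightarrow> real"
  assumes "C1_on g U" "\<And>x. x \<in> U \<Longrightarrow> (f has_real_derivative f' (g x)) (at (g x))"
    "continuous_on (g ` U) f'"
  shows "C1_on (\<lambda>x. f (g x)) U"
proof (rule C1_onI[where f' = "\<lambda>x v. f' (g x) * \<D> g x v"])
  show "((\<lambda>x. f (g x)) has_derivative (\<lambda>v. f' (g x) * \<D> g x v)) (at x)" if "x \<in> U" for x
    using has_derivative_compose[OF C1_has_D[OF assms(1) that]
      assms(2)[OF that, unfolded has_field_derivative_def]] .
  show "continuous_on U (\<lambda>x. f' (g x) * \<D> g x v)" for v
    by (intro continuous_intros C1_continuous_D assms
        continuous_on_compose2[OF assms(3) C1_continuous[OF assms(1)]]) auto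
qed

lemma C1_inverse:
  fixes g :: "'a::real_normed_vector \<Rightarrow> real"
  assumes "C1_on g U" "\<And>x. x \<in> U \<Longrightarrow> g x \<noteq> 0"
  shows "C1_on (\<lambda>x. inverse (g x)) U"
  by (rule C1_real_compose[OF assms(1), where f' = "\<lambda>y. - (inverse y * inverse y)"])
    (use assms in \<open>auto intro!: DERIV_inverse continuous_intros simp: power2_eq_square\<close>,
      use DERIV_inverse[where 'a = real] in \<open>simp add: power2_eq_square numeral_2_eq_2\<close>)

lemma C1_divide:
  fixes f g :: "'a::real_normed_vector \<Rightarrow> real"
  shows "C1_on f U \<Longrightarrow> C1_on g U \<Longrightarrow> (\<And>x. x \<in> U \<Longrightarrow> g x \<noteq> 0) \<Longrightarrow> C1_on (\<lambda>x. f x / g x) U"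
  unfolding divide_inverse by (intro C1_mult C1_inverse)

lemma C1_sqrt:
  fixes g :: "'a::real_normed_vector \<Rightarrow> real"
  assumes "C1_on g U" "\<And>x. x \<in> U \<Longrightarrow> g x > 0"
  shows "C1_on (\<lambda>x. sqrt (g x)) U"
  by (rule C1_real_compose[OF assms(1), where f' = "\<lambda>y. inverse (sqrt y) / 2"])
    (use assms in \<open>force intro!: DERIV_real_sqrt continuous_intros\<close>)+

lemma C1_det:
  fixes f :: "'a::real_normed_vector \<Rightarrow> real ^ 'n ^ 'n"
  assumes "\<And>i j. C1_on (\<lambda>x. f x $ i $ j) U"
  shows "C1_on (\<lambda>x. det (f x)) U"
  unfolding det_def by (intro C1_sum C1_mult C1_prod assms C1_const)

lemma matrix_inv:
  assumes "invertible (A :: real ^ 'n ^ 'n)"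
  shows "A ** matrix_inv A = mat 1" "matrix_inv A ** A = mat 1"
proof -
  have "A ** matrix_inv A = mat 1 \<and> matrix_inv A ** A = mat 1"
    using assms unfolding matrix_inv_def invertible_def by (rule someI_ex)
  then show "A ** matrix_inv A = mat 1" "matrix_inv A ** A = mat 1" by auto
qed

text \<open>Cramer's rule for the j-th column of the inverse. It makes the entries quotients of
  determinants, hence C1 when the matrix is.\<close>

lemma matrix_inv_nth:
  fixes A :: "real ^ 'n ^ 'n"
  assumes "det A \<noteq> 0"
  shows "matrix_inv A $ i $ j = det (\<chi> k l. if l = i then axis j 1 $ k else A $ k $ l) / det A"
proof -
  have "A *v (matrix_inv A *v axis j 1) = axis j 1"
    using assms by (simp add: matrix_vector_mul_assoc matrix_inv(1) invertible_det_nz)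
  then have "matrix_inv A *v axis j 1 = (\<chi> i. det (\<chi> k l. if l = i then axis j 1 $ k else A $ k $ l) / det A)"
    using cramer[OF assms] by blast
  then have "(matrix_inv A *v axis j 1) $ i = det (\<chi> k l. if l = i then axis j 1 $ k else A $ k $ l) / det A"
    by (simp only: vec_lambda_beta)
  moreover have "(matrix_inv A *v axis j 1) $ i = matrix_inv A $ i $ j"
    by (simp add: matrix_vector_mult_def axis_def if_distrib cong: if_cong)
  ultimately show ?thesis by simp
qed

lemma C1_matrix_inv:
  fixes f :: "'a::real_normed_vector \<Rightarrow> real ^ 'n ^ 'n"
  assumes U: "open U" and f: "C1_on f U" and nz: "\<And>x. x \<in> U \<Longrightarrow> det (f x) \<noteq> 0"
  shows "C1_on (\<lambda>x. matrix_inv (f x) $ i $ j) U"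
proof (rule C1_cong[OF U])
  have c: "C1_on (\<lambda>x. f x $ i $ j) U" for i j by (intro C1_nth f)
  show "C1_on (\<lambda>x. det (\<chi> k l. if l = i then axis j 1 $ k else f x $ k $ l) / det (f x)) U"
  proof (intro C1_divide C1_det nz c)
    show "C1_on (\<lambda>x. (\<chi> k l. if l = i then axis j 1 $ k else f x $ k $ l) $ i' $ j') U" for i' j'
      using c by (cases "j' = i") auto
  qed
qed (simp add: matrix_inv_nth nz)

lemma smooth_on_C1: "smooth_on f U \<Longrightarrow> C1_on f U"
  unfolding smooth_on_def C1_on_def by (drule spec[of _ "Suc 0"]) auto

lemma smooth_on_D: "smooth_on f U \<Longrightarrow> smooth_on (\<lambda>x. \<D> f x v) U"
  unfolding smooth_on_def by (metis Ck_on.simps(2))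

lemma smooth_on_C1_D: "smooth_on f U \<Longrightarrow> C1_on (\<lambda>x. \<D> f x v) U"
  by (intro smooth_on_C1 smooth_on_D)

lemma Ck_on_subset: "Ck_on k f U \<Longrightarrow> V \<subseteq> U \<Longrightarrow> Ck_on k f V"
  by (induction k arbitrary: f) (auto intro: continuous_on_subset)

lemma smooth_on_subset: "smooth_on f U \<Longrightarrow> V \<subseteq> U \<Longrightarrow> smooth_on f V"
  unfolding smooth_on_def by (blast intro: Ck_on_subset)

lemma mvt_ball:
  fixes f :: "'a::real_normed_vector \<Rightarrow> real"
  assumes f: "\<And>z. z \<in> ball x r \<Longrightarrow> f differentiable (at z)"
    and y: "y \<in> ball x r" "y + h *\<^sub>R w \<in> ball x r" and h: "h > 0"
  obtains t where "0 < t" "t < h" "f (y + h *\<^sub>R w) - f y = h * \<D> f (y + t *\<^sub>R w) w"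
proof -
  have in_ball: "y + t *\<^sub>R w \<in> ball x r" if "0 \<le> t" "t \<le> h" for t
  proof -
    have "y + t *\<^sub>R w = (1 - t / h) *\<^sub>R y + (t / h) *\<^sub>R (y + h *\<^sub>R w)"
      using h by (simp add: algebra_simps)
    moreover have "0 \<le> t / h" "t / h \<le> 1" using that h by auto
    ultimately show ?thesis
      using convexD_alt[OF convex_ball y, of "t / h"] by simp
  qed
  have "((\<lambda>t. f (y + t *\<^sub>R w)) has_real_derivative \<D> f (y + t *\<^sub>R w) w) (at t)"
    if "0 \<le> t" "t \<le> h" for t
  proof -
    have 1: "((\<lambda>t. y + t *\<^sub>R w) has_derivative (\<lambda>s. s *\<^sub>R w)) (at t)"
      by (auto intro!: derivative_eq_intros)
    have 2: "f differentiable (at (y + t *\<^sub>R w))" using f in_ball[OF that] by blast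
    have "((\<lambda>t. f (y + t *\<^sub>R w)) has_derivative (\<lambda>s. \<D> f (y + t *\<^sub>R w) (s *\<^sub>R w))) (at t)"
      using has_derivative_compose[OF 1 has_D[OF 2]] .
    moreover have "\<D> f (y + t *\<^sub>R w) (s *\<^sub>R w) = \<D> f (y + t *\<^sub>R w) w * s" for s
      using linear_scale[OF linear_frechet_derivative[OF 2]] by simp
    ultimately show ?thesis by (simp add: has_field_derivative_def)
  qed
  then obtain t where "0 < t" "t < h"
    "f (y + h *\<^sub>R w) - f (y + 0 *\<^sub>R w) = (h - 0) * \<D> f (y + t *\<^sub>R w) w"
    using MVT2[of 0 h "\<lambda>t. f (y + t *\<^sub>R w)" "\<lambda>t. \<D> f (y + t *\<^sub>R w) w"] h by auto
  then show thesis by (intro that) auto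
qed

text \<open>The mean value theorem is applied twice: to y -> f(y + h w) - f y in direction v, then
  to the resulting difference of v-derivatives in direction w. The second difference itself is
  symmetric in v and w.\<close>

lemma second_difference:
  fixes f :: "'a::real_normed_vector \<Rightarrow> real"
  assumes f: "C1_on f (ball x r)" and fv: "C1_on (\<lambda>y. \<D> f y v) (ball x r)"
    and h: "h > 0" "h * (norm v + norm w) < r"
  obtains z where "z \<in> ball x r" "norm (z - x) \<le> h * (norm v + norm w)"
    "f (x + h *\<^sub>R v + h *\<^sub>R w) - f (x + h *\<^sub>R v) - f (x + h *\<^sub>R w) + f x = h * (h * \<D> (\<lambda>y. \<D> f y v) z w)"
proof -
  have bound: "norm (s *\<^sub>R v + t *\<^sub>R w) \<le> h * (norm v + norm w)" if "0 \<le> s" "s \<le> h" "0 \<le> t" "t \<le> h" for s t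
  proof -
    have "norm (s *\<^sub>R v + t *\<^sub>R w) \<le> s * norm v + t * norm w"
      using norm_triangle_ineq[of "s *\<^sub>R v" "t *\<^sub>R w"] that by simp
    also have "\<dots> \<le> h * norm v + h * norm w" using that by (intro add_mono mult_right_mono) auto
    finally show ?thesis by (simp add: algebra_simps)
  qed
  have inb: "x + s *\<^sub>R v + t *\<^sub>R w \<in> ball x r" if "0 \<le> s" "s \<le> h" "0 \<le> t" "t \<le> h" for s t
  proof -
    have "dist x (x + s *\<^sub>R v + t *\<^sub>R w) = norm (s *\<^sub>R v + t *\<^sub>R w)"
      unfolding dist_norm by (subst norm_minus_commute) (simp add: add.assoc)
    then show ?thesis using bound[OF that] h by simp
  qed
  have fd: "f differentiable (at y)" if "y \<in> ball x r" for y using f that by (rule C1_differentiable)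
  \<comment> \<open>With this radius for y, both y and the shifted point y + h w lie in the ball of
    radius r.\<close>
  let ?\<rho> = "r - h * norm w"
  have hw: "norm (y + h *\<^sub>R w - x) < r" "norm (y - x) < r" if "y \<in> ball x ?\<rho>" for y
  proof -
    have "norm (y - x) < ?\<rho>" using that by (simp add: dist_norm norm_minus_commute)
    moreover have "norm (y + h *\<^sub>R w - x) \<le> norm (y - x) + h * norm w"
      using norm_triangle_ineq[of "y - x" "h *\<^sub>R w"] h by (simp add: algebra_simps)
    moreover have "h * norm w \<ge> 0" using h by simp
    ultimately show "norm (y + h *\<^sub>R w - x) < r" "norm (y - x) < r" by linarith+
  qed
  let ?g = "\<lambda>y. f (y + h *\<^sub>R w) - f y"
  have gder: "(?g has_derivative (\<lambda>d. \<D> f (y + h *\<^sub>R w) d - \<D> f y d)) (at y)" if "y \<in> ball x ?\<rho>" for y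
  proof -
    have 1: "((\<lambda>y. y + h *\<^sub>R w) has_derivative (\<lambda>d. d)) (at y)" by (auto intro!: derivative_eq_intros)
    have "y + h *\<^sub>R w \<in> ball x r" "y \<in> ball x r"
      using hw[OF that] by (simp_all add: dist_norm norm_minus_commute)
    then show ?thesis
      using has_derivative_compose[OF 1 has_D[OF fd]] has_D[OF fd] by (intro has_derivative_diff) auto
  qed
  have \<rho>: "h * norm v < ?\<rho>" using h by (simp add: algebra_simps)
  obtain s where s: "0 < s" "s < h" "?g (x + h *\<^sub>R v) - ?g x = h * \<D> ?g (x + s *\<^sub>R v) v"
  proof (rule mvt_ball[of x ?\<rho> ?g x h v])
    show "?g differentiable (at z)" if "z \<in> ball x ?\<rho>" for z
      using gder[OF that] by (rule differentiableI)
    show "x \<in> ball x ?\<rho>"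
      unfolding centre_in_ball using \<rho> h mult_nonneg_nonneg[of h "norm v"] norm_ge_zero[of v] by linarith
    show "x + h *\<^sub>R v \<in> ball x ?\<rho>" using \<rho> h by (simp add: dist_norm)
  qed (use h in auto)
  have sx: "x + s *\<^sub>R v \<in> ball x ?\<rho>"
  proof -
    have "s * norm v \<le> h * norm v" using s by (intro mult_right_mono) auto
    then show ?thesis using \<rho> s by (simp add: dist_norm)
  qed
  have gs: "\<D> ?g (x + s *\<^sub>R v) v = \<D> f (x + s *\<^sub>R v + h *\<^sub>R w) v - \<D> f (x + s *\<^sub>R v) v"
    using D_eq[OF gder[OF sx]] by simp
  obtain t where t: "0 < t" "t < h"
    "\<D> f (x + s *\<^sub>R v + h *\<^sub>R w) v - \<D> f (x + s *\<^sub>R v) v = h * \<D> (\<lambda>y. \<D> f y v) (x + s *\<^sub>R v + t *\<^sub>R w) w"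
  proof (rule mvt_ball[of x r "\<lambda>y. \<D> f y v" "x + s *\<^sub>R v" h w])
    show "x + s *\<^sub>R v \<in> ball x r" using inb[of s 0] s by simp
    show "x + s *\<^sub>R v + h *\<^sub>R w \<in> ball x r" using inb[of s h] s h by simp
  qed (use h C1_differentiable[OF fv] in auto)
  show thesis
  proof (rule that)
    show "x + s *\<^sub>R v + t *\<^sub>R w \<in> ball x r" using inb s t by simp
    show "norm (x + s *\<^sub>R v + t *\<^sub>R w - x) \<le> h * (norm v + norm w)"
      using bound[of s t] s t by (simp add: algebra_simps)
    show "f (x + h *\<^sub>R v + h *\<^sub>R w) - f (x + h *\<^sub>R v) - f (x + h *\<^sub>R w) + f x =
        h * (h * \<D> (\<lambda>y. \<D> f y v) (x + s *\<^sub>R v + t *\<^sub>R w) w)"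
      using s t gs by (simp add: algebra_simps)
  qed
qed

text \<open>Both mixed derivatives, taken at points z1 and z2 close to x, equal the same second
  difference divided by h^2; continuity at x then excludes distinct values there.\<close>

lemma symmetric_second_derivative_real:
  fixes f :: "'a::real_normed_vector \<Rightarrow> real"
  assumes U: "open U" "x \<in> U"
    and f: "C1_on f U" and fv: "C1_on (\<lambda>y. \<D> f y v) U" and fw: "C1_on (\<lambda>y. \<D> f y w) U"
  shows "\<D> (\<lambda>y. \<D> f y v) x w = \<D> (\<lambda>y. \<D> f y w) x v"
proof (rule ccontr)
  let ?A = "\<lambda>z. \<D> (\<lambda>y. \<D> f y v) z w" and ?B = "\<lambda>z. \<D> (\<lambda>y. \<D> f y w) z v"
  assume ne: "?A x \<noteq> ?B x"
  define e where "e = \<bar>?A x - ?B x\<bar> / 2"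
  have e: "e > 0" using ne by (simp add: e_def)
  obtain r where r: "r > 0" "ball x r \<subseteq> U" using U open_contains_ball by blast
  have "isCont ?A x" "isCont ?B x"
    using C1_continuous_D[OF fv] C1_continuous_D[OF fw] U by (auto simp: continuous_on_eq_continuous_at)
  then obtain d1 d2 where d: "d1 > 0" "d2 > 0"
    "\<And>z. dist z x < d1 \<Longrightarrow> dist (?A z) (?A x) < e" "\<And>z. dist z x < d2 \<Longrightarrow> dist (?B z) (?B x) < e"
    using e unfolding continuous_at_eps_delta by metis
  define \<delta> where "\<delta> = min r (min d1 d2)"
  have \<delta>: "\<delta> > 0" using r d by (simp add: \<delta>_def)
  \<comment> \<open>The denominator exceeds \<open>norm v + norm w\<close> and is positive even for
    v = w = 0, so z1 and z2 fall within \<delta> of x.\<close>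
  define h where "h = \<delta> / (2 * (norm v + norm w + 1))"
  have n: "norm v + norm w + 1 > 0" by (smt (verit) norm_ge_zero)
  have h: "h > 0" using \<delta> n by (simp add: h_def)
  have "h * (norm v + norm w) < h * (2 * (norm v + norm w + 1))" using h n by (intro mult_strict_left_mono) auto
  also have "\<dots> = \<delta>" using n unfolding h_def by simp
  finally have hd: "h * (norm v + norm w) < \<delta>" .
  obtain z1 where z1: "norm (z1 - x) \<le> h * (norm v + norm w)"
    "f (x + h *\<^sub>R v + h *\<^sub>R w) - f (x + h *\<^sub>R v) - f (x + h *\<^sub>R w) + f x = h * (h * ?A z1)"
    using second_difference[of f x r v h w] f fv r hd h C1_subset
    by (smt (verit, best) \<delta>_def min.bounded_iff)
  obtain z2 where z2: "norm (z2 - x) \<le> h * (norm w + norm v)"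
    "f (x + h *\<^sub>R w + h *\<^sub>R v) - f (x + h *\<^sub>R w) - f (x + h *\<^sub>R v) + f x = h * (h * ?B z2)"
    using second_difference[of f x r w h v] f fw r hd h C1_subset
    by (smt (verit, best) \<delta>_def min.bounded_iff)
  have "f (x + h *\<^sub>R w + h *\<^sub>R v) = f (x + h *\<^sub>R v + h *\<^sub>R w)" by (simp add: add_ac)
  then have "h * (h * ?A z1) = h * (h * ?B z2)" using z1(2) z2(2) by linarith
  then have "?A z1 = ?B z2" using h by simp
  moreover have "dist (?A z1) (?A x) < e" "dist (?B z2) (?B x) < e"
    using d z1(1) z2(1) hd by (auto simp: dist_norm \<delta>_def add.commute)
  ultimately show False using e unfolding e_def dist_real_def by argo
qed

lemma D_linear:
  assumes "bounded_linear l" "f differentiable (at x)"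
  shows "\<D> (\<lambda>x. l (f x)) x v = l (\<D> f x v)"
  using D_eq[OF bounded_linear.has_derivative[OF assms(1) has_D[OF assms(2)]]] by simp

text \<open>Componentwise reduction to the real case. The C1 form serves \<open>V\<close> and
  \<open>norm2\<close>, for which just this much differentiability is derived.\<close>

lemma symmetric_second_derivative_C1:
  fixes f :: "'a::real_normed_vector \<Rightarrow> 'b::euclidean_space"
  assumes U: "open U" "x \<in> U" and f: "C1_on f U" and f': "\<And>v. C1_on (\<lambda>x. \<D> f x v) U"
  shows "\<D> (\<lambda>y. \<D> f y v) x w = \<D> (\<lambda>y. \<D> f y w) x v"
proof (rule euclidean_eqI)
  fix b :: 'b assume "b \<in> Basis"
  have bl: "bounded_linear (\<lambda>x. x \<bullet> b)" by (rule bounded_linear_inner_left)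
  have D1: "\<D> (\<lambda>y. f y \<bullet> b) y v = \<D> f y v \<bullet> b" if "y \<in> U" for y v
    by (rule D_linear[OF bl C1_differentiable[OF f that]])
  have c1: "C1_on (\<lambda>y. \<D> (\<lambda>y. f y \<bullet> b) y v) U" for v
    by (rule C1_cong[OF U(1) C1_linear[OF bl f'[of v]]]) (simp add: D1)
  have D2: "\<D> (\<lambda>y. \<D> (\<lambda>y. f y \<bullet> b) y v) x w = \<D> (\<lambda>y. \<D> f y v) x w \<bullet> b" for v w
  proof -
    have "\<D> (\<lambda>y. \<D> (\<lambda>y. f y \<bullet> b) y v) x = \<D> (\<lambda>y. \<D> f y v \<bullet> b) x"
      by (rule frechet_derivative_transform_within_open[OF C1_differentiable[OF c1 U(2)] U])
        (simp add: D1)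
    then show ?thesis
      using D_linear[OF bl C1_differentiable[OF f' U(2)]] by simp
  qed
  show "\<D> (\<lambda>y. \<D> f y v) x w \<bullet> b = \<D> (\<lambda>y. \<D> f y w) x v \<bullet> b"
    using symmetric_second_derivative_real[OF U C1_linear[OF bl f] c1 c1] D2 by simp
qed

lemma symmetric_second_derivative:
  fixes f :: "'a::real_normed_vector \<Rightarrow> 'b::euclidean_space"
  assumes "open U" "x \<in> U" "smooth_on f U"
  shows "\<D> (\<lambda>y. \<D> f y v) x w = \<D> (\<lambda>y. \<D> f y w) x v"
  using assms by (intro symmetric_second_derivative_C1 smooth_on_C1 smooth_on_C1_D)

section \<open>The divergence theorem on a closed surface\<close>

text \<open>The difference quotients of Z along e have integral zero by translation invariance of
  Lebesgue measure, and they converge to the derivative under a dominating function.\<close>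

lemma integral_directional_derivative:
  fixes Z :: "'a::euclidean_space \<Rightarrow> real"
  assumes Z: "C1_on Z UNIV" and K: "compact K" "\<And>x. x \<notin> K \<Longrightarrow> Z x = 0"
  shows "(LINT x|lborel. \<D> Z x e) = 0"
proof -
  let ?g = "\<lambda>x. \<D> Z x e"
  have g0: "?g x = 0" if "x \<notin> K" for x
  proof -
    have "open (- K)" using K by (simp add: compact_imp_closed open_Compl)
    then have "\<D> Z x = \<D> (\<lambda>x. 0) x"
      using frechet_derivative_transform_within_open[OF C1_differentiable[OF Z], of x "- K" "\<lambda>x. 0"] K that
      by auto
    then show ?thesis by simp
  qed
  have contg: "continuous_on UNIV ?g" by (rule C1_continuous_D[OF Z])
  obtain B where B: "\<And>x. \<bar>?g x\<bar> \<le> B"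
  proof -
    have "bounded (?g ` K)"
      by (intro compact_imp_bounded compact_continuous_image K continuous_on_subset[OF contg]) auto
    then obtain B where "\<And>x. x \<in> K \<Longrightarrow> \<bar>?g x\<bar> \<le> B" unfolding bounded_iff by auto
    then have "\<bar>?g x\<bar> \<le> max B 0" for x using g0[of x] by (cases "x \<in> K") force+
    then show thesis by (rule that)
  qed
  obtain R where R: "R > 0" "K \<subseteq> ball 0 R"
    using bounded_subset_ballD[OF compact_imp_bounded[OF K(1)], of 0] by auto
  define h where "h n = inverse (real (Suc n))" for n
  have h: "0 < h n" "h n \<le> 1" for n by (auto simp: h_def field_simps)
  have hlim: "h \<longlonglongrightarrow> 0" unfolding h_def by (rule LIMSEQ_inverse_real_of_nat)
  let ?s = "\<lambda>n x. (Z (x + h n *\<^sub>R e) - Z x) / h n"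
  have Zint: "integrable lborel Z"
  proof -
    have "integrable lborel (\<lambda>x. indicator K x *\<^sub>R Z x)"
      by (intro borel_integrable_compact K continuous_on_subset[OF C1_continuous[OF Z]]) auto
    moreover have "(\<lambda>x. indicator K x *\<^sub>R Z x) = Z" using K(2) by (auto simp: fun_eq_iff indicator_def)
    ultimately show ?thesis by (simp only:)
  qed
  have Zm: "Z \<in> borel_measurable borel"
    by (intro borel_measurable_continuous_onI C1_continuous[OF Z])
  have shift_int: "integrable lborel (\<lambda>x. Z (c + x))" for c
    using Zint lborel_distr_plus[of c] integrable_distr_eq[of "(+) c" lborel borel Z] Zm by auto
  have shift: "(LINT x|lborel. Z (c + x)) = (LINT x|lborel. Z x)" for c
    using lborel_distr_plus[of c] integral_distr[of "(+) c" lborel borel Z] Zm by auto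
  have s0: "integral\<^sup>L lborel (?s n) = 0" for n
  proof -
    have "(LINT x|lborel. Z (h n *\<^sub>R e + x) - Z x) = 0"
      using shift_int[of "h n *\<^sub>R e"] Zint shift[of "h n *\<^sub>R e"] by simp
    then show ?thesis by (simp add: add.commute)
  qed
  \<comment> \<open>All step sizes are at most 1, so the quotients vanish off the ball of radius
    \<open>R + norm e\<close>; by the mean value theorem each quotient is a value of the derivative,
    hence bounded by B.\<close>
  have lim: "(\<lambda>n. integral\<^sup>L lborel (?s n)) \<longlonglongrightarrow> integral\<^sup>L lborel ?g"
  proof (rule integral_dominated_convergence[where w = "\<lambda>x. indicator (cball 0 (R + norm e)) x *\<^sub>R B"])
    show "?g \<in> borel_measurable lborel" using borel_measurable_continuous_onI[OF contg] by simp
    show "?s n \<in> borel_measurable lborel" for n using Zm by simp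
    show "integrable lborel (\<lambda>x. indicator (cball 0 (R + norm e)) x *\<^sub>R B)"
      by (intro borel_integrable_compact) auto
    show "AE x in lborel. (\<lambda>n. ?s n x) \<longlonglongrightarrow> ?g x"
    proof (rule AE_I2)
      fix x
      have 1: "((\<lambda>t. x + t *\<^sub>R e) has_derivative (\<lambda>s. s *\<^sub>R e)) (at 0)"
        by (auto intro!: derivative_eq_intros)
      have 2: "(Z has_derivative \<D> Z x) (at (x + 0 *\<^sub>R e))" using C1_has_D[OF Z, of x] by simp
      have "((\<lambda>t. Z (x + t *\<^sub>R e)) has_derivative (\<lambda>s. \<D> Z x (s *\<^sub>R e))) (at 0)"
        using has_derivative_compose[OF 1 2] .
      moreover have "\<D> Z x (s *\<^sub>R e) = ?g x * s" for s
        using linear_scale[OF linear_frechet_derivative[OF C1_differentiable[OF Z]]] by simp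
      ultimately have "((\<lambda>t. Z (x + t *\<^sub>R e)) has_real_derivative ?g x) (at 0)"
        by (simp add: has_field_derivative_def)
      then have *: "(\<lambda>t. (Z (x + t *\<^sub>R e) - Z x) / t) \<midarrow>0\<rightarrow> ?g x"
        by (simp add: DERIV_def)
      have "filterlim h (at 0) sequentially"
        unfolding filterlim_at using hlim h(1) by (auto simp: less_imp_neq[symmetric] intro!: always_eventually)
      then show "(\<lambda>n. ?s n x) \<longlonglongrightarrow> ?g x"
        using filterlim_compose[OF *, of h sequentially] by blast
    qed
    show "AE x in lborel. norm (?s n x) \<le> indicator (cball 0 (R + norm e)) x *\<^sub>R B" for n
    proof (rule AE_I2)
      fix x
      show "norm (?s n x) \<le> indicator (cball 0 (R + norm e)) x *\<^sub>R B"
      proof (cases "x \<in> cball 0 (R + norm e)")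
        case True
        have "norm (h n *\<^sub>R e) \<le> norm e" using h[of n] by (simp add: mult_left_le_one_le)
        then have "x + h n *\<^sub>R e \<in> ball x (norm e + 1)" by (simp add: dist_norm)
        moreover have "x \<in> ball x (norm e + 1)" using norm_ge_zero[of e] unfolding centre_in_ball by linarith
        ultimately obtain t where "Z (x + h n *\<^sub>R e) - Z x = h n * \<D> Z (x + t *\<^sub>R e) e"
          using mvt_ball[of x "norm e + 1" Z x "h n" e] C1_differentiable[OF Z] h by blast
        then have "?s n x = ?g (x + t *\<^sub>R e)" using h[of n] by simp
        then show ?thesis using True B by simp
      next
        case False
        have n: "norm x > R + norm e" using False by simp
        have "norm (h n *\<^sub>R e) \<le> norm e" using h[of n] by (simp add: mult_left_le_one_le)
        moreover have "norm x \<le> norm (x + h n *\<^sub>R e) + norm (h n *\<^sub>R e)"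
          using norm_triangle_ineq4[of "x + h n *\<^sub>R e" "h n *\<^sub>R e"] by simp
        ultimately have "norm (x + h n *\<^sub>R e) > R" using n by linarith
        moreover have "norm x > R" using n norm_ge_zero[of e] by linarith
        ultimately have "x + h n *\<^sub>R e \<notin> K" "x \<notin> K" using R(2) by (auto dest!: subsetD)
        then have "Z (x + h n *\<^sub>R e) = 0" "Z x = 0" by (simp_all add: K(2))
        then show ?thesis using False by simp
      qed
    qed
  qed
  show ?thesis by (rule LIMSEQ_unique[OF lim[unfolded s0] tendsto_const])
qed

definition divergence :: "(real ^ 'n \<Rightarrow> real ^ 'n) \<Rightarrow> real ^ 'n \<Rightarrow> real" where
  "divergence Z x = (\<Sum>i\<in>UNIV. \<D> Z x (axis i 1) $ i)"

lemma set_integrable_compact_support: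
  fixes f :: "'a::euclidean_space \<Rightarrow> real"
  assumes "continuous_on W f" "compact K" "K \<subseteq> W" "\<And>x. x \<in> W - K \<Longrightarrow> f x = 0"
  shows "set_integrable lborel W f"
proof -
  have "integrable lborel (\<lambda>x. indicator K x *\<^sub>R f x)"
    by (intro borel_integrable_compact assms continuous_on_subset[OF assms(1)])
  moreover have "(\<lambda>x. indicator K x *\<^sub>R f x) = (\<lambda>x. indicator W x *\<^sub>R f x)"
    using assms(3,4) by (auto simp: fun_eq_iff indicator_def)
  ultimately show ?thesis by (simp only: set_integrable_def)
qed

text \<open>Each component, extended by zero, is C1 on the whole space because the open sets W and
  -K cover it; then \<open>integral_directional_derivative\<close> applies in each coordinate
  direction.\<close>

lemma integral_divergence_zero:
  fixes Z :: "real ^ 'n \<Rightarrow> real ^ 'n"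
  assumes W: "open W" and Z: "C1_on Z W" and K: "compact K" "K \<subseteq> W" "\<And>x. x \<in> W - K \<Longrightarrow> Z x = 0"
  shows "(LINT x:W|lborel. divergence Z x) = 0"
proof -
  let ?Z = "\<lambda>i x. if x \<in> W then Z x $ i else 0"
  have "open (- K)" using K by (simp add: compact_imp_closed open_Compl)
  have Zi: "(?Z i has_derivative (\<lambda>v. if x \<in> W then \<D> Z x v $ i else 0)) (at x)" for i x
  proof (cases "x \<in> W")
    case True
    have "((\<lambda>x. Z x $ i) has_derivative (\<lambda>v. \<D> Z x v $ i)) (at x)"
      by (rule bounded_linear.has_derivative[OF bounded_linear_vec_nth C1_has_D[OF Z True]])
    from has_derivative_transform_within_open[OF this W True, of "?Z i"] show ?thesis
      using True by simp
  next
    case False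
    have z: "((\<lambda>x. 0::real) has_derivative (\<lambda>v. 0)) (at x)" by simp
    have "(?Z i has_derivative (\<lambda>v. 0)) (at x)"
      by (rule has_derivative_transform_within_open[OF z \<open>open (- K)\<close>]) (use False K in auto)
    then show ?thesis using False by simp
  qed
  have DZ0: "\<D> Z x = (\<lambda>v. 0)" if "x \<in> W - K" for x
  proof -
    have "open (W - K)" using W K by (simp add: compact_imp_closed open_Diff)
    then have "\<D> Z x = \<D> (\<lambda>x. 0) x"
      using frechet_derivative_transform_within_open[OF C1_differentiable[OF Z], of x "W - K" "\<lambda>x. 0"] K that
      by auto
    then show ?thesis by simp
  qed
  have cont: "continuous_on UNIV (\<lambda>x. if x \<in> W then \<D> Z x v $ i else 0)" for i v
  proof -
    have "continuous_on (W \<union> - K) (\<lambda>x. if x \<in> W then \<D> Z x v $ i else 0)"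
    proof (rule continuous_on_open_Un[OF W \<open>open (- K)\<close>])
      show "continuous_on W (\<lambda>x. if x \<in> W then \<D> Z x v $ i else 0)"
        using continuous_on_component[OF C1_continuous_D[OF Z, of v], of i] by (simp cong: continuous_on_cong)
      show "continuous_on (- K) (\<lambda>x. if x \<in> W then \<D> Z x v $ i else 0)"
        using DZ0 by (auto intro!: continuous_on_eq[OF continuous_on_const[of _ 0]])
    qed
    moreover have "W \<union> - K = UNIV" using K by auto
    ultimately show ?thesis by simp
  qed
  have C1: "C1_on (?Z i) UNIV" for i
    by (rule C1_onI[OF Zi cont])
  have "(LINT x|lborel. \<D> (?Z i) x (axis i 1)) = 0" for i
    by (rule integral_directional_derivative[OF C1 K(1)]) (use K in auto)
  then have z: "(LINT x|lborel. (if x \<in> W then \<D> Z x (axis i 1) $ i else 0)) = 0" for i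
    using D_eq[OF Zi] by simp
  have int: "integrable lborel (\<lambda>x. if x \<in> W then \<D> Z x (axis i 1) $ i else 0)" for i
  proof -
    have "set_integrable lborel W (\<lambda>x. \<D> Z x (axis i 1) $ i)"
      by (intro set_integrable_compact_support[OF _ K(1,2)] continuous_on_component C1_continuous_D Z)
        (simp add: DZ0)
    moreover have "indicator W x *\<^sub>R \<D> Z x (axis i 1) $ i = (if x \<in> W then \<D> Z x (axis i 1) $ i else 0)" for x
      by simp
    ultimately show ?thesis unfolding set_integrable_def by simp
  qed
  have "(LINT x:W|lborel. divergence Z x) = (LINT x|lborel. (\<Sum>i\<in>UNIV. if x \<in> W then \<D> Z x (axis i 1) $ i else 0))"
    unfolding set_lebesgue_integral_def divergence_def
    by (intro Bochner_Integration.integral_cong) (auto simp: indicator_def)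
  also have "\<dots> = 0" using z int by simp
  finally show ?thesis .
qed

text \<open>The integrand is wrapped as a vector in \<open>real ^ 1\<close> to fit
  \<open>has_absolute_integral_change_of_variables\<close>.\<close>

lemma integral_change_of_variables_scalar:
  fixes f :: "real ^ 'm::{finite,wellorder} \<Rightarrow> real" and g :: "real ^ 'm::_ \<Rightarrow> real ^ 'm::_"
  assumes S: "S \<in> sets lebesgue"
    and der: "\<And>x. x \<in> S \<Longrightarrow> (g has_derivative g' x) (at x within S)"
    and inj: "inj_on g S"
    and f: "f absolutely_integrable_on g ` S"
  shows "integral (g ` S) f = integral S (\<lambda>x. \<bar>det (matrix (g' x))\<bar> * f (g x))"
proof -
  let ?F = "\<lambda>x. (\<chi> i. f x) :: real ^ 1"
  have bl: "bounded_linear (\<lambda>y::real. (\<chi> i. y) :: real ^ 1)"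
    by (simp add: linear_conv_bounded_linear[symmetric] linearI vec_eq_iff)
  have F: "?F absolutely_integrable_on g ` S"
    using absolutely_integrable_linear[OF f bl] by (simp add: o_def)
  have "(\<lambda>x. \<bar>det (matrix (g' x))\<bar> *\<^sub>R ?F (g x)) absolutely_integrable_on S \<and>
      integral S (\<lambda>x. \<bar>det (matrix (g' x))\<bar> *\<^sub>R ?F (g x)) = integral (g ` S) ?F"
    using has_absolute_integral_change_of_variables[OF S der inj, of ?F] F by blast
  then have 1: "(\<lambda>x. \<bar>det (matrix (g' x))\<bar> *\<^sub>R ?F (g x)) integrable_on S"
    "integral S (\<lambda>x. \<bar>det (matrix (g' x))\<bar> *\<^sub>R ?F (g x)) $ 1 = integral (g ` S) ?F $ 1"
    using set_lebesgue_integral_eq_integral(1) by auto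
  have 2: "?F integrable_on g ` S" using F set_lebesgue_integral_eq_integral(1) by blast
  show ?thesis
    using 1(2) integral_component_eq_cart[OF 1(1), of 1] integral_component_eq_cart[OF 2, of 1] by simp
qed

lemma set_integral_eq_on_subset:
  fixes f :: "'a::euclidean_space \<Rightarrow> real"
  assumes f: "set_integrable lborel W f" and V: "V \<subseteq> W" "\<And>x. x \<in> W - V \<Longrightarrow> f x = 0"
  shows "f absolutely_integrable_on V" "integral V f = (LINT x:W|lborel. f x)"
proof -
  have eq: "(\<lambda>x. indicator W x *\<^sub>R f x) = (\<lambda>x. indicator V x *\<^sub>R f x)"
    using V by (auto simp: fun_eq_iff indicator_def)
  have i: "integrable lborel (\<lambda>x. indicator V x *\<^sub>R f x)"
    using f unfolding set_integrable_def eq .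
  then show "f absolutely_integrable_on V"
    unfolding set_integrable_def by (rule integrable_completion[THEN iffD2, rotated]) (use i in auto)
  have "integral V f = integral UNIV (\<lambda>x. indicator V x *\<^sub>R f x)"
    unfolding indicator_scaleR_eq_if by (simp only: integral_restrict_UNIV)
  also have "\<dots> = (LINT x|lborel. indicator V x *\<^sub>R f x)" by (rule integral_lborel[OF i])
  finally show "integral V f = (LINT x:W|lborel. f x)"
    unfolding set_lebesgue_integral_def eq .
qed

text \<open>Made for transition maps, which exist only on an overlap: U lies in one parameter
  domain, its image in the other, and both integrands vanish off the overlap, so the integrals can
  run over the full domains.\<close>

lemma set_integral_change_of_variables:
  fixes f :: "real ^ 'm::{finite,wellorder} \<Rightarrow> real"
  assumes f: "set_integrable lborel W f" and f': "set_integrable lborel W' f'"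
    and U: "open U" "U \<subseteq> W" "\<And>x. x \<in> W - U \<Longrightarrow> f x = 0"
    and der: "\<And>x. x \<in> U \<Longrightarrow> (g has_derivative g' x) (at x)"
    and inj: "inj_on g U"
    and V: "g ` U \<subseteq> W'" "\<And>x. x \<in> W' - g ` U \<Longrightarrow> f' x = 0"
    and eq: "\<And>x. x \<in> U \<Longrightarrow> f x = \<bar>det (matrix (g' x))\<bar> * f' (g x)"
  shows "(LINT x:W|lborel. f x) = (LINT x:W'|lborel. f' x)"
proof -
  have "integral (g ` U) f' = integral U (\<lambda>x. \<bar>det (matrix (g' x))\<bar> * f' (g x))"
  proof (rule integral_change_of_variables_scalar[OF _ _ inj set_integral_eq_on_subset(1)[OF f' V]])
    show "U \<in> sets lebesgue" using U(1) by (rule borel_open[THEN sets_completionI_sets[of _ lborel, unfolded sets_lborel]])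
    show "(g has_derivative g' x) (at x within U)" if "x \<in> U" for x
      using der[OF that] by (rule has_derivative_at_withinI)
  qed
  also have "\<dots> = integral U f" by (rule integral_cong) (simp only: eq)
  finally show ?thesis
    using set_integral_eq_on_subset(2)[OF f U(2,3)] set_integral_eq_on_subset(2)[OF f' V] by simp
qed

lemma linear_axis_sum:
  fixes v :: "real ^ 'n"
  assumes "linear l"
  shows "l v = (\<Sum>i\<in>UNIV. v $ i *\<^sub>R l (axis i 1))"
proof -
  have "v = (\<Sum>i\<in>UNIV. v $ i *\<^sub>R axis i 1)"
    by (simp add: vec_eq_iff axis_def if_distrib cong: if_cong)
  then have "l v = l (\<Sum>i\<in>UNIV. v $ i *\<^sub>R axis i 1)" by (rule arg_cong)
  then show ?thesis using assms by (simp add: linear_sum linear_scale)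
qed

lemma divergence_scaleR:
  fixes f :: "real ^ 'n \<Rightarrow> real" and Z :: "real ^ 'n \<Rightarrow> real ^ 'n"
  assumes "f differentiable (at u)" "Z differentiable (at u)"
  shows "divergence (\<lambda>u. f u *\<^sub>R Z u) u = f u * divergence Z u + \<D> f u (Z u)"
proof -
  have "\<D> (\<lambda>u. f u *\<^sub>R Z u) u v = f u *\<^sub>R \<D> Z u v + \<D> f u v *\<^sub>R Z u" for v
    using D_eq[OF has_derivative_scaleR[OF has_D[OF assms(1)] has_D[OF assms(2)]]] by simp
  then have "divergence (\<lambda>u. f u *\<^sub>R Z u) u = f u * divergence Z u + (\<Sum>i\<in>UNIV. \<D> f u (axis i 1) * Z u $ i)"
    by (simp add: divergence_def sum.distrib sum_distrib_left)
  moreover have "(\<Sum>i\<in>UNIV. \<D> f u (axis i 1) * Z u $ i) = \<D> f u (Z u)"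
  proof -
    have l: "linear (\<D> f u)" using assms(1) by (rule linear_frechet_derivative)
    have "\<D> f u (Z u) = (\<Sum>i\<in>UNIV. Z u $ i *\<^sub>R \<D> f u (axis i 1))"
      by (rule linear_axis_sum[OF l])
    then show ?thesis by (simp add: mult.commute)
  qed
  ultimately show ?thesis by simp
qed

text \<open>A point of positivity would give a nonempty open set of positivity, which cannot be
  null.\<close>

lemma set_integral_nonneg_eq_0:
  fixes f :: "'a::euclidean_space \<Rightarrow> real"
  assumes W: "open W" and f: "set_integrable lborel W f" "continuous_on W f" "\<And>x. x \<in> W \<Longrightarrow> 0 \<le> f x"
    and 0: "(LINT x:W|lborel. f x) = 0" and x: "x \<in> W"
  shows "f x = 0"
proof (rule ccontr)
  assume "f x \<noteq> 0"
  then have "f x > 0" using f(3)[OF x] by simp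
  define S where "S = {x \<in> W. f x \<in> {0<..}}"
  have S: "open S" "S \<noteq> {}"
    unfolding S_def using continuous_open_preimage[OF f(2) W, of "{0<..}"] x \<open>f x > 0\<close>
    by (auto simp: Int_def vimage_def)
  have "AE x in lborel. indicator W x *\<^sub>R f x = 0"
    using integral_nonneg_eq_0_iff_AE[of lborel "\<lambda>x. indicator W x *\<^sub>R f x"] f(1,3) 0
    unfolding set_integrable_def set_lebesgue_integral_def by (auto simp: indicator_def)
  then have "AE x in lborel. x \<notin> S"
    by eventually_elim (auto simp: S_def)
  then have "AE x in lebesgue. x \<notin> S" by (rule AE_completion)
  then have "S \<in> null_sets lebesgue"
    using S(1) by (intro AE_iff_null_sets[THEN iffD2]) auto
  then show False using open_not_negligible[OF S] negligible_iff_null_sets by blast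
qed

lemma set_integral_sum_real:
  fixes f :: "'i \<Rightarrow> 'a \<Rightarrow> real"
  assumes "\<And>j. j \<in> I \<Longrightarrow> set_integrable M A (f j)"
  shows "(LINT x:A|M. (\<Sum>j\<in>I. f j x)) = (\<Sum>j\<in>I. LINT x:A|M. f j x)"
proof -
  have "(LINT x:A|M. (\<Sum>j\<in>I. f j x)) = (LINT x|M. (\<Sum>j\<in>I. indicator A x *\<^sub>R f j x))"
    unfolding set_lebesgue_integral_def by (simp only: scaleR_sum_right)
  also have "\<dots> = (\<Sum>j\<in>I. LINT x:A|M. f j x)"
    using assms unfolding set_lebesgue_integral_def set_integrable_def
    by (intro Bochner_Integration.integral_sum)
  finally show ?thesis .
qed

text \<open>
  \<open>Z i\<close> is a vector density in the parametrization \<open>\<psi> i\<close>, whence the Jacobian in its transformation law. With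
  the partition of unity \<open>\<phi>\<close>, the integrals of \<open>\<phi> i * div (Z i)\<close> sum up to minus the integrals of \<open>D (\<phi> i) (Z i)\<close>;
  those cancel because \<open>\<Sum>i. \<phi> i\<close> is constant, once a change of variables has moved them into common charts.
\<close>
lemma closed_surface_divergence:
  fixes \<psi> :: "'i \<Rightarrow> real ^ 'm::{finite,wellorder} \<Rightarrow> 'p" and \<phi> :: "'i \<Rightarrow> 'p \<Rightarrow> real"
    and Z :: "'i \<Rightarrow> real ^ 'm::_ \<Rightarrow> real ^ 'm::_"
  assumes fin: "finite I" and W: "\<And>i. i \<in> I \<Longrightarrow> open (W i)" and inj: "\<And>i. i \<in> I \<Longrightarrow> inj_on (\<psi> i) (W i)"
    and Z: "\<And>i. i \<in> I \<Longrightarrow> C1_on (Z i) (W i)"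
    and K: "\<And>i. i \<in> I \<Longrightarrow> compact (K i)" "\<And>i. i \<in> I \<Longrightarrow> K i \<subseteq> W i"
    and \<phi>0: "\<And>i p. i \<in> I \<Longrightarrow> 0 \<le> \<phi> i p"
    and \<phi>1: "\<And>j u. j \<in> I \<Longrightarrow> u \<in> W j \<Longrightarrow> (\<Sum>i\<in>I. \<phi> i (\<psi> j u)) = 1"
    and \<phi>K: "\<And>i j u. i \<in> I \<Longrightarrow> j \<in> I \<Longrightarrow> u \<in> W j \<Longrightarrow> \<phi> i (\<psi> j u) \<noteq> 0 \<Longrightarrow> \<psi> j u \<in> \<psi> i ` K i"
    and \<phi>C1: "\<And>i j. i \<in> I \<Longrightarrow> j \<in> I \<Longrightarrow> C1_on (\<lambda>u. \<phi> i (\<psi> j u)) (W j)"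
    and ov: "\<And>i j. i \<in> I \<Longrightarrow> j \<in> I \<Longrightarrow> open {u \<in> W i. \<psi> i u \<in> \<psi> j ` W j}"
    and tr: "\<And>i j u v. \<lbrakk>i \<in> I; j \<in> I; u \<in> W i; v \<in> W j; \<psi> i u = \<psi> j v\<rbrakk> \<Longrightarrow>
      \<exists>D. ((\<lambda>u. inv_into (W j) (\<psi> j) (\<psi> i u)) has_derivative D) (at u) \<and>
          D (Z i u) = \<bar>det (matrix D)\<bar> *\<^sub>R Z j v"
    and pos: "\<And>i u. i \<in> I \<Longrightarrow> u \<in> W i \<Longrightarrow> 0 \<le> divergence (Z i) u"
    and i: "i \<in> I" "u \<in> W i" "\<phi> i (\<psi> i u) \<noteq> 0"
  shows "divergence (Z i) u = 0"
proof -
  define d where "d i j u = \<D> (\<lambda>u. \<phi> i (\<psi> j u)) u (Z j u)" for i j u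
  have inK: "u \<in> K i" if "i \<in> I" "u \<in> W i" "\<phi> i (\<psi> i u) \<noteq> 0" for i u
  proof -
    have "\<psi> i u \<in> \<psi> i ` K i" by (rule \<phi>K[OF that(1,1,2,3)])
    then obtain v where "v \<in> K i" "\<psi> i u = \<psi> i v" by auto
    moreover have "v \<in> W i" using K(2)[OF that(1)] \<open>v \<in> K i\<close> by blast
    ultimately show ?thesis using inj_onD[OF inj[OF that(1)], of u v] that(2) by simp
  qed
  \<comment> \<open>\<open>\<phi> i\<close> is nonnegative, so each of its zeros is a minimum and
    the derivative vanishes there. Hence \<open>d\<close> inherits the supports of the
    partition.\<close>
  have d0: "d i j u = 0" if h: "i \<in> I" "j \<in> I" "u \<in> W j" "\<phi> i (\<psi> j u) = 0" for i j u
  proof -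
    have "\<D> (\<lambda>u. \<phi> i (\<psi> j u)) u = (\<lambda>v. 0)"
      using differential_zero_maxmin[OF that(3) W[OF that(2)] C1_has_D[OF \<phi>C1[OF that(1,2)] that(3)]]
        that(4) \<phi>0[OF that(1)] by simp
    then show ?thesis by (simp add: d_def)
  qed
  have dcont: "continuous_on (W j) (d i j)" if "i \<in> I" "j \<in> I" for i j
    unfolding d_def
    by (rule C1_continuous_D_joint[OF \<phi>C1[OF that] continuous_on_id C1_continuous[OF Z[OF that(2)]]]) auto
  have divcont: "continuous_on (W i) (divergence (Z i))" if "i \<in> I" for i
    unfolding divergence_def by (intro continuous_intros C1_continuous_D Z that)
  have int1: "set_integrable lborel (W j) (\<lambda>u. \<phi> j (\<psi> j u) * d i j u)" if "i \<in> I" "j \<in> I" for i j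
    by (rule set_integrable_compact_support[OF _ K[OF that(2)]])
      (auto intro!: continuous_intros dcont C1_continuous[OF \<phi>C1] that dest: inK[OF that(2)])
  have int2: "set_integrable lborel (W i) (\<lambda>u. \<phi> j (\<psi> i u) * d i i u)" if "i \<in> I" "j \<in> I" for i j
    by (rule set_integrable_compact_support[OF _ K[OF that(1)]])
      (auto intro!: continuous_intros dcont C1_continuous[OF \<phi>C1] that d0 dest: inK[OF that(1)])
  have int3: "set_integrable lborel (W i) (\<lambda>u. \<phi> i (\<psi> i u) * divergence (Z i) u)" if "i \<in> I" for i
    by (rule set_integrable_compact_support[OF _ K[OF that(1)]])
      (auto intro!: continuous_intros divcont C1_continuous[OF \<phi>C1] that dest: inK[OF that(1)])
  have int4: "set_integrable lborel (W i) (d i i)" if "i \<in> I" for i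
    by (rule set_integrable_compact_support[OF dcont K[OF that(1)]])
      (auto intro!: that d0 dest: inK[OF that(1)])
  \<comment> \<open>On the overlap the derivative of \<open>\<phi> i\<close> transforms as a
    covector and Z as a density, so their pairing acquires exactly the factor |det| of the change of
    variables.\<close>
  have cov: "(LINT u:W i|lborel. \<phi> j (\<psi> i u) * d i i u) = (LINT v:W j|lborel. \<phi> j (\<psi> j v) * d i j v)"
    if ij: "i \<in> I" "j \<in> I" for i j
  proof -
    define g where "g u = inv_into (W j) (\<psi> j) (\<psi> i u)" for u
    define U where "U = {u \<in> W i. \<psi> i u \<in> \<psi> j ` W j}"
    have U: "open U" "U \<subseteq> W i" unfolding U_def by (rule ov[OF ij]) auto
    have g: "g u \<in> W j" "\<psi> j (g u) = \<psi> i u" if "u \<in> U" for u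
      using that by (auto simp: U_def g_def inv_into_into f_inv_into_f)
    have gv: "g u = v" if "u \<in> W i" "v \<in> W j" "\<psi> i u = \<psi> j v" for u v
      using that inj[OF ij(2)] by (simp add: g_def inv_into_f_f)
    have gD: "(g has_derivative \<D> g u) (at u)" "\<D> g u (Z i u) = \<bar>det (matrix (\<D> g u))\<bar> *\<^sub>R Z j (g u)"
      if "u \<in> U" for u
    proof -
      have "\<exists>D. (g has_derivative D) (at u) \<and> D (Z i u) = \<bar>det (matrix D)\<bar> *\<^sub>R Z j (g u)"
        using tr[OF ij _ g(1)[OF that] g(2)[OF that, symmetric]] that U unfolding g_def[abs_def] by auto
      then obtain D where D: "(g has_derivative D) (at u)" "D (Z i u) = \<bar>det (matrix D)\<bar> *\<^sub>R Z j (g u)"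
        by auto
      then show "(g has_derivative \<D> g u) (at u)" "\<D> g u (Z i u) = \<bar>det (matrix (\<D> g u))\<bar> *\<^sub>R Z j (g u)"
        using D_eq[OF D(1)] by auto
    qed
    show ?thesis
    proof (rule set_integral_change_of_variables[OF int2[OF ij] int1[OF ij] U, where g = g and g' = "\<D> g"])
      fix u assume "u \<in> W i - U"
      then have "\<phi> j (\<psi> i u) = 0" using \<phi>K[OF ij(2,1), of u] K(2)[OF ij(2)] by (auto simp: U_def)
      then show "\<phi> j (\<psi> i u) * d i i u = 0" by simp
    next
      show "inj_on g U"
      proof (rule inj_onI)
        fix u u' assume "u \<in> U" "u' \<in> U" "g u = g u'"
        then have "\<psi> i u = \<psi> i u'" using g(2) by metis
        then show "u = u'" using inj_onD[OF inj[OF ij(1)]] U \<open>u \<in> U\<close> \<open>u' \<in> U\<close> by blast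
      qed
      show "g ` U \<subseteq> W j" using g by auto
    next
      fix v assume v: "v \<in> W j - g ` U"
      have "\<phi> i (\<psi> j v) = 0"
      proof (rule ccontr)
        assume "\<phi> i (\<psi> j v) \<noteq> 0"
        then obtain u where u: "u \<in> K i" "\<psi> j v = \<psi> i u" using \<phi>K[OF ij, of v] v by auto
        then have "u \<in> W i" using K(2)[OF ij(1)] by blast
        then have "g u = v" using gv[of u v] u v by simp
        moreover have "u \<in> U" unfolding U_def using \<open>u \<in> W i\<close> v u(2)[symmetric] by auto
        ultimately have "v \<in> g ` U" by blast
        then show False using v by auto
      qed
      then show "\<phi> j (\<psi> j v) * d i j v = 0" using d0[OF ij] v by simp
    next
      fix u assume u: "u \<in> U"
      show "(g has_derivative \<D> g u) (at u)" by (rule gD[OF u])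
      have fd: "(\<lambda>u. \<phi> i (\<psi> j u)) differentiable (at (g u))"
        by (rule C1_differentiable[OF \<phi>C1[OF ij] g(1)[OF u]])
      have gd: "g differentiable (at u)" using gD(1)[OF u] by (rule differentiableI)
      have "\<D> (\<lambda>u. \<phi> i (\<psi> i u)) u = \<D> (\<lambda>u. \<phi> i (\<psi> j (g u))) u"
        by (rule frechet_derivative_transform_within_open[OF C1_differentiable[OF \<phi>C1[OF ij(1,1)]] U(1) u])
          (use u U g in auto)
      then have "d i i u = \<D> (\<lambda>u. \<phi> i (\<psi> j u)) (g u) (\<D> g u (Z i u))"
        unfolding d_def using D_compose[OF fd gd] by simp
      also have "\<dots> = \<bar>det (matrix (\<D> g u))\<bar> * d i j (g u)"
        unfolding gD(2)[OF u] d_def using linear_scale[OF linear_frechet_derivative[OF fd]] by simp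
      finally show "\<phi> j (\<psi> i u) * d i i u = \<bar>det (matrix (\<D> g u))\<bar> * (\<phi> j (\<psi> j (g u)) * d i j (g u))"
        using g(2)[OF u] by simp
    qed
  qed
  have div: "(LINT u:W i|lborel. \<phi> i (\<psi> i u) * divergence (Z i) u) = - (LINT u:W i|lborel. d i i u)"
    if i: "i \<in> I" for i
  proof -
    have "(LINT u:W i|lborel. divergence (\<lambda>u. \<phi> i (\<psi> i u) *\<^sub>R Z i u) u) = 0"
      by (rule integral_divergence_zero[OF W[OF i] C1_scaleR[OF \<phi>C1[OF i i] Z[OF i]] K[OF i]])
        (use inK[OF i] in auto)
    also have "(LINT u:W i|lborel. divergence (\<lambda>u. \<phi> i (\<psi> i u) *\<^sub>R Z i u) u) =
      (LINT u:W i|lborel. \<phi> i (\<psi> i u) * divergence (Z i) u + d i i u)"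
    proof (rule set_lebesgue_integral_cong)
      show "W i \<in> sets lborel" using W[OF i] by simp
      show "\<forall>u. u \<in> W i \<longrightarrow> divergence (\<lambda>u. \<phi> i (\<psi> i u) *\<^sub>R Z i u) u = \<phi> i (\<psi> i u) * divergence (Z i) u + d i i u"
        unfolding d_def
        using divergence_scaleR C1_differentiable[OF \<phi>C1[OF i i]] C1_differentiable[OF Z[OF i]] by blast
    qed
    finally show ?thesis
      unfolding set_integral_add(2)[OF int3[OF i] int4[OF i]] by linarith
  qed
  \<comment> \<open>The factor 1 is replaced by the sum of all \<open>\<phi> j\<close>, so that
    every summand is supported in an overlap and can be moved to the parametrisation j.\<close>
  have split: "(LINT u:W i|lborel. d i i u) = (\<Sum>j\<in>I. LINT u:W i|lborel. \<phi> j (\<psi> i u) * d i i u)" if i: "i \<in> I" for i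
  proof -
    have "(LINT u:W i|lborel. d i i u) = (LINT u:W i|lborel. (\<Sum>j\<in>I. \<phi> j (\<psi> i u) * d i i u))"
    proof (rule set_lebesgue_integral_cong)
      show "W i \<in> sets lborel" using W[OF i] by simp
      show "\<forall>u. u \<in> W i \<longrightarrow> d i i u = (\<Sum>j\<in>I. \<phi> j (\<psi> i u) * d i i u)"
        using \<phi>1[OF i] by (simp add: sum_distrib_right[symmetric])
    qed
    also have "\<dots> = (\<Sum>j\<in>I. LINT u:W i|lborel. \<phi> j (\<psi> i u) * d i i u)"
      by (rule set_integral_sum_real[OF int2[OF i]])
    finally show ?thesis .
  qed
  \<comment> \<open>In one parametrisation j the derivatives of all \<open>\<phi> i\<close> act on
    the same field \<open>Z j\<close>, and their sum is the derivative of the constant 1.\<close>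
  have dsum: "(\<Sum>i\<in>I. d i j v) = 0" if "j \<in> I" "v \<in> W j" for j v
  proof -
    have "((\<lambda>u. \<Sum>i\<in>I. \<phi> i (\<psi> j u)) has_derivative (\<lambda>x. \<Sum>i\<in>I. \<D> (\<lambda>u. \<phi> i (\<psi> j u)) v x)) (at v)"
      by (intro has_derivative_sum C1_has_D[OF \<phi>C1 that(2)] that)
    then have "((\<lambda>u. 1) has_derivative (\<lambda>x. \<Sum>i\<in>I. \<D> (\<lambda>u. \<phi> i (\<psi> j u)) v x)) (at v)"
      by (rule has_derivative_transform_within_open[OF _ W[OF that(1)] that(2)]) (use \<phi>1[OF that(1)] in auto)
    from D_eq[OF this] show ?thesis by (simp add: d_def fun_eq_iff)
  qed
  have sum0: "(\<Sum>i\<in>I. LINT v:W j|lborel. \<phi> j (\<psi> j v) * d i j v) = 0" if j: "j \<in> I" for j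
  proof -
    have "(\<Sum>i\<in>I. LINT v:W j|lborel. \<phi> j (\<psi> j v) * d i j v) = (LINT v:W j|lborel. (\<Sum>i\<in>I. \<phi> j (\<psi> j v) * d i j v))"
      by (rule set_integral_sum_real[symmetric, OF int1[OF _ j]])
    also have "\<dots> = (LINT v:W j|lborel. 0)"
    proof (rule set_lebesgue_integral_cong)
      show "W j \<in> sets lborel" using W[OF j] by simp
      show "\<forall>v. v \<in> W j \<longrightarrow> (\<Sum>i\<in>I. \<phi> j (\<psi> j v) * d i j v) = 0"
        using dsum[OF j] by (simp add: sum_distrib_left[symmetric])
    qed
    finally show ?thesis by (simp add: set_lebesgue_integral_def)
  qed
  let ?J = "\<lambda>i. LINT u:W i|lborel. \<phi> i (\<psi> i u) * divergence (Z i) u"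
  have J: "?J i = - (\<Sum>j\<in>I. LINT v:W j|lborel. \<phi> j (\<psi> j v) * d i j v)" if "i \<in> I" for i
  proof -
    have "(\<Sum>j\<in>I. LINT u:W i|lborel. \<phi> j (\<psi> i u) * d i i u) =
        (\<Sum>j\<in>I. LINT v:W j|lborel. \<phi> j (\<psi> j v) * d i j v)"
      by (rule sum.cong[OF refl cov[OF that]])
    then show ?thesis using div[OF that] split[OF that] by simp
  qed
  have "(\<Sum>i\<in>I. ?J i) = - (\<Sum>i\<in>I. \<Sum>j\<in>I. LINT v:W j|lborel. \<phi> j (\<psi> j v) * d i j v)"
    using sum.cong[OF refl J] by (simp only: sum_negf)
  also have "\<dots> = - (\<Sum>j\<in>I. \<Sum>i\<in>I. LINT v:W j|lborel. \<phi> j (\<psi> j v) * d i j v)"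
    using sum.swap by (rule arg_cong)
  also have "\<dots> = 0" using sum0 by simp
  finally have total: "(\<Sum>i\<in>I. ?J i) = 0" .
  have Jpos: "0 \<le> ?J i" if "i \<in> I" for i
    unfolding set_lebesgue_integral_def
    by (intro Bochner_Integration.integral_nonneg)
      (use \<phi>0[OF that] pos[OF that] in \<open>auto simp: indicator_def\<close>)
  have "?J i = 0" using total sum_nonneg_eq_0_iff[OF fin, of ?J] Jpos i(1) by auto
  then have "\<phi> i (\<psi> i u) * divergence (Z i) u = 0"
    using i \<phi>0 pos
    by (intro set_integral_nonneg_eq_0[OF W[OF i(1)] int3[OF i(1)], of u])
      (auto intro!: continuous_intros divcont C1_continuous[OF \<phi>C1])
  then show ?thesis using i(3) by simp
qed

section \<open>Variation of the induced metric, and Christoffel symbols\<close>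

lemma bounded_bilinear_matrix_vector_mult:
  "bounded_bilinear (\<lambda>(A :: real ^ 'n ^ 'm) v. A *v v)"
  unfolding bilinear_conv_bounded_bilinear[symmetric] bilinear_def
  by (auto intro!: linearI simp: matrix_vector_right_distrib matrix_vector_mult_add_rdistrib
      vec_eq_iff matrix_vector_mult_def algebra_simps sum_distrib_left sum.distrib)

lemmas C1_mv = C1_bilinear[OF bounded_bilinear_matrix_vector_mult]

interpretation mv: bounded_bilinear "\<lambda>(A :: real ^ 'n ^ 'm) v. A *v v"
  by (rule bounded_bilinear_matrix_vector_mult)

lemma sym_matrix_inner:
  fixes A :: "real ^ 'n ^ 'n"
  assumes "transpose A = A"
  shows "x \<bullet> (A *v y) = y \<bullet> (A *v x)"
  by (metis assms dot_lmul_matrix inner_commute matrix_transpose_mul transpose_matrix_vector vector_transpose_matrix)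

lemma sandwich_nth: "axis i 1 \<bullet> (A *v axis j 1) = (A :: real ^ 'n ^ 'n) $ i $ j"
  by (simp add: inner_axis' matrix_vector_mult_basis column_def)

lemma matrix_nondegenerate:
  fixes G :: "real ^ 'n ^ 'n"
  assumes "det G \<noteq> 0" "\<And>z. z \<bullet> (G *v v) = 0"
  shows "v = 0"
proof -
  have "G *v v = 0" using assms(2)[of "G *v v"] by simp
  then have "matrix_inv G *v (G *v v) = 0" by simp
  then show ?thesis
    using matrix_inv(2)[of G] assms(1) by (simp add: matrix_vector_mul_assoc invertible_det_nz)
qed

lemma transpose_matrix_inv:
  fixes G :: "real ^ 'n ^ 'n"
  assumes "transpose G = G" "det G \<noteq> 0"
  shows "transpose (matrix_inv G) = matrix_inv G"
proof -
  have inv: "G ** matrix_inv G = mat 1" using matrix_inv(1)[of G] assms(2) by (simp add: invertible_det_nz)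
  have "transpose (matrix_inv G) ** G = mat 1" by (metis assms(1) inv matrix_transpose_mul transpose_mat)
  then show ?thesis by (metis inv matrix_mul_assoc matrix_mul_lid matrix_mul_rid)
qed

lemma bilinear_form_zero:
  fixes f :: "real ^ 'n \<Rightarrow> real ^ 'n \<Rightarrow> real"
  assumes "\<And>a. linear (f a)" "\<And>b. linear (\<lambda>a. f a b)" "\<And>i j. f (axis i 1) (axis j 1) = 0"
  shows "f a b = 0"
proof -
  have "f (axis i 1) b = 0" for i
    using linear_axis_sum[OF assms(1)[of "axis i 1"], of b] by (simp add: assms(3))
  then show ?thesis using linear_axis_sum[OF assms(2)[of b], of a] by simp
qed

lemma D_add: "f differentiable (at x) \<Longrightarrow> g differentiable (at x) \<Longrightarrow> \<D> (\<lambda>x. f x + g x) x v = \<D> f x v + \<D> g x v"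
  by (rule fun_cong[OF D_eq, of _ "\<lambda>v. \<D> f x v + \<D> g x v"]) (intro has_derivative_add has_D)

lemma D_bilinear:
  assumes "bounded_bilinear p" "f differentiable (at x)" "g differentiable (at x)"
  shows "\<D> (\<lambda>x. p (f x) (g x)) x v = p (f x) (\<D> g x v) + p (\<D> f x v) (g x)"
  by (rule fun_cong[OF D_eq[OF bounded_bilinear.FDERIV[OF assms(1) has_D[OF assms(2)] has_D[OF assms(3)]]]])

lemma differentiable_bilinear:
  assumes "bounded_bilinear p" "f differentiable (at x)" "g differentiable (at x)"
  shows "(\<lambda>x. p (f x) (g x)) differentiable (at x)"
  using bounded_bilinear.FDERIV[OF assms(1) has_D has_D] assms(2,3) by (blast intro: differentiableI)

lemmas D_inner = D_bilinear[OF bounded_bilinear_inner]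
lemmas D_mv = D_bilinear[OF bounded_bilinear_matrix_vector_mult]
lemmas D_scaleR = D_bilinear[OF bounded_bilinear_scaleR]
lemmas differentiable_inner = differentiable_bilinear[OF bounded_bilinear_inner]
lemmas differentiable_mv = differentiable_bilinear[OF bounded_bilinear_matrix_vector_mult]

lemma differentiable_scaleR':
  "f differentiable (at x) \<Longrightarrow> g differentiable (at x) \<Longrightarrow> (\<lambda>x. f x *\<^sub>R g x) differentiable (at x)"
  by (rule differentiable_bilinear[OF bounded_bilinear_scaleR])

lemma D_form:
  fixes A :: "'a::real_normed_vector \<Rightarrow> real ^ 'n ^ 'm"
  assumes "x differentiable (at u)" "A differentiable (at u)" "y differentiable (at u)"
  shows "\<D> (\<lambda>u. x u \<bullet> (A u *v y u)) u v =
    \<D> x u v \<bullet> (A u *v y u) + x u \<bullet> (\<D> A u v *v y u) + x u \<bullet> (A u *v \<D> y u v)"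
  using D_inner[OF assms(1) differentiable_mv[OF assms(2,3)]] D_mv[OF assms(2,3)]
  by (simp add: inner_add_right)

lemma differentiable_compose_at:
  "g differentiable (at x) \<Longrightarrow> f differentiable (at (g x)) \<Longrightarrow> (\<lambda>x. f (g x)) differentiable (at x)"
  using differentiable_chain_at[of g x f] by (simp add: o_def)

lemma D_cong:
  assumes "open U" "x \<in> U" "\<And>y. y \<in> U \<Longrightarrow> f y = g y" "f differentiable (at x)"
  shows "\<D> f x = \<D> g x"
  by (rule frechet_derivative_transform_within_open[OF assms(4,1,2)]) (use assms(3) in auto)

lemma linear_D: "f differentiable (at x) \<Longrightarrow> linear (\<D> f x)"
  by (rule linear_frechet_derivative)

lemmas D_lin_add = linear_add[OF linear_D] and D_lin_scale = linear_scale[OF linear_D]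

lemma smooth_differentiable: "smooth_on f U \<Longrightarrow> x \<in> U \<Longrightarrow> f differentiable (at x)"
  by (rule C1_differentiable[OF smooth_on_C1])

lemma smooth_differentiable_D: "smooth_on f U \<Longrightarrow> x \<in> U \<Longrightarrow> (\<lambda>x. \<D> f x v) differentiable (at x)"
  by (rule C1_differentiable[OF smooth_on_C1_D])

lemma linear_D_family:
  fixes L :: "'a::real_normed_vector \<Rightarrow> 'b::real_normed_vector \<Rightarrow> 'c::real_normed_vector"
  assumes U: "open U" "x \<in> U" and L: "\<And>x. x \<in> U \<Longrightarrow> linear (L x)"
    and d: "\<And>v. (\<lambda>x. L x v) differentiable (at x)"
  shows "linear (\<lambda>v. \<D> (\<lambda>x. L x v) x w)"
proof (rule linearI)
  fix v v' :: 'b and r :: real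
  have "\<D> (\<lambda>x. L x (v + v')) x = \<D> (\<lambda>x. L x v + L x v') x"
    by (rule D_cong[OF U _ d]) (rule linear_add[OF L])
  then show "\<D> (\<lambda>x. L x (v + v')) x w = \<D> (\<lambda>x. L x v) x w + \<D> (\<lambda>x. L x v') x w"
    using D_add[OF d d] by simp
  have "\<D> (\<lambda>x. L x (r *\<^sub>R v)) x = \<D> (\<lambda>x. r *\<^sub>R L x v) x"
    by (rule D_cong[OF U _ d]) (rule linear_scale[OF L])
  then show "\<D> (\<lambda>x. L x (r *\<^sub>R v)) x w = r *\<^sub>R \<D> (\<lambda>x. L x v) x w"
    using D_linear[OF bounded_linear_scaleR_right d] by simp
qed

text \<open>A product rule for a family of linear maps whose differentiability is known one
  direction at a time: y is expanded in the coordinate directions.\<close>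

lemma has_derivative_linear_family:
  fixes L :: "'a::real_normed_vector \<Rightarrow> real ^ 'm \<Rightarrow> 'b::real_normed_vector"
  assumes U: "open U" "x \<in> U" and L: "\<And>x. x \<in> U \<Longrightarrow> linear (L x)"
    and d: "\<And>v. (\<lambda>x. L x v) differentiable (at x)" and y: "y differentiable (at x)"
  shows "((\<lambda>x. L x (y x)) has_derivative (\<lambda>a. L x (\<D> y x a) + \<D> (\<lambda>x'. L x' (y x)) x a)) (at x)"
proof -
  have 1: "((\<lambda>x. \<Sum>i\<in>UNIV. y x $ i *\<^sub>R L x (axis i 1)) has_derivative
     (\<lambda>a. \<Sum>i\<in>UNIV. y x $ i *\<^sub>R \<D> (\<lambda>x. L x (axis i 1)) x a + \<D> y x a $ i *\<^sub>R L x (axis i 1))) (at x)"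
    by (intro has_derivative_sum has_derivative_scaleR has_D d
        bounded_linear.has_derivative[OF bounded_linear_vec_nth has_D[OF y]])
  have "((\<lambda>x'. \<Sum>i\<in>UNIV. y x $ i *\<^sub>R L x' (axis i 1)) has_derivative
     (\<lambda>a. \<Sum>i\<in>UNIV. y x $ i *\<^sub>R \<D> (\<lambda>x. L x (axis i 1)) x a)) (at x)"
    by (intro has_derivative_sum bounded_linear.has_derivative[OF bounded_linear_scaleR_right] has_D d)
  then have "((\<lambda>x'. L x' (y x)) has_derivative (\<lambda>a. \<Sum>i\<in>UNIV. y x $ i *\<^sub>R \<D> (\<lambda>x. L x (axis i 1)) x a)) (at x)"
    by (rule has_derivative_transform_within_open[OF _ U]) (rule linear_axis_sum[OF L, symmetric])
  from D_eq[OF this] have 2: "(\<Sum>i\<in>UNIV. y x $ i *\<^sub>R \<D> (\<lambda>x. L x (axis i 1)) x a + \<D> y x a $ i *\<^sub>R L x (axis i 1))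
      = L x (\<D> y x a) + \<D> (\<lambda>x'. L x' (y x)) x a" for a
    using linear_axis_sum[OF L[OF U(2)], of "\<D> y x a"] by (simp add: sum.distrib add.commute)
  show ?thesis
    using 1 unfolding 2
    by (rule has_derivative_transform_within_open[OF _ U]) (rule linear_axis_sum[OF L, symmetric])
qed

text \<open>The case \<open>L x = \<D> T (f x)\<close>: it produces the second derivative of T when
  a vector is pushed forward by a transition map or by a parametrisation.\<close>

lemma has_derivative_D_apply:
  fixes T :: "real ^ 'n \<Rightarrow> 'b::real_normed_vector" and f :: "real ^ 'm \<Rightarrow> real ^ 'n"
  assumes W: "open W" "u \<in> W" and fW: "\<And>v. v \<in> W \<Longrightarrow> f v \<in> U" and T: "smooth_on T U"
    and f: "f differentiable (at u)" and y: "y differentiable (at u)"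
  shows "((\<lambda>u. \<D> T (f u) (y u)) has_derivative
    (\<lambda>a. \<D> T (f u) (\<D> y u a) + \<D> (\<lambda>x. \<D> T x (y u)) (f u) (\<D> f u a))) (at u)"
proof -
  note Td = smooth_differentiable[OF T fW] and T2d = smooth_differentiable_D[OF T fW[OF W(2)]]
  show ?thesis
    using has_derivative_linear_family[of W u "\<lambda>v. \<D> T (f v)" y, OF W linear_D[OF Td]
        differentiable_compose_at[OF f T2d] y]
    by (simp add: D_compose[OF T2d f])
qed

lemmas D_D_apply = has_derivative_D_apply[THEN D_eq, THEN fun_cong]
lemmas differentiable_D_apply = has_derivative_D_apply[THEN differentiableI]

text \<open>
  Half the derivative of the induced metric of \<open>F\<close> under the variation \<open>K\<close>, evaluated on \<open>a\<close> and \<open>b\<close>.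
  For a normal field \<open>K\<close> this is the symmetrised second form; unlike the latter it
  contains no Christoffel symbols, so that its invariance is just the chain rule.
\<close>
definition strain ::
  "(real ^ 'n \<Rightarrow> real ^ 'n ^ 'n) \<Rightarrow> (real ^ 'm \<Rightarrow> real ^ 'n) \<Rightarrow> (real ^ 'm \<Rightarrow> real ^ 'n) \<Rightarrow> real ^ 'm \<Rightarrow>
   real ^ 'm \<Rightarrow> real ^ 'm \<Rightarrow> real" where
  "strain G F K u a b = (\<D> K u a \<bullet> (G (F u) *v \<D> F u b) + \<D> K u b \<bullet> (G (F u) *v \<D> F u a)
     + \<D> F u a \<bullet> (\<D> G (F u) (K u) *v \<D> F u b)) / 2"

lemma strain_cong:
  assumes "open W" "u \<in> W" "\<And>v. v \<in> W \<Longrightarrow> K v = K' v" "K differentiable (at u)"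
  shows "strain G F K u a b = strain G F K' u a b"
  using D_cong[OF assms] assms(2,3) by (simp add: strain_def)

lemma strain_add:
  assumes "K differentiable (at u)" "K' differentiable (at u)" "G differentiable (at (F u))"
  shows "strain G F (\<lambda>u. K u + K' u) u a b = strain G F K u a b + strain G F K' u a b"
  unfolding strain_def D_add[OF assms(1,2)] D_lin_add[OF assms(3)]
  by (simp add: inner_add_left inner_add_right mv.add_left field_simps)

text \<open>The terms with the derivative of \<alpha> pair K with tangent vectors and vanish by
  normality.\<close>

lemma strain_scaleR_normal:
  assumes "\<alpha> differentiable (at u)" "K differentiable (at u)" "G differentiable (at (F u))"
    and "\<And>a. K u \<bullet> (G (F u) *v \<D> F u a) = 0"
  shows "strain G F (\<lambda>u. \<alpha> u *\<^sub>R K u) u a b = \<alpha> u * strain G F K u a b"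
  unfolding strain_def D_scaleR[OF assms(1,2)] D_lin_scale[OF assms(3)]
  by (simp add: inner_add_left mv.scaleR_left assms(4) field_simps)

text \<open>The right-hand side is half the Lie derivative of G along \<Xi>, evaluated on tangent
  vectors, which is zero for a Killing field.\<close>

lemma strain_ambient:
  assumes "F differentiable (at u)" "\<Xi> differentiable (at (F u))"
  shows "strain G F (\<lambda>u. \<Xi> (F u)) u a b =
    (\<D> \<Xi> (F u) (\<D> F u a) \<bullet> (G (F u) *v \<D> F u b) + \<D> \<Xi> (F u) (\<D> F u b) \<bullet> (G (F u) *v \<D> F u a)
     + \<D> F u a \<bullet> (\<D> G (F u) (\<Xi> (F u)) *v \<D> F u b)) / 2"
  unfolding strain_def D_compose[OF assms(2,1)] by simp

text \<open>The right-hand side is half the Lie derivative of the induced metric along X, in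
  parameters: symmetry of the second derivatives of F turns the ambient expression into an intrinsic
  one.\<close>

lemma strain_tangential:
  assumes W: "open W" "u \<in> W" and F: "smooth_on F W" and X: "X differentiable (at u)"
    and G: "G differentiable (at (F u))" "transpose (G (F u)) = G (F u)"
  shows "strain G F (\<lambda>u. \<D> F u (X u)) u a b =
    (\<D> F u (\<D> X u a) \<bullet> (G (F u) *v \<D> F u b) + \<D> F u (\<D> X u b) \<bullet> (G (F u) *v \<D> F u a)
     + \<D> (\<lambda>u. \<D> F u a \<bullet> (G (F u) *v \<D> F u b)) u (X u)) / 2"
proof -
  note Fd = smooth_differentiable[OF F W(2)] and Fd2 = smooth_differentiable_D[OF F W(2)]
  have GF: "(\<lambda>u. G (F u)) differentiable (at u)"
    by (rule differentiable_compose_at[OF Fd G(1)])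
  have 1: "\<D> (\<lambda>u. \<D> F u (X u)) u a = \<D> F u (\<D> X u a) + \<D> (\<lambda>x. \<D> F x a) u (X u)" for a
    using D_D_apply[OF W _ F differentiable_ident X, of a]
      symmetric_second_derivative[OF W F, of "X u" a] by simp
  have 2: "\<D> (\<lambda>u. \<D> F u a \<bullet> (G (F u) *v \<D> F u b)) u (X u) =
      \<D> (\<lambda>u. \<D> F u a) u (X u) \<bullet> (G (F u) *v \<D> F u b) + \<D> F u a \<bullet> (\<D> G (F u) (\<D> F u (X u)) *v \<D> F u b)
      + \<D> F u a \<bullet> (G (F u) *v \<D> (\<lambda>u. \<D> F u b) u (X u))"
    using D_form[OF Fd2 GF Fd2] D_compose[OF G(1) Fd] by simp
  show ?thesis
    unfolding strain_def 1 2
    using sym_matrix_inner[OF G(2), of "\<D> F u a" "\<D> (\<lambda>u. \<D> F u b) u (X u)"]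
    by (simp add: inner_add_left)
qed

text \<open>The second derivatives of T that enter through the derivative of \<open>K'\<close> are
  exactly those that appear when the transformation law of the metric is differentiated along
  K.\<close>

lemma strain_chart_change:
  fixes F :: "real ^ 'm \<Rightarrow> real ^ 'n"
  assumes V: "open V" and W: "open W" "u \<in> W" "\<And>v. v \<in> W \<Longrightarrow> F v \<in> V" and T: "smooth_on T V"
    and Fd: "F differentiable (at u)" and Kd: "K differentiable (at u)"
    and G: "G differentiable (at (F u))" and G': "G' differentiable (at (T (F u)))"
    and sym: "transpose (G' (T (F u))) = G' (T (F u))"
    and GG': "\<And>x a b. x \<in> V \<Longrightarrow> a \<bullet> (G x *v b) = \<D> T x a \<bullet> (G' (T x) *v \<D> T x b)"
    and F': "\<And>v. v \<in> W \<Longrightarrow> F' v = T (F v)" and K': "\<And>v. v \<in> W \<Longrightarrow> K' v = \<D> T (F v) (K v)"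
  shows "strain G' F' K' u a b = strain G F K u a b"
proof -
  have FV: "F u \<in> V" using W by blast
  note Td = smooth_differentiable[OF T FV] and Td2 = smooth_differentiable_D[OF T FV]
  have DF': "\<D> F' u a = \<D> T (F u) (\<D> F u a)" for a
  proof -
    have "\<D> (\<lambda>u. T (F u)) u = \<D> F' u"
      by (rule D_cong[OF W(1,2)]) (use F' differentiable_compose_at[OF Fd Td] in auto)
    then show ?thesis using D_compose[OF Td Fd] by metis
  qed
  let ?H = "\<lambda>v w. \<D> (\<lambda>x. \<D> T x v) (F u) w"
  have H: "?H v w = ?H w v" for v w by (rule symmetric_second_derivative[OF V FV T])
  have DK': "\<D> K' u a = \<D> T (F u) (\<D> K u a) + ?H (K u) (\<D> F u a)" for a
  proof -
    have "\<D> (\<lambda>u. \<D> T (F u) (K u)) u = \<D> K' u"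
      by (rule D_cong[OF W(1,2)]) (use K' differentiable_D_apply[OF W T Fd Kd] in auto)
    then show ?thesis using D_D_apply[OF W T Fd Kd] by metis
  qed
  let ?A = "\<D> F u a" and ?B = "\<D> F u b" and ?G = "G' (T (F u))"
  have "\<D> (\<lambda>x. ?A \<bullet> (G x *v ?B)) (F u) (K u) = \<D> (\<lambda>x. \<D> T x ?A \<bullet> (G' (T x) *v \<D> T x ?B)) (F u) (K u)"
    by (rule fun_cong, rule D_cong[OF V FV]) (use GG' G in \<open>auto intro!: differentiable_inner differentiable_mv\<close>)
  moreover have "\<D> (\<lambda>x. ?A \<bullet> (G x *v ?B)) (F u) (K u) = ?A \<bullet> (\<D> G (F u) (K u) *v ?B)"
    using D_form[of "\<lambda>x. ?A" "F u" G "\<lambda>x. ?B"] G by simp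
  moreover have "\<D> (\<lambda>x. \<D> T x ?A \<bullet> (G' (T x) *v \<D> T x ?B)) (F u) (K u) =
      ?H ?A (K u) \<bullet> (?G *v \<D> T (F u) ?B) + \<D> T (F u) ?A \<bullet> (\<D> G' (T (F u)) (\<D> T (F u) (K u)) *v \<D> T (F u) ?B)
      + \<D> T (F u) ?A \<bullet> (?G *v ?H ?B (K u))"
    using D_form[OF Td2 differentiable_compose_at[OF Td G'] Td2] D_compose[OF G' Td] by simp
  ultimately have key: "?A \<bullet> (\<D> G (F u) (K u) *v ?B) =
      ?H ?A (K u) \<bullet> (?G *v \<D> T (F u) ?B) + \<D> T (F u) ?A \<bullet> (\<D> G' (T (F u)) (\<D> T (F u) (K u)) *v \<D> T (F u) ?B)
      + ?H ?B (K u) \<bullet> (?G *v \<D> T (F u) ?A)"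
    using sym_matrix_inner[OF sym] by simp
  show ?thesis
    unfolding strain_def DF' DK' key GG'[OF FV]
    using F'[OF W(2)] K'[OF W(2)] by (simp add: inner_add_left H[of _ "K u"])
qed

lemma strain_reparametrize:
  assumes W: "open W" "u \<in> W" and \<tau>: "\<tau> differentiable (at u)"
    and F: "F differentiable (at (\<tau> u))" and K: "K differentiable (at (\<tau> u))"
    and F': "\<And>v. v \<in> W \<Longrightarrow> F' v = F (\<tau> v)" and K': "\<And>v. v \<in> W \<Longrightarrow> K' v = K (\<tau> v)"
  shows "strain G F' K' u a b = strain G F K (\<tau> u) (\<D> \<tau> u a) (\<D> \<tau> u b)"
proof -
  have "\<D> F' u a = \<D> F (\<tau> u) (\<D> \<tau> u a)" for a
    using D_cong[OF W, of "\<lambda>v. F (\<tau> v)" F'] F' differentiable_compose_at[OF \<tau> F] D_compose[OF F \<tau>] by metis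
  moreover have "\<D> K' u a = \<D> K (\<tau> u) (\<D> \<tau> u a)" for a
    using D_cong[OF W, of "\<lambda>v. K (\<tau> v)" K'] K' differentiable_compose_at[OF \<tau> K] D_compose[OF K \<tau>] by metis
  ultimately show ?thesis using F'[OF W(2)] K'[OF W(2)] by (simp add: strain_def)
qed

text \<open>\<open>gam G x a b\<close> is the vector with the components \<open>\<Gamma>\<^sup>k\<^sub>i\<^sub>j a\<^sup>i b\<^sup>j\<close>.\<close>
definition gam :: "(real ^ 'n \<Rightarrow> real ^ 'n ^ 'n) \<Rightarrow> real ^ 'n \<Rightarrow> real ^ 'n \<Rightarrow> real ^ 'n \<Rightarrow> real ^ 'n" where
  "gam G x a b = matrix_inv (G x) *v (\<chi> l. (b \<bullet> (\<D> G x a *v axis l 1) + a \<bullet> (\<D> G x b *v axis l 1)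
     - a \<bullet> (\<D> G x (axis l 1) *v b)) / 2)"

text \<open>Lowering the index cancels \<open>matrix_inv\<close> and leaves Christoffel symbols of
  the first kind; linearity in z extends the formula from coordinate directions.\<close>

lemma inner_gam:
  assumes G: "G differentiable (at x)" "transpose (G x) = G x" "det (G x) \<noteq> 0"
  shows "z \<bullet> (G x *v gam G x a b) =
    (b \<bullet> (\<D> G x a *v z) + a \<bullet> (\<D> G x b *v z) - a \<bullet> (\<D> G x z *v b)) / 2"
proof -
  let ?w = "\<lambda>z. (b \<bullet> (\<D> G x a *v z) + a \<bullet> (\<D> G x b *v z) - a \<bullet> (\<D> G x z *v b)) / 2"
  have l: "linear ?w"
    by (rule linearI) (simp_all add: D_lin_add[OF G(1)] D_lin_scale[OF G(1)] mv.add_left mv.add_right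
        mv.scaleR_left mv.scaleR_right inner_add_right field_simps)
  have "G x *v gam G x a b = (\<chi> l. ?w (axis l 1))"
    using matrix_inv(1)[of "G x"] G(3) by (simp add: gam_def matrix_vector_mul_assoc invertible_det_nz)
  then have "z \<bullet> (G x *v gam G x a b) = (\<Sum>i\<in>UNIV. z $ i *\<^sub>R ?w (axis i 1))"
    by (simp add: inner_vec_def)
  then show ?thesis using linear_axis_sum[OF l, of z] by simp
qed

section \<open>Killing fields in a chart\<close>

lemma gam_linear:
  assumes "G differentiable (at x)"
  shows "linear (gam G x a)" "linear (\<lambda>a. gam G x a b)"
proof -
  let ?v = "\<lambda>a b. (\<chi> l. (b \<bullet> (\<D> G x a *v axis l 1) + a \<bullet> (\<D> G x b *v axis l 1) - a \<bullet> (\<D> G x (axis l 1) *v b)) / 2)"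
  have 1: "linear (?v a)"
    by (rule linearI) (simp_all add: vec_eq_iff mv.add_left mv.add_right mv.scaleR_left mv.scaleR_right
        inner_add_right inner_add_left D_lin_add[OF assms] D_lin_scale[OF assms] field_simps)
  have 2: "linear (\<lambda>a. ?v a b)"
    by (rule linearI) (simp_all add: vec_eq_iff mv.add_left mv.add_right mv.scaleR_left mv.scaleR_right
        inner_add_right inner_add_left D_lin_add[OF assms] D_lin_scale[OF assms] field_simps)
  show "linear (gam G x a)" "linear (\<lambda>a. gam G x a b)"
    using linear_compose[OF 1 matrix_vector_mul_linear] linear_compose[OF 2 matrix_vector_mul_linear]
    by (simp_all add: gam_def[abs_def] o_def)
qed

lemma gam_sym:
  assumes "\<And>v. transpose (\<D> G x v) = \<D> G x v"
  shows "gam G x a b = gam G x b a"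
proof -
  have "a \<bullet> (\<D> G x v *v b) = b \<bullet> (\<D> G x v *v a)" for v
    by (rule sym_matrix_inner[OF assms])
  then show ?thesis by (simp add: gam_def add.commute)
qed

lemma transpose_D:
  fixes G :: "real ^ 'n \<Rightarrow> real ^ 'k ^ 'k"
  assumes "open U" "x \<in> U" "\<And>y. y \<in> U \<Longrightarrow> transpose (G y) = G y" "G differentiable (at x)"
  shows "transpose (\<D> G x v) = \<D> G x v"
proof -
  have "linear (transpose :: real ^ 'k ^ 'k \<Rightarrow> _)"
    by (rule linearI) (simp_all add: transpose_def vec_eq_iff)
  then have bl: "bounded_linear (transpose :: real ^ 'k ^ 'k \<Rightarrow> _)"
    by (simp add: linear_conv_bounded_linear)
  have "\<D> G x = \<D> (\<lambda>y. transpose (G y)) x"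
    by (rule D_cong[OF assms(1,2) _ assms(4)]) (use assms(3) in auto)
  then show ?thesis using D_linear[OF bl assms(4)] by metis
qed

lemma C1_gam:
  assumes U: "open U" and G: "smooth_on G U" "\<And>x. x \<in> U \<Longrightarrow> det (G x) \<noteq> 0"
  shows "C1_on (\<lambda>x. gam G x a b) U"
proof -
  have "C1_on (\<lambda>x. \<chi> i j. matrix_inv (G x) $ i $ j) U"
    by (intro C1_vec C1_matrix_inv U smooth_on_C1[OF G(1)] G(2))
  then have 1: "C1_on (\<lambda>x. matrix_inv (G x)) U" by simp
  have "C1_on (\<lambda>x. \<chi> l. (1/2) * (b \<bullet> (\<D> G x a *v axis l 1) + a \<bullet> (\<D> G x b *v axis l 1)
     - a \<bullet> (\<D> G x (axis l 1) *v b))) U"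
    by (intro C1_vec C1_mult C1_add C1_diff C1_inner C1_mv C1_const smooth_on_C1_D[OF G(1)])
  from C1_mv[OF 1 this] show ?thesis by (simp add: gam_def[abs_def])
qed

text \<open>\<open>riem G x a b e\<close> has the components \<open>R\<^sub>i\<^sub>j\<^sub>k\<^sup>d a\<^sup>i b\<^sup>j e\<^sup>k\<close>.\<close>
definition riem :: "(real ^ 'n \<Rightarrow> real ^ 'n ^ 'n) \<Rightarrow> real ^ 'n \<Rightarrow> real ^ 'n \<Rightarrow> real ^ 'n \<Rightarrow> real ^ 'n \<Rightarrow> real ^ 'n" where
  "riem G x a b e = \<D> (\<lambda>x. gam G x a e) x b - \<D> (\<lambda>x. gam G x b e) x a
     + gam G x b (gam G x a e) - gam G x a (gam G x b e)"

definition ltrace :: "(real ^ 'n \<Rightarrow> real ^ 'n) \<Rightarrow> real" where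
  "ltrace l = (\<Sum>i\<in>UNIV. l (axis i 1) $ i)"

lemma ltrace_commute:
  fixes f g :: "real ^ 'n \<Rightarrow> real ^ 'n"
  assumes "linear f" "linear g"
  shows "ltrace (\<lambda>x. f (g x)) = ltrace (\<lambda>x. g (f x))"
proof -
  have "f (g (axis i 1)) $ i = (\<Sum>j\<in>UNIV. g (axis i 1) $ j * f (axis j 1) $ i)" for i
    using linear_axis_sum[OF assms(1), of "g (axis i 1)"] by simp
  moreover have "g (f (axis i 1)) $ i = (\<Sum>j\<in>UNIV. f (axis i 1) $ j * g (axis j 1) $ i)" for i
    using linear_axis_sum[OF assms(2), of "f (axis i 1)"] by simp
  ultimately show ?thesis
    unfolding ltrace_def by (simp add: mult.commute) (rule sum.swap)
qed

text \<open>B factors through the single functional x -> x . n, so its trace is n . B z for any z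
  with z . n = 1. In the application n is a null vector with its index lowered.\<close>

lemma ltrace_eq_0:
  fixes n :: "real ^ 'n"
  assumes B: "linear B" and n: "n \<noteq> 0"
    and ker: "\<And>x. x \<bullet> n = 0 \<Longrightarrow> B x = 0" and range: "\<And>x. n \<bullet> B x = 0"
  shows "ltrace B = 0"
proof -
  define z where "z = (1 / (n \<bullet> n)) *\<^sub>R n"
  have z: "z \<bullet> n = 1" using n by (simp add: z_def)
  have B': "B x = (x \<bullet> n) *\<^sub>R B z" for x
  proof -
    have "B (x - (x \<bullet> n) *\<^sub>R z) = 0" by (rule ker) (simp add: inner_diff_left z)
    then show ?thesis using B by (simp add: linear_diff linear_scale)
  qed
  have "B (axis i 1) $ i = n $ i * B z $ i" for i
    by (subst B') (simp add: inner_axis')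
  then have "ltrace B = (\<Sum>i\<in>UNIV. n $ i * B z $ i)" by (simp add: ltrace_def)
  also have "\<dots> = n \<bullet> B z" by (simp add: inner_vec_def)
  finally show ?thesis using range by simp
qed

text \<open>Killing's equation enters as the vanishing Lie derivative of the metric, which contains
  no Christoffel symbols; \<open>killing_chart_of\<close> derives it from the covariant
  form.\<close>

locale killing_chart =
  fixes G :: "real ^ 'n \<Rightarrow> real ^ 'n ^ 'n" and \<Xi> :: "real ^ 'n \<Rightarrow> real ^ 'n" and U :: "(real ^ 'n) set"
  assumes U: "open U" and G: "smooth_on G U" and \<Xi>: "smooth_on \<Xi> U"
    and sym: "\<And>x. x \<in> U \<Longrightarrow> transpose (G x) = G x" and det: "\<And>x. x \<in> U \<Longrightarrow> det (G x) \<noteq> 0"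
    and lie: "\<And>x a b. x \<in> U \<Longrightarrow>
      \<D> \<Xi> x a \<bullet> (G x *v b) + a \<bullet> (G x *v \<D> \<Xi> x b) + a \<bullet> (\<D> G x (\<Xi> x) *v b) = 0"
begin

lemma Gd: "x \<in> U \<Longrightarrow> G differentiable (at x)" and \<Xi>d: "x \<in> U \<Longrightarrow> \<Xi> differentiable (at x)"
  using smooth_differentiable G \<Xi> by blast+

lemma G_commute: "x \<in> U \<Longrightarrow> v \<bullet> (G x *v w) = w \<bullet> (G x *v v)"
  by (rule sym_matrix_inner[OF sym])

lemma DG_commute: "x \<in> U \<Longrightarrow> v \<bullet> (\<D> G x a *v w) = w \<bullet> (\<D> G x a *v v)"
  by (rule sym_matrix_inner[OF transpose_D[OF U _ sym Gd]]) auto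

lemma gam_commute: "x \<in> U \<Longrightarrow> gam G x a b = gam G x b a"
  by (rule gam_sym[OF transpose_D[OF U _ sym Gd]]) auto

lemmas gaml = gam_linear[OF Gd]

lemmas G_nondegenerate = matrix_nondegenerate[OF det]

text \<open>The covariant derivative of the Killing field: \<open>M x a\<close> has the components \<open>a\<^sup>i \<nabla>\<^sub>i \<xi>\<^sup>k\<close>.\<close>
definition M :: "real ^ 'n \<Rightarrow> real ^ 'n \<Rightarrow> real ^ 'n" where
  "M x a = \<D> \<Xi> x a + gam G x a (\<Xi> x)"

lemma M_linear: "x \<in> U \<Longrightarrow> linear (M x)"
  unfolding M_def by (intro linear_compose_add linear_D \<Xi>d gaml)

text \<open>\<open>lie\<close> removes the symmetric part, so the right-hand side is visibly
  antisymmetric in a and b.\<close>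

lemma inner_M:
  assumes x: "x \<in> U"
  shows "b \<bullet> (G x *v M x a) = (\<D> \<Xi> x a \<bullet> (G x *v b) - \<D> \<Xi> x b \<bullet> (G x *v a)
     + \<Xi> x \<bullet> (\<D> G x a *v b) - \<Xi> x \<bullet> (\<D> G x b *v a)) / 2"
proof -
  have "b \<bullet> (G x *v M x a) = b \<bullet> (G x *v \<D> \<Xi> x a) + b \<bullet> (G x *v gam G x a (\<Xi> x))"
    by (simp add: M_def mv.add_right inner_add_right)
  also have "b \<bullet> (G x *v gam G x a (\<Xi> x)) =
      (\<Xi> x \<bullet> (\<D> G x a *v b) + a \<bullet> (\<D> G x (\<Xi> x) *v b) - a \<bullet> (\<D> G x b *v \<Xi> x)) / 2"
    by (rule inner_gam[OF Gd[OF x] sym[OF x] det[OF x]])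
  finally show ?thesis
    using lie[OF x, of a b] G_commute[OF x, of b "\<D> \<Xi> x a"] G_commute[OF x, of a "\<D> \<Xi> x b"]
      DG_commute[OF x, of a b "\<Xi> x"] by (simp add: field_simps)
qed

lemma M_antisym: "x \<in> U \<Longrightarrow> b \<bullet> (G x *v M x a) = - (a \<bullet> (G x *v M x b))"
  by (simp add: inner_M field_simps)

lemma M_self: "x \<in> U \<Longrightarrow> b \<bullet> (G x *v M x b) = 0"
  using M_antisym[of x b b] by simp

text \<open>The symmetric inverse metric is contracted with an antisymmetric form. This is the
  vanishing divergence of a Killing field.\<close>

lemma ltrace_M:
  assumes x: "x \<in> U"
  shows "ltrace (M x) = 0"
proof -
  let ?H = "matrix_inv (G x)"
  have inv: "G x ** ?H = mat 1" "?H ** G x = mat 1" using matrix_inv det[OF x] by (auto simp: invertible_det_nz)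
  have Hsym: "transpose ?H = ?H" by (rule transpose_matrix_inv[OF sym[OF x] det[OF x]])
  define N where "N a = G x *v M x a" for a
  have N: "linear N" unfolding N_def by (rule linear_compose[OF M_linear[OF x], unfolded o_def]) simp
  have MN: "M x a = ?H *v N a" for a by (simp add: N_def matrix_vector_mul_assoc inv)
  let ?h = "\<lambda>i j. ?H $ i $ j" and ?n = "\<lambda>i j. N (axis i 1) $ j"
  have "?n i j = - ?n j i" for i j
    using M_antisym[OF x, of "axis j 1" "axis i 1"] by (simp add: N_def inner_axis')
  moreover have "?h i j = ?h j i" for i j using arg_cong[OF Hsym, of "\<lambda>A. A $ i $ j"] by (simp add: transpose_def)
  ultimately have e: "?h i j * ?n i j = - (?h j i * ?n j i)" for i j by (metis mult_minus_right)
  have "ltrace (M x) = (\<Sum>i\<in>UNIV. \<Sum>j\<in>UNIV. ?h i j * ?n i j)"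
    by (simp add: ltrace_def MN matrix_vector_mult_def)
  also have "\<dots> = - (\<Sum>i\<in>UNIV. \<Sum>j\<in>UNIV. ?h j i * ?n j i)"
    unfolding sum_negf[symmetric] by (intro sum.cong refl e)
  also have "(\<Sum>i\<in>UNIV. \<Sum>j\<in>UNIV. ?h j i * ?n j i) = (\<Sum>i\<in>UNIV. \<Sum>j\<in>UNIV. ?h i j * ?n i j)"
    by (rule sum.swap)
  finally show ?thesis by (simp add: ltrace_def MN matrix_vector_mult_def)
qed

lemma gam_differentiable: "x \<in> U \<Longrightarrow> (\<lambda>x. gam G x a b) differentiable (at x)"
  by (rule C1_differentiable[OF C1_gam[OF U G det]])

lemma D_gam_\<Xi>:
  assumes x: "x \<in> U"
  shows "((\<lambda>y. gam G y a (\<Xi> y)) has_derivative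
    (\<lambda>b. gam G x a (\<D> \<Xi> x b) + \<D> (\<lambda>y. gam G y a (\<Xi> x)) x b)) (at x)"
  by (rule has_derivative_linear_family[OF U x gaml(1) gam_differentiable[OF x] \<Xi>d[OF x]])

lemma M_has_derivative:
  assumes x: "x \<in> U"
  shows "((\<lambda>x. M x a) has_derivative
    (\<lambda>b. \<D> (\<lambda>x. \<D> \<Xi> x a) x b + (gam G x a (\<D> \<Xi> x b) + \<D> (\<lambda>y. gam G y a (\<Xi> x)) x b))) (at x)"
  unfolding M_def by (intro has_derivative_add D_gam_\<Xi> x has_D smooth_differentiable_D[OF \<Xi>])

text \<open>The Ricci identity for \<Xi> and constant coordinate directions: the second derivatives
  of \<Xi> cancel by symmetry, and the remaining terms in \<open>gam\<close> regroup into
  \<open>riem\<close>.\<close>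

lemma curvature_identity:
  assumes x: "x \<in> U"
  shows "\<D> (\<lambda>x. M x a) x b - \<D> (\<lambda>x. M x b) x a =
    riem G x a b (\<Xi> x) + gam G x a (M x b) - gam G x b (M x a)"
  unfolding D_eq[OF M_has_derivative[OF x]] riem_def
  using symmetric_second_derivative[OF U x \<Xi>, of a b]
  by (simp add: M_def linear_add[OF gaml(1)[OF x]])

text \<open>The acceleration of the Killing field, that is, its covariant derivative along itself;
  by \<open>inner_Y\<close> it is minus half the gradient of \<open>norm2\<close>.\<close>

definition Y :: "real ^ 'n \<Rightarrow> real ^ 'n" where
  "Y x = M x (\<Xi> x)"

lemma Y_has_derivative:
  assumes x: "x \<in> U"
  shows "(Y has_derivative (\<lambda>b. M x (\<D> \<Xi> x b) + \<D> (\<lambda>y. M y (\<Xi> x)) x b)) (at x)"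
  unfolding Y_def[abs_def]
  by (rule has_derivative_linear_family[OF U x M_linear differentiableI[OF M_has_derivative[OF x]] \<Xi>d[OF x]])

text \<open>The hypothesis \<open>Y x = 0\<close> removes the Christoffel terms acting on Y, so the
  coordinate trace of \<open>\<D> Y x\<close> is the covariant divergence of Y at x.\<close>

lemma ricci_killing:
  assumes x: "x \<in> U" and Y0: "Y x = 0"
  shows "ltrace (\<lambda>b. riem G x (\<Xi> x) b (\<Xi> x)) = ltrace (\<D> Y x) - ltrace (\<lambda>b. M x (M x b))"
proof -
  let ?\<xi> = "\<Xi> x"
  have Md: "(\<lambda>y. M y b) differentiable (at x)" for b
    using M_has_derivative[OF x] by (rule differentiableI)
  have id: "riem G x ?\<xi> b ?\<xi> = \<D> (\<lambda>x. M x ?\<xi>) x b - \<D> (\<lambda>x. M x b) x ?\<xi> - gam G x ?\<xi> (M x b)" for b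
    using curvature_identity[OF x, of ?\<xi> b] Y0 linear_0[OF gaml(1)[OF x]] by (simp add: Y_def algebra_simps)
  have "((\<lambda>y. ltrace (M y)) has_derivative (\<lambda>v. \<Sum>i\<in>UNIV. \<D> (\<lambda>y. M y (axis i 1)) x v $ i)) (at x)"
    unfolding ltrace_def
    by (intro has_derivative_sum bounded_linear.has_derivative[OF bounded_linear_vec_nth] has_D Md)
  then have "((\<lambda>y. 0) has_derivative (\<lambda>v. \<Sum>i\<in>UNIV. \<D> (\<lambda>y. M y (axis i 1)) x v $ i)) (at x)"
    by (rule has_derivative_transform_within_open[OF _ U x]) (rule ltrace_M)
  \<comment> \<open>This differentiates the identically vanishing divergence of \<Xi> in the
    direction of \<Xi>.\<close>
  from D_eq[OF this] have tr0: "(\<Sum>i\<in>UNIV. \<D> (\<lambda>y. M y (axis i 1)) x ?\<xi> $ i) = 0"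
    by (simp add: fun_eq_iff)
  have "ltrace (\<lambda>b. gam G x ?\<xi> (M x b)) = ltrace (\<lambda>b. M x (gam G x ?\<xi> b))"
    by (rule ltrace_commute[OF gaml(1)[OF x] M_linear[OF x]])
  moreover have "ltrace (\<lambda>b. M x (M x b)) = ltrace (\<lambda>b. M x (\<D> \<Xi> x b)) + ltrace (\<lambda>b. M x (gam G x ?\<xi> b))"
    unfolding ltrace_def M_def[of x "axis _ 1"] gam_commute[OF x, of "axis _ 1"]
    by (simp add: linear_add[OF M_linear[OF x]] sum.distrib)
  moreover have "ltrace (\<D> Y x) = ltrace (\<lambda>b. M x (\<D> \<Xi> x b)) + (\<Sum>i\<in>UNIV. \<D> (\<lambda>y. M y ?\<xi>) x (axis i 1) $ i)"
    unfolding D_eq[OF Y_has_derivative[OF x]] ltrace_def by (simp add: sum.distrib)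
  moreover have "ltrace (\<lambda>b. riem G x ?\<xi> b ?\<xi>) =
      (\<Sum>i\<in>UNIV. \<D> (\<lambda>y. M y ?\<xi>) x (axis i 1) $ i) - ltrace (\<lambda>b. gam G x ?\<xi> (M x b))"
    using tr0 unfolding id ltrace_def by (simp add: sum_subtractf)
  ultimately show ?thesis by simp
qed

end

section \<open>Unique continuation of Killing fields from a point\<close>

lemma gronwall_zero:
  fixes y :: "'a::euclidean_space \<Rightarrow> 'b::real_inner"
  assumes y: "\<And>x. x \<in> ball x0 r \<Longrightarrow> y differentiable (at x)"
    and bound: "\<And>x d. x \<in> ball x0 r \<Longrightarrow> norm (\<D> y x d) \<le> C * norm (y x) * norm d"
    and y0: "y x0 = 0" and x: "x \<in> ball x0 r"
  shows "y x = 0"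
proof -
  define d where "d = x - x0"
  have seg: "x0 + t *\<^sub>R d \<in> ball x0 r" if "0 \<le> t" "t \<le> 1" for t
  proof -
    have "t * norm d \<le> 1 * norm d" using that by (intro mult_right_mono) auto
    then show ?thesis using x that by (simp add: d_def dist_norm norm_minus_commute)
  qed
  \<comment> \<open>The bound gives 2 y . y' \<le> K |y|^2 along the segment, so the weight exp(-K
    t) makes f nonincreasing; f starts at 0.\<close>
  define K where "K = 2 * C * norm d"
  define f where "f t = exp (- (K * t)) * (y (x0 + t *\<^sub>R d) \<bullet> y (x0 + t *\<^sub>R d))" for t
  define f' where "f' t = exp (- (K * t)) * (2 * (y (x0 + t *\<^sub>R d) \<bullet> \<D> y (x0 + t *\<^sub>R d) d))
     + (- K * exp (- (K * t))) * (y (x0 + t *\<^sub>R d) \<bullet> y (x0 + t *\<^sub>R d))" for t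
  have "f 1 \<le> f 0"
  proof (rule DERIV_nonpos_imp_nonincreasing[of 0 1 f])
    fix t :: real assume t: "0 \<le> t" "t \<le> 1"
    let ?x = "x0 + t *\<^sub>R d"
    have 1: "((\<lambda>t. x0 + t *\<^sub>R d) has_derivative (\<lambda>s. s *\<^sub>R d)) (at t)"
      by (auto intro!: derivative_eq_intros)
    have yd: "y differentiable (at ?x)" by (rule y[OF seg[OF t]])
    have 2: "((\<lambda>t. y (x0 + t *\<^sub>R d)) has_derivative (\<lambda>s. \<D> y ?x (s *\<^sub>R d))) (at t)"
      by (rule has_derivative_compose[OF 1 has_D[OF yd]])
    have "\<D> y ?x (s *\<^sub>R d) = s *\<^sub>R \<D> y ?x d" for s by (rule D_lin_scale[OF yd])
    with 2 have "((\<lambda>t. y (x0 + t *\<^sub>R d)) has_vector_derivative \<D> y ?x d) (at t)"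
      by (simp add: has_vector_derivative_def)
    then have "((\<lambda>t. y (x0 + t *\<^sub>R d) \<bullet> y (x0 + t *\<^sub>R d)) has_real_derivative 2 * (y ?x \<bullet> \<D> y ?x d)) (at t)"
      using has_derivative_inner[of "\<lambda>t. y (x0 + t *\<^sub>R d)" "\<lambda>s. s *\<^sub>R \<D> y ?x d" t UNIV
        "\<lambda>t. y (x0 + t *\<^sub>R d)" "\<lambda>s. s *\<^sub>R \<D> y ?x d"]
      unfolding has_vector_derivative_def has_field_derivative_def
      by (simp add: inner_commute algebra_simps mult_commute_abs)
    then have "(f has_real_derivative f' t) (at t)"
      unfolding f_def[abs_def] f'_def by (auto intro!: derivative_eq_intros)
    moreover have "f' t \<le> 0"
    proof -
      have "y ?x \<bullet> \<D> y ?x d \<le> norm (y ?x) * norm (\<D> y ?x d)" by (rule norm_cauchy_schwarz)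
      also have "\<dots> \<le> norm (y ?x) * (C * norm (y ?x) * norm d)"
        by (intro mult_left_mono bound[OF seg[OF t]]) auto
      finally have "2 * (y ?x \<bullet> \<D> y ?x d) \<le> K * (y ?x \<bullet> y ?x)"
        by (simp add: K_def dot_square_norm power2_eq_square mult_ac)
      then have "exp (- (K * t)) * (2 * (y ?x \<bullet> \<D> y ?x d) - K * (y ?x \<bullet> y ?x)) \<le> 0"
        by (intro mult_nonneg_nonpos) auto
      then show ?thesis by (simp add: f'_def algebra_simps)
    qed
    ultimately show "\<exists>z. (f has_real_derivative z) (at t) \<and> z \<le> 0" by blast
  qed auto
  then have "exp (- K) * (y x \<bullet> y x) \<le> 0" using y0 by (simp add: f_def d_def)
  then have "y x \<bullet> y x \<le> 0" by (simp add: mult_le_0_iff)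
  then show ?thesis by (metis inner_ge_zero inner_eq_zero_iff antisym)
qed

lemma norm_linear_le:
  fixes l :: "real ^ 'n \<Rightarrow> 'b::real_normed_vector"
  assumes "linear l" "\<And>c. norm (l (axis c 1)) \<le> B"
  shows "norm (l d) \<le> real CARD('n) * B * norm d"
proof -
  have B: "0 \<le> B" using assms(2)[of undefined] norm_ge_zero order_trans by blast
  have "norm (l d) \<le> (\<Sum>i\<in>UNIV. norm (d $ i *\<^sub>R l (axis i 1)))"
    unfolding linear_axis_sum[OF assms(1), of d] by (rule norm_sum)
  also have "\<dots> \<le> (\<Sum>i\<in>(UNIV :: 'n set). norm d * B)"
    using assms(2) B component_le_norm_cart[of d] by (intro sum_mono) (simp add: mult_mono)
  finally show ?thesis by (simp add: mult_ac)
qed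

lemma norm_vec_le_sum:
  fixes v :: "'b::real_normed_vector ^ 'n"
  shows "norm v \<le> (\<Sum>i\<in>UNIV. norm (v $ i))"
  unfolding norm_vec_def by (rule L2_set_le_sum) simp

context killing_chart
begin

text \<open>The covector form of the field is used because Killing's equation then expresses the
  symmetrised coordinate derivative through V itself, see \<open>D_V_sym\<close>.\<close>

definition V :: "real ^ 'n \<Rightarrow> real ^ 'n" where
  "V x = G x *v \<Xi> x"

lemma D_V: "x \<in> U \<Longrightarrow> \<D> V x a = G x *v \<D> \<Xi> x a + \<D> G x a *v \<Xi> x"
  unfolding V_def[abs_def] using D_mv[OF Gd \<Xi>d] by simp

lemma V_C1: "C1_on V U"
  unfolding V_def[abs_def] by (intro C1_mv smooth_on_C1 G \<Xi>)

lemma DV_C1: "C1_on (\<lambda>x. \<D> V x a) U"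
  by (rule C1_cong[OF U, of "\<lambda>x. G x *v \<D> \<Xi> x a + \<D> G x a *v \<Xi> x"])
    (simp_all add: D_V C1_add C1_mv smooth_on_C1[OF G] smooth_on_C1[OF \<Xi>] smooth_on_C1_D[OF G] smooth_on_C1_D[OF \<Xi>])

lemma D_V_sym:
  assumes x: "x \<in> U"
  shows "\<D> V x a \<bullet> b + \<D> V x b \<bullet> a = 2 * (gam G x a b \<bullet> V x)"
proof -
  have "\<Xi> x \<bullet> (G x *v gam G x a b) = (b \<bullet> (\<D> G x a *v \<Xi> x) + a \<bullet> (\<D> G x b *v \<Xi> x) - a \<bullet> (\<D> G x (\<Xi> x) *v b)) / 2"
    by (rule inner_gam[OF Gd[OF x] sym[OF x] det[OF x]])
  moreover have "gam G x a b \<bullet> V x = \<Xi> x \<bullet> (G x *v gam G x a b)"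
    unfolding V_def by (rule G_commute[OF x])
  moreover have "\<D> V x a \<bullet> b = b \<bullet> (G x *v \<D> \<Xi> x a) + b \<bullet> (\<D> G x a *v \<Xi> x)" for a b
    unfolding D_V[OF x] by (subst inner_commute) (rule inner_add_right)
  ultimately show ?thesis
    using lie[OF x, of a b] G_commute[OF x, of b "\<D> \<Xi> x a"] by (simp add: field_simps)
qed

text \<open>As for the Koszul formula, the symmetrised second derivatives determine all of them.\<close>
lemma D_D_V:
  assumes x: "x \<in> U"
  defines "S \<equiv> \<lambda>a b c. \<D> (\<lambda>x. gam G x a b) x c \<bullet> V x + gam G x a b \<bullet> \<D> V x c"
  shows "\<D> (\<lambda>x. \<D> V x a) x c \<bullet> b = S a b c + S c b a - S c a b"
proof -
  let ?H = "\<lambda>a c. \<D> (\<lambda>x. \<D> V x a) x c"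
  have H: "?H a c = ?H c a" for a c
    by (rule symmetric_second_derivative_C1[OF U x V_C1 DV_C1])
  have Vd: "V differentiable (at x)" "(\<lambda>x. \<D> V x a) differentiable (at x)" for a
    using C1_differentiable[OF V_C1 x] C1_differentiable[OF DV_C1 x] by auto
  have E: "?H a c \<bullet> b + ?H b c \<bullet> a = 2 * S a b c" for a b c
  proof -
    have l: "((\<lambda>x. \<D> V x a \<bullet> b + \<D> V x b \<bullet> a) has_derivative (\<lambda>c. ?H a c \<bullet> b + ?H b c \<bullet> a)) (at x)"
      by (intro has_derivative_add bounded_linear.has_derivative[OF bounded_linear_inner_left] has_D Vd)
    have r: "((\<lambda>x. 2 * (gam G x a b \<bullet> V x)) has_derivative (\<lambda>c. 2 * S a b c)) (at x)"
      using has_derivative_mult_right[OF has_derivative_inner[OF has_D[OF gam_differentiable[OF x]] has_D[OF Vd(1)]], of 2]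
      by (simp add: S_def add.commute)
    have "((\<lambda>x. 2 * (gam G x a b \<bullet> V x)) has_derivative (\<lambda>c. ?H a c \<bullet> b + ?H b c \<bullet> a)) (at x)"
      by (rule has_derivative_transform_within_open[OF l U x]) (rule D_V_sym)
    from has_derivative_unique[OF this r] show ?thesis by (rule fun_cong)
  qed
  show ?thesis using E[where a = a and b = b and c = c] E[where a = c and b = b and c = a] E[where a = c and b = a and c = b]
      H[of b c] H[of c a] H[of b a] by simp
qed

text \<open>By \<open>D_D_V\<close> the pair of V and its first derivatives satisfies a linear
  first-order system with coefficients bounded near \<open>x0\<close>, so zero data at
  \<open>x0\<close> propagate along rays.\<close>

lemma vanishing:
  assumes x0: "x0 \<in> U" "\<Xi> x0 = 0" "\<And>a. \<D> \<Xi> x0 a = 0"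
  shows "\<exists>r>0. ball x0 r \<subseteq> U \<and> (\<forall>x\<in>ball x0 r. \<Xi> x = 0)"
proof -
  obtain r where r: "r > 0" "cball x0 r \<subseteq> U" using U x0(1) open_contains_cball by blast
  note ball = subsetD[OF subset_trans[OF ball_subset_cball r(2)]]
  let ?e = "\<lambda>i. axis i 1 :: real ^ 'n"
  \<comment> \<open>A crude continuous majorant of all Christoffel symbols and their first
    derivatives.\<close>
  define \<Phi> where "\<Phi> x = (\<Sum>i\<in>UNIV. \<Sum>j\<in>UNIV. norm (gam G x (?e i) (?e j)) +
    (\<Sum>k\<in>UNIV. norm (\<D> (\<lambda>x. gam G x (?e i) (?e j)) x (?e k))))" for x
  have "continuous_on (cball x0 r) \<Phi>"
    unfolding \<Phi>_def
    by (intro continuous_intros continuous_on_subset[OF C1_continuous_D[OF C1_gam[OF U G det]] r(2)]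
      continuous_on_subset[OF C1_continuous[OF C1_gam[OF U G det]] r(2)])
  then have "bounded (\<Phi> ` cball x0 r)"
    by (intro compact_imp_bounded compact_continuous_image) auto
  then obtain B where B': "\<forall>y\<in>\<Phi> ` cball x0 r. norm y \<le> B" unfolding bounded_iff by blast
  have B: "\<Phi> x \<le> B" if "x \<in> cball x0 r" for x using bspec[OF B' imageI[OF that]] by simp
  have \<Phi>: "norm (gam G x (?e i) (?e j)) \<le> \<Phi> x" "norm (\<D> (\<lambda>x. gam G x (?e i) (?e j)) x (?e k)) \<le> \<Phi> x" for x i j k
  proof -
    let ?h = "\<lambda>i j. \<Sum>k\<in>UNIV. norm (\<D> (\<lambda>x. gam G x (?e i) (?e j)) x (?e k))"
    let ?g = "\<lambda>i j. norm (gam G x (?e i) (?e j)) + ?h i j"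
    have h: "0 \<le> ?h i j" for i j by (rule sum_nonneg) simp
    have "?g i j \<le> (\<Sum>j\<in>UNIV. ?g i j)" by (rule member_le_sum) (use h in auto)
    also have "\<dots> \<le> \<Phi> x" unfolding \<Phi>_def
      by (rule member_le_sum[where f = "\<lambda>i. \<Sum>j\<in>UNIV. ?g i j"]) (use h in \<open>auto intro!: sum_nonneg\<close>)
    finally have g: "?g i j \<le> \<Phi> x" .
    have "norm (\<D> (\<lambda>x. gam G x (?e i) (?e j)) x (?e k)) \<le> ?h i j"
      by (rule member_le_sum) auto
    then show "norm (gam G x (?e i) (?e j)) \<le> \<Phi> x" "norm (\<D> (\<lambda>x. gam G x (?e i) (?e j)) x (?e k)) \<le> \<Phi> x"
      using g h[of i j] norm_ge_zero[of "gam G x (?e i) (?e j)"] by linarith+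
  qed
  define y where "y x = (V x, (\<chi> a. \<D> V x (?e a)))" for x
  let ?H = "\<lambda>x a c. \<D> (\<lambda>x. \<D> V x a) x c"
  have yD: "(y has_derivative (\<lambda>c. (\<D> V x c, (\<chi> a. ?H x (?e a) c)))) (at x)" if x: "x \<in> U" for x
  proof -
    have "((\<lambda>x. \<Sum>a\<in>UNIV. axis a (\<D> V x (?e a))) has_derivative (\<lambda>c. \<Sum>a\<in>UNIV. axis a (?H x (?e a) c))) (at x)"
      by (intro has_derivative_sum bounded_linear.has_derivative[OF bounded_linear_axis] C1_has_D[OF DV_C1 x])
    then show ?thesis
      unfolding y_def[abs_def] sum_axis by (intro has_derivative_Pair C1_has_D[OF V_C1 x])
  qed
  define n where "n = real CARD('n)"
  have yV: "norm (V x) \<le> norm (y x)" "norm (\<D> V x (?e c)) \<le> norm (y x)" for x c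
  proof -
    show "norm (V x) \<le> norm (y x)" unfolding y_def by (rule norm_fst_le)
    have "norm (\<D> V x (?e c)) \<le> norm ((\<chi> a. \<D> V x (?e a)))"
      using Finite_Cartesian_Product.norm_nth_le[where x = "\<chi> a. \<D> V x (?e a)" and i = c] by simp
    also have "\<dots> \<le> norm (y x)" unfolding y_def by (rule norm_snd_le)
    finally show "norm (\<D> V x (?e c)) \<le> norm (y x)" .
  qed
  \<comment> \<open>The 1 accounts for the derivative of V. Each of the three terms S in
    \<open>D_D_V\<close> is at most 2 B |y|, giving 6 B, and the two factors n come from passing
    from entries to norms.\<close>
  define C where "C = 1 + n * (n * (6 * B))"
  have Dy: "norm (\<D> y x (?e c)) \<le> C * norm (y x)" if x: "x \<in> ball x0 r" for x c
  proof -
    note xU = ball[OF x]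
    have BB: "\<Phi> x \<le> B" using B x by auto
    have S: "\<bar>\<D> (\<lambda>x. gam G x (?e i) (?e j)) x (?e k) \<bullet> V x + gam G x (?e i) (?e j) \<bullet> \<D> V x (?e k)\<bar> \<le> 2 * (B * norm (y x))" for i j k
    proof -
      have "\<bar>\<D> (\<lambda>x. gam G x (?e i) (?e j)) x (?e k) \<bullet> V x\<bar> \<le> B * norm (y x)"
        by (rule order_trans[OF Cauchy_Schwarz_ineq2]) (intro mult_mono order_trans[OF \<Phi>(2) BB] yV; simp add: order_trans[OF norm_ge_zero order_trans[OF \<Phi>(1) BB]])
      moreover have "\<bar>gam G x (?e i) (?e j) \<bullet> \<D> V x (?e k)\<bar> \<le> B * norm (y x)"
        by (rule order_trans[OF Cauchy_Schwarz_ineq2]) (intro mult_mono order_trans[OF \<Phi>(1) BB] yV; simp add: order_trans[OF norm_ge_zero order_trans[OF \<Phi>(1) BB]])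
      ultimately show ?thesis by linarith
    qed
    have H: "\<bar>?H x (?e a) (?e c) $ b\<bar> \<le> 6 * B * norm (y x)" for a b c
      using D_D_V[OF xU, of "?e a" "?e c" "?e b"] S[of a b c] S[of c b a] S[of c a b]
      by (simp add: inner_axis)
    have H': "norm (?H x (?e a) (?e c)) \<le> n * (6 * B * norm (y x))" for a
    proof -
      have "norm (?H x (?e a) (?e c)) \<le> (\<Sum>b\<in>UNIV. \<bar>?H x (?e a) (?e c) $ b\<bar>)" by (rule norm_le_l1_cart)
      also have "\<dots> \<le> (\<Sum>b\<in>(UNIV :: 'n set). 6 * B * norm (y x))" by (intro sum_mono H)
      finally show ?thesis by (simp add: n_def)
    qed
    have "norm (\<chi> a. ?H x (?e a) (?e c)) \<le> (\<Sum>a\<in>UNIV. norm ((\<chi> a. ?H x (?e a) (?e c)) $ a))"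
      by (rule norm_vec_le_sum)
    also have "\<dots> \<le> (\<Sum>a\<in>(UNIV :: 'n set). n * (6 * B * norm (y x)))" using H' by (intro sum_mono) simp
    also have "\<dots> = n * (n * (6 * B)) * norm (y x)" by (simp add: n_def)
    finally have "norm (\<D> V x (?e c), (\<chi> a. ?H x (?e a) (?e c))) \<le> norm (y x) + n * (n * (6 * B)) * norm (y x)"
      using norm_Pair_le[of "\<D> V x (?e c)" "\<chi> a. ?H x (?e a) (?e c)"] yV(2)[of x c] by linarith
    then show ?thesis unfolding D_eq[OF yD[OF xU]] C_def by (simp add: algebra_simps)
  qed
  have "y x = 0" if x: "x \<in> ball x0 r" for x
  proof (rule gronwall_zero[of x0 r y "n * C", OF _ _ _ x])
    show "y differentiable (at x)" if "x \<in> ball x0 r" for x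
      using yD[OF ball[OF that]] by (rule differentiableI)
    show "norm (\<D> y x d) \<le> n * C * norm (y x) * norm d" if x: "x \<in> ball x0 r" for x d
      using norm_linear_le[OF linear_D[OF differentiableI[OF yD[OF ball[OF x]]]] Dy[OF x], of d]
      by (simp add: n_def mult_ac)
    show "y x0 = 0"
      using x0 by (simp add: y_def V_def[of x0] D_V zero_prod_def) (simp add: zero_vec_def)
  qed
  then have "V x = 0" if "x \<in> ball x0 r" for x using that by (simp add: y_def zero_prod_def)
  then have "\<Xi> x = 0" if "x \<in> ball x0 r" for x
    by (intro G_nondegenerate[OF ball[OF that]]) (use that in \<open>simp add: V_def\<close>)
  then show ?thesis using r ball by blast
qed

end

section \<open>Zeros of causal Killing fields\<close>

lemma inner_minkowski: "x \<bullet> (minkowski *v y) = x $ 1 * y $ 1 + x $ 2 * y $ 2 + x $ 3 * y $ 3 - x $ 4 * y $ 4"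
proof -
  \<comment> \<open>In the index type 4 the numeral 4 is 0, so the time index 0 of
    \<open>minkowski\<close> is the fourth component.\<close>
  have "(4::4) = 0" "(1::4) \<noteq> 0" "(2::4) \<noteq> 0" "(3::4) \<noteq> 0" by simp_all
  then show ?thesis
    by (simp add: minkowski_def inner_vec_def matrix_vector_mult_def sum_4 if_distrib cong: if_cong)
qed

lemma inner_congruence:
  fixes A :: "real ^ 'n ^ 'n" and P :: "real ^ 'm ^ 'n"
  shows "(P *v x) \<bullet> (A *v (P *v y)) = x \<bullet> ((transpose P ** A ** P) *v y)"
proof -
  have "(P *v x) \<bullet> z = x \<bullet> (transpose P *v z)" for z
    by (metis dot_lmul_matrix vector_transpose_matrix)
  then show ?thesis by (simp only: matrix_vector_mul_assoc matrix_mul_assoc)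
qed

text \<open>In a Lorentz frame, orthogonality and the Cauchy-Schwarz inequality for the spatial
  parts force the time component of v to vanish; causality then leaves no spatial part.\<close>

lemma causal_orthogonal_to_timelike:
  fixes G P :: "real ^ 4 ^ 4"
  assumes P: "invertible P" "transpose P ** G ** P = minkowski"
    and a: "a \<bullet> (G *v a) < 0" "a \<bullet> (G *v v) = 0" and v: "v \<bullet> (G *v v) \<le> 0"
  shows "v = 0"
proof -
  note conv = inner_congruence[of P _ G, unfolded P(2)]
  have inv: "P *v (matrix_inv P *v x) = x" for x
    using matrix_inv(1)[OF P(1)] by (simp add: matrix_vector_mul_assoc)
  define y where "y = matrix_inv P *v a"
  define w where "w = matrix_inv P *v v"
  have aw: "a = P *v y" "v = P *v w" by (simp_all add: y_def w_def inv)
  have 1: "y$1 * y$1 + y$2 * y$2 + y$3 * y$3 < y$4 * y$4"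
    "y$1 * w$1 + y$2 * w$2 + y$3 * w$3 = y$4 * w$4"
    "w$1 * w$1 + w$2 * w$2 + w$3 * w$3 \<le> w$4 * w$4"
    using a v unfolding aw conv inner_minkowski by simp_all
  let ?Y = "y$1 * y$1 + y$2 * y$2 + y$3 * y$3" and ?W = "w$1 * w$1 + w$2 * w$2 + w$3 * w$3"
  have cs: "(y$1 * w$1 + y$2 * w$2 + y$3 * w$3)\<^sup>2 \<le> ?Y * ?W"
  proof -
    \<comment> \<open>Lagrange's identity: this sum of squares is the defect in the Cauchy-Schwarz
      inequality.\<close>
    have "0 \<le> (y$1 * w$2 - y$2 * w$1)\<^sup>2 + (y$1 * w$3 - y$3 * w$1)\<^sup>2 + (y$2 * w$3 - y$3 * w$2)\<^sup>2" by simp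
    then show ?thesis by (simp add: power2_eq_square algebra_simps)
  qed
  have "(y$4 * w$4)\<^sup>2 \<le> ?Y * (w$4 * w$4)"
    using cs 1(2,3) mult_left_mono[OF 1(3), of ?Y] by (smt (verit) zero_le_square)
  then have "(y$4 * y$4 - ?Y) * (w$4 * w$4) \<le> 0" by (simp add: power2_eq_square algebra_simps)
  then have w0: "w $ 4 = 0"
    using 1(1) by (metis diff_gt_0_iff_gt mult_le_0_iff not_le not_square_less_zero mult_eq_0_iff order_antisym)
  then have "?W \<le> 0" using 1(3) by simp
  then have "w $ 1 = 0" "w $ 2 = 0" "w $ 3 = 0"
    by (metis add_nonneg_nonneg add_nonpos_eq_0_iff antisym mult_eq_0_iff zero_le_square add_nonneg_eq_0_iff)+
  then have "w = 0" using w0 by (simp add: vec_eq_iff forall_4)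
  then show ?thesis by (simp add: aw)
qed

text \<open>Causality passes to the derivative: at a zero the quotients \<Xi>(x + t a) / t are
  causal or zero and converge to the derivative in direction a. For timelike a this limit is also
  orthogonal to a, hence zero.\<close>

lemma killing_zero_D_zero:
  fixes G :: "real ^ 4 \<Rightarrow> real ^ 4 ^ 4"
  assumes kc: "killing_chart G \<Xi> U" and x: "x \<in> U" "\<Xi> x = 0"
    and causal: "\<And>y. y \<in> U \<Longrightarrow> \<Xi> y \<bullet> (G y *v \<Xi> y) \<le> 0"
    and P: "invertible P" "transpose P ** G x ** P = minkowski"
  shows "\<D> \<Xi> x a = 0"
proof -
  interpret killing_chart G \<Xi> U by (rule kc)
  let ?F = "\<D> \<Xi> x"
  have F: "linear ?F" by (rule linear_D[OF \<Xi>d[OF x(1)]])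
  have nonpos: "?F a \<bullet> (G x *v ?F a) \<le> 0" for a
  proof -
    have 1: "((\<lambda>t. x + t *\<^sub>R a) has_derivative (\<lambda>s. s *\<^sub>R a)) (at 0)"
      by (auto intro!: derivative_eq_intros)
    have "((\<lambda>t. \<Xi> (x + t *\<^sub>R a)) has_derivative (\<lambda>s. ?F (s *\<^sub>R a))) (at 0)"
      using has_derivative_compose[OF 1, of \<Xi> ?F] has_D[OF \<Xi>d[OF x(1)]] by simp
    then have 2: "((\<lambda>t. norm (\<Xi> (x + t *\<^sub>R a) - t *\<^sub>R ?F a) / norm t) \<longlongrightarrow> 0) (at 0)"
      using x(2) by (simp add: has_derivative_at linear_scale[OF F])
    have 3: "norm (\<Xi> (x + t *\<^sub>R a) - t *\<^sub>R ?F a) / norm t = norm ((1 / t) *\<^sub>R \<Xi> (x + t *\<^sub>R a) - ?F a)"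
      if "t \<noteq> 0" for t
    proof -
      have "(1 / t) *\<^sub>R \<Xi> (x + t *\<^sub>R a) - ?F a = (1 / t) *\<^sub>R (\<Xi> (x + t *\<^sub>R a) - t *\<^sub>R ?F a)"
        using that by (simp add: scaleR_diff_right)
      then show ?thesis by simp
    qed
    have "((\<lambda>t. norm ((1 / t) *\<^sub>R \<Xi> (x + t *\<^sub>R a) - ?F a)) \<longlongrightarrow> 0) (at 0)"
      by (rule Lim_transform_eventually[OF 2]) (use 3 in \<open>simp add: eventually_at_filter\<close>)
    then have lim: "((\<lambda>t. (1 / t) *\<^sub>R \<Xi> (x + t *\<^sub>R a)) \<longlongrightarrow> ?F a) (at 0)"
      unfolding Lim_null[where l = "?F a"] by (rule tendsto_norm_zero_cancel)
    have sh: "((\<lambda>t. x + t *\<^sub>R a) \<longlongrightarrow> x) (at 0)" by (auto intro!: tendsto_eq_intros)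
    have "(G \<longlongrightarrow> G x) (nhds x)"
      using differentiable_imp_continuous_within[OF Gd[OF x(1)]] by (simp add: continuous_at tendsto_at_iff_tendsto_nhds)
    then have Glim: "((\<lambda>t. G (x + t *\<^sub>R a)) \<longlongrightarrow> G x) (at 0)"
      using filterlim_compose[of G "nhds (G x)" "nhds x" "\<lambda>t. x + t *\<^sub>R a" "at 0"] sh by simp
    have "((\<lambda>t. (1 / t) *\<^sub>R \<Xi> (x + t *\<^sub>R a) \<bullet> (G (x + t *\<^sub>R a) *v ((1 / t) *\<^sub>R \<Xi> (x + t *\<^sub>R a)))) \<longlongrightarrow> ?F a \<bullet> (G x *v ?F a)) (at 0)"
      by (intro tendsto_inner mv.tendsto lim Glim)
    moreover have "\<forall>\<^sub>F t in at 0. x + t *\<^sub>R a \<in> U" by (rule topological_tendstoD[OF sh U x(1)])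
    then have "\<forall>\<^sub>F t in at 0. (1 / t) *\<^sub>R \<Xi> (x + t *\<^sub>R a) \<bullet> (G (x + t *\<^sub>R a) *v ((1 / t) *\<^sub>R \<Xi> (x + t *\<^sub>R a))) \<le> 0"
    proof eventually_elim
      case (elim t)
      have "(1 / t) * ((1 / t) * (\<Xi> (x + t *\<^sub>R a) \<bullet> (G (x + t *\<^sub>R a) *v \<Xi> (x + t *\<^sub>R a)))) \<le> 0"
        unfolding mult.assoc[symmetric] by (rule mult_nonneg_nonpos[OF zero_le_square causal[OF elim]])
      then show ?case by (simp add: mv.scaleR_right)
    qed
    ultimately show ?thesis by (rule tendsto_upperbound) simp
  qed
  have orth: "a \<bullet> (G x *v ?F a) = 0" for a
    using lie[OF x(1), of a a] x(2) G_commute[OF x(1), of a "?F a"] D_lin_scale[OF Gd[OF x(1)], of 0 0] by simp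
  have timelike: "?F a = 0" if "a \<bullet> (G x *v a) < 0" for a
    by (rule causal_orthogonal_to_timelike[OF P that orth nonpos])
  note conv = inner_congruence[of P _ "G x", unfolded P(2)]
  have e0: "?F (P *v axis 4 1) = 0"
    by (rule timelike) (simp add: conv inner_minkowski axis_def)
  have ei: "?F (P *v axis i 1) = 0" for i
  proof (cases "i = 4")
    case False
    \<comment> \<open>Twice the time axis plus a spatial unit vector is still timelike, and the time
      axis itself is already mapped to zero; so the spatial axes are mapped to zero as well.\<close>
    have "?F (P *v (2 *\<^sub>R axis 4 1 + axis i 1)) = 0"
    proof (rule timelike)
      consider "i = 1" | "i = 2" | "i = 3" using False exhaust_4[of i] by auto
      then show "(P *v (2 *\<^sub>R axis 4 1 + axis i 1)) \<bullet> (G x *v (P *v (2 *\<^sub>R axis 4 1 + axis i 1))) < 0"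
        by cases (simp_all add: conv inner_minkowski axis_def)
    qed
    then show ?thesis
      using e0 by (simp add: mv.add_right mv.scaleR_right linear_add[OF F] linear_scale[OF F])
  qed (use e0 in simp)
  have "linear (\<lambda>z. ?F (P *v z))" by (rule linear_compose[OF matrix_vector_mul_linear F, unfolded o_def])
  from linear_axis_sum[OF this, of "matrix_inv P *v a"]
  show ?thesis using ei matrix_inv(1)[OF P(1)] by (simp add: matrix_vector_mul_assoc)
qed

section \<open>Space-times\<close>

lemma minkowski_sym: "transpose minkowski = minkowski"
  by (simp add: minkowski_def transpose_def vec_eq_iff)

lemma minkowski_square: "minkowski ** minkowski = mat 1"
  by (simp add: minkowski_def matrix_matrix_mult_def mat_def vec_eq_iff forall_4 sum_4)

locale spacetime_charts =
  fixes A :: "('p::{t2_space,second_countable_topology}, 4) chart set"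
    and g :: "('p, 4) bilinear_field" and T :: "('p, 4) vector_field"
  assumes st: "spacetime A g T"
begin

lemma chart: "c \<in> A \<Longrightarrow> is_chart c"
  using st by (simp add: spacetime_def smooth_atlas_def)

lemma chart_cover: "\<exists>c\<in>A. p \<in> chart_dom c"
  using st by (auto simp: spacetime_def smooth_atlas_def)

lemma chart_open: "c \<in> A \<Longrightarrow> open (chart_dom c)"
  using chart by (auto simp: is_chart_def)

lemma chart_homeo: "c \<in> A \<Longrightarrow> homeomorphism (chart_dom c) (coords c ` chart_dom c) (coords c) (chart_inv c)"
  using chart by (auto simp: is_chart_def)

lemma chart_inv_coords: "c \<in> A \<Longrightarrow> p \<in> chart_dom c \<Longrightarrow> chart_inv c (coords c p) = p"
  using chart_homeo by (meson homeomorphism_apply1)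

lemma open_coords_image:
  assumes "c \<in> A" "open N" shows "open (coords c ` (chart_dom c \<inter> N))"
proof -
  have "openin (top_of_set (chart_dom c)) (chart_dom c \<inter> N)" using assms(2) by (rule openin_open_Int)
  then have "openin (top_of_set (coords c ` chart_dom c)) (coords c ` (chart_dom c \<inter> N))"
    by (rule homeomorphism_imp_open_map[OF chart_homeo[OF assms(1)]])
  moreover have "open (coords c ` chart_dom c)" using chart[OF assms(1)] by (auto simp: is_chart_def)
  ultimately show ?thesis by (auto dest: openin_open_trans)
qed

abbreviation Gc where "Gc c \<equiv> \<lambda>x. g c (chart_inv c x)"

lemma Gc_smooth: "c \<in> A \<Longrightarrow> smooth_on (Gc c) (coords c ` chart_dom c)"
  using st by (auto simp: spacetime_def lorentz_metric_def smooth_field_on_def o_def)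

lemma lorentz_frame:
  "c \<in> A \<Longrightarrow> p \<in> chart_dom c \<Longrightarrow> \<exists>P. invertible P \<and> transpose P ** g c p ** P = minkowski"
  using st by (auto simp: spacetime_def lorentz_metric_def)

text \<open>\<open>lorentz_metric\<close> has no separate symmetry clause; symmetry comes from the
  congruence to the symmetric matrix \<open>minkowski\<close>.\<close>

lemma g_sym: assumes "c \<in> A" "p \<in> chart_dom c" shows "transpose (g c p) = g c p"
proof -
  obtain P where P: "invertible P" "transpose P ** g c p ** P = minkowski"
    using lorentz_frame[OF assms] by blast
  let ?Q = "matrix_inv P"
  have PQ: "P ** ?Q = mat 1" using matrix_inv[OF P(1)] by simp
  have QP: "transpose ?Q ** transpose P = mat 1"
    by (metis PQ matrix_transpose_mul transpose_mat)
  have eq: "transpose ?Q ** minkowski ** ?Q = g c p"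
  proof -
    have "transpose ?Q ** minkowski ** ?Q = (transpose ?Q ** transpose P) ** g c p ** (P ** ?Q)"
      unfolding P(2)[symmetric] by (simp only: matrix_mul_assoc)
    then show ?thesis by (simp add: PQ QP)
  qed
  have "transpose (transpose ?Q ** minkowski ** ?Q) = transpose ?Q ** minkowski ** ?Q"
    by (simp add: matrix_transpose_mul minkowski_sym matrix_mul_assoc)
  then show ?thesis unfolding eq .
qed

lemma g_det: assumes "c \<in> A" "p \<in> chart_dom c" shows "det (g c p) \<noteq> 0"
proof -
  obtain P where P: "transpose P ** g c p ** P = minkowski" using lorentz_frame[OF assms] by blast
  have "det minkowski * det minkowski = 1"
    using arg_cong[OF minkowski_square, of det] by (simp add: det_mul)
  then have "det (transpose P ** g c p ** P) \<noteq> 0" unfolding P by auto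
  then show ?thesis by (auto simp: det_mul)
qed

lemma Gc_diff: "c \<in> A \<Longrightarrow> p \<in> chart_dom c \<Longrightarrow> Gc c differentiable (at (coords c p))"
  by (rule smooth_differentiable[OF Gc_smooth]) auto

lemma pderiv_chart_eq:
  assumes "(\<lambda>x. f (chart_inv c x)) differentiable (at (coords c p))" "bounded_linear l"
  shows "pderiv_chart c i (\<lambda>x. l (f x)) p = l (\<D> (\<lambda>x. f (chart_inv c x)) (coords c p) (axis i 1))"
  unfolding pderiv_chart_def o_def by (rule D_linear[OF assms(2,1)])

lemma christoffel_gam:
  assumes "c \<in> A" "p \<in> chart_dom c"
  shows "christoffel g c p k i j = gam (Gc c) (coords c p) (axis i 1) (axis j 1) $ k"
proof -
  have d: "pderiv_chart c i (\<lambda>x. g c x $ j $ l) p = \<D> (Gc c) (coords c p) (axis i 1) $ j $ l" for i j l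
    by (rule pderiv_chart_eq[OF Gc_diff[OF assms] bounded_linear_nth_nth])
  show ?thesis
    unfolding christoffel_def gam_def d sandwich_nth chart_inv_coords[OF assms]
    by (simp add: matrix_vector_mult_def sum_divide_distrib)
qed

lemma nabla1_gam:
  assumes "c \<in> A" "p \<in> chart_dom c" "(\<lambda>x. V (chart_inv c x)) differentiable (at (coords c p))"
  shows "nabla1 g c V p $ a $ b = \<D> (\<lambda>x. V (chart_inv c x)) (coords c p) (axis a 1) $ b
    - gam (Gc c) (coords c p) (axis a 1) (axis b 1) \<bullet> V p"
  unfolding nabla1_def christoffel_gam[OF assms(1,2)]
  by (simp add: pderiv_chart_eq[OF assms(3) bounded_linear_vec_nth] inner_vec_def)

lemma Gc_gam_linear:
  assumes "c \<in> A" "p \<in> chart_dom c"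
  shows "linear (gam (Gc c) (coords c p) a)" "linear (\<lambda>a. gam (Gc c) (coords c p) a b)"
  using gam_linear[OF Gc_diff[OF assms]] by auto

lemma Gc_gam_commute:
  assumes c: "c \<in> A" "p \<in> chart_dom c"
  shows "gam (Gc c) (coords c p) a b = gam (Gc c) (coords c p) b a"
proof (rule gam_sym)
  have "open (coords c ` chart_dom c)" using open_coords_image[OF c(1), of UNIV] by simp
  then show "transpose (\<D> (Gc c) (coords c p) v) = \<D> (Gc c) (coords c p) v" for v
    by (rule transpose_D[OF _ _ _ Gc_diff[OF c]]) (use c g_sym[OF c(1)] chart_inv_coords[OF c(1)] in auto)
qed

lemma Gc_C1_gam: "c \<in> A \<Longrightarrow> C1_on (\<lambda>x. gam (Gc c) x a b) (coords c ` chart_dom c)"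
  by (rule C1_gam[OF _ Gc_smooth])
    (use open_coords_image[of c UNIV] g_det[of c] chart_inv_coords[of c] in auto)

lemma riemann_riem:
  assumes c: "c \<in> A" "p \<in> chart_dom c"
  shows "riemann g c p a b e d = riem (Gc c) (coords c p) (axis a 1) (axis b 1) (axis e 1) $ d"
proof -
  let ?x = "coords c p" and ?G = "\<lambda>x i j. gam (Gc c) x (axis i 1) (axis j 1)"
  \<comment> \<open>The coordinate covector has constant components, so only the Christoffel term
    survives.\<close>
  have n: "nabla1 g c (\<lambda>_. axis d 1) q $ i $ j = - (?G (coords c q) i j $ d)" if "q \<in> chart_dom c" for q i j
    using nabla1_gam[OF c(1) that, of "\<lambda>_. axis d 1" i j] by (simp add: inner_axis)
  have gd: "(\<lambda>x. ?G x i j) differentiable (at ?x)" for i j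
    by (rule C1_differentiable[OF Gc_C1_gam]) (use c in auto)
  have pd: "pderiv_chart c a (\<lambda>x. nabla1 g c (\<lambda>_. axis d 1) x $ i $ j) p = - (\<D> (\<lambda>x. ?G x i j) ?x (axis a 1) $ d)" for a i j
  proof -
    let ?f = "\<lambda>x. - (?G x i j $ d)"
    have bl: "bounded_linear (\<lambda>v :: real ^ 4. - (v $ d))" by (intro bounded_linear_minus bounded_linear_vec_nth)
    have fd: "?f differentiable (at ?x)"
      using bounded_linear.has_derivative[OF bl has_D[OF gd]] by (rule differentiableI)
    have "open (coords c ` chart_dom c)" using open_coords_image[OF c(1), of UNIV] by simp
    then have "\<D> ?f ?x = \<D> (\<lambda>x. nabla1 g c (\<lambda>_. axis d 1) (chart_inv c x) $ i $ j) ?x"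
      by (rule D_cong[OF _ _ _ fd]) (use c n chart_inv_coords[OF c(1)] in auto)
    then show ?thesis unfolding pderiv_chart_def o_def using D_linear[OF bl gd] by metis
  qed
  have ge: "gam (Gc c) ?x (axis i 1) v $ d = (\<Sum>f\<in>UNIV. v $ f * ?G ?x i f $ d)" for i v
    using linear_axis_sum[OF Gc_gam_linear(1)[OF c], of "axis i 1" v] by simp
  show ?thesis
    unfolding riemann_def nabla2_def pd n[OF c(2)] christoffel_gam[OF c] riem_def
    by (simp add: ge[of b "?G ?x a e"] ge[of a "?G ?x b e"] Gc_gam_commute[OF c, of "axis b 1" "axis a 1"] sum_negf)
qed

lemma ricci_riem:
  assumes c: "c \<in> A" "p \<in> chart_dom c"
  shows "v \<bullet> (ricci g c p *v v) = ltrace (\<lambda>b. riem (Gc c) (coords c p) v b v)"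
proof -
  let ?x = "coords c p"
  let ?R = "riem (Gc c) ?x"
  note gl = Gc_gam_linear[OF c]
  have C1: "open (coords c ` chart_dom c)" "?x \<in> coords c ` chart_dom c"
    using open_coords_image[OF c(1), of UNIV] c by auto
  have gd: "(\<lambda>x. gam (Gc c) x a e) differentiable (at ?x)" for a e
    by (rule C1_differentiable[OF Gc_C1_gam[OF c(1)] C1(2)])
  have glU: "linear (gam (Gc c) x a)" "linear (\<lambda>a. gam (Gc c) x a e)" if "x \<in> coords c ` chart_dom c" for x a e
    using that gam_linear[OF Gc_diff[OF c(1)]] by auto
  have l1: "linear (\<lambda>a. ?R a b e)" for b e
    unfolding riem_def
    by (intro linear_compose_add linear_compose_sub linear_D_family[OF C1] glU gd linear_D gl
        linear_compose[OF gl(2) gl(1), unfolded o_def])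
  have l3: "linear (\<lambda>e. ?R a b e)" for a b
    unfolding riem_def
    by (intro linear_compose_add linear_compose_sub linear_D_family[OF C1] glU gd linear_D gl
        linear_compose[OF gl(1) gl(1), unfolded o_def])
  have "?R v (axis b 1) v $ b = (\<Sum>a\<in>UNIV. \<Sum>e\<in>UNIV. v $ a * (v $ e * ?R (axis a 1) (axis b 1) (axis e 1) $ b))" for b
  proof -
    have "?R v (axis b 1) v = (\<Sum>a\<in>UNIV. v $ a *\<^sub>R (\<Sum>e\<in>UNIV. v $ e *\<^sub>R ?R (axis a 1) (axis b 1) (axis e 1)))"
      using linear_axis_sum[OF l1, of v "axis b 1" v] linear_axis_sum[OF l3, of _ "axis b 1" v]
      by (metis (no_types, lifting) sum.cong)
    then show ?thesis by (simp add: sum_distrib_left)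
  qed
  then have "ltrace (\<lambda>b. ?R v b v) = (\<Sum>b\<in>UNIV. \<Sum>a\<in>UNIV. \<Sum>e\<in>UNIV. v $ a * (v $ e * riemann g c p a b e b))"
    by (simp add: ltrace_def riemann_riem[OF c])
  also have "\<dots> = (\<Sum>a\<in>UNIV. \<Sum>e\<in>UNIV. \<Sum>b\<in>UNIV. v $ a * (v $ e * riemann g c p a b e b))"
    by (subst sum.swap) (intro sum.cong refl sum.swap)
  also have "\<dots> = v \<bullet> (ricci g c p *v v)"
    by (simp add: ricci_def inner_vec_def matrix_vector_mult_def sum_distrib_left mult_ac)
  finally show ?thesis by simp
qed

lemma jacobian_D:
  assumes "c \<in> A" "c' \<in> A" "p \<in> chart_dom c \<inter> chart_dom c'"
  shows "jacobian c c' p *v v = \<D> (transition c c') (coords c p) v"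
proof -
  have "smooth_on (transition c c') (coords c ` (chart_dom c \<inter> chart_dom c'))"
    using st assms by (simp add: spacetime_def smooth_atlas_def)
  then have "linear (\<D> (transition c c') (coords c p))"
    by (intro linear_D smooth_differentiable) (use assms in auto)
  then show ?thesis by (simp add: jacobian_def matrix_works)
qed

lemma vector_change:
  assumes "c \<in> A" "c' \<in> A" "vector_on A X v" "p \<in> X" "p \<in> chart_dom c" "p \<in> chart_dom c'"
  shows "v c' p = \<D> (transition c c') (coords c p) (v c p)"
proof -
  have "v c' p = jacobian c c' p *v v c p" using assms unfolding vector_on_def by blast
  then show ?thesis using jacobian_D[OF assms(1,2)] assms(5,6) by simp
qed

lemma metric_change:
  assumes "c \<in> A" "c' \<in> A" "p \<in> chart_dom c" "p \<in> chart_dom c'"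
  shows "a \<bullet> (g c p *v b) = \<D> (transition c c') (coords c p) a \<bullet> (g c' p *v \<D> (transition c c') (coords c p) b)"
proof -
  have "g c p = transpose (jacobian c c' p) ** g c' p ** jacobian c c' p"
    using st assms unfolding spacetime_def lorentz_metric_def bilinear_on_def by blast
  then show ?thesis
    using inner_congruence[of "jacobian c c' p" a "g c' p" b] jacobian_D[OF assms(1,2)] assms(3,4) by simp
qed

text \<open>Expanding the Christoffel symbols turns the symmetrised covariant derivative into the
  Lie derivative of the metric. The latter is bilinear in a and b, so coordinate directions
  suffice.\<close>

lemma killing_chart_of:
  assumes K: "killing_on A g R \<xi>" and R: "open R" and c: "c \<in> A"
  shows "killing_chart (Gc c) (\<lambda>x. \<xi> c (chart_inv c x)) (coords c ` (chart_dom c \<inter> R))"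
proof -
  let ?\<Xi> = "\<lambda>x. \<xi> c (chart_inv c x)" and ?U = "coords c ` (chart_dom c \<inter> R)"
  have smG: "smooth_on (Gc c) ?U" by (rule smooth_on_subset[OF Gc_smooth[OF c]]) auto
  have sm\<Xi>: "smooth_on ?\<Xi> ?U"
    using K c by (auto simp: killing_on_def smooth_vector_field_on_def smooth_field_on_def o_def)
  show ?thesis
  proof
    fix x a b assume "x \<in> ?U"
    then obtain p where p: "p \<in> chart_dom c" "p \<in> R" "x = coords c p" by auto
    have ip: "chart_inv c x = p" using p chart_inv_coords[OF c] by simp
    have Gd: "Gc c differentiable (at x)" and \<Xi>d: "?\<Xi> differentiable (at x)"
      using smooth_differentiable[OF smG \<open>x \<in> ?U\<close>] smooth_differentiable[OF sm\<Xi> \<open>x \<in> ?U\<close>] .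
    note sym = sym_matrix_inner[OF g_sym[OF c p(1)]]
    let ?N = "\<lambda>a b. nabla1 g c (\<lambda>x. g c x *v \<xi> c x) p $ a $ b"
    let ?f = "\<lambda>a b. \<D> ?\<Xi> x a \<bullet> (g c p *v b) + a \<bullet> (g c p *v \<D> ?\<Xi> x b) + a \<bullet> (\<D> (Gc c) x (?\<Xi> x) *v b)"
    have DGs: "v \<bullet> (\<D> (Gc c) x a *v w) = w \<bullet> (\<D> (Gc c) x a *v v)" for v w a
    proof (rule sym_matrix_inner[OF transpose_D[OF open_coords_image[OF c R] \<open>x \<in> ?U\<close> _ Gd]])
      show "transpose (g c (chart_inv c y)) = g c (chart_inv c y)" if "y \<in> ?U" for y
        using that g_sym[OF c] chart_inv_coords[OF c] by auto
    qed
    have N: "?N a b = axis b 1 \<bullet> (\<D> (Gc c) x (axis a 1) *v ?\<Xi> x) + axis b 1 \<bullet> (g c p *v \<D> ?\<Xi> x (axis a 1))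
        - (axis b 1 \<bullet> (\<D> (Gc c) x (axis a 1) *v ?\<Xi> x) + axis a 1 \<bullet> (\<D> (Gc c) x (axis b 1) *v ?\<Xi> x)
            - axis a 1 \<bullet> (\<D> (Gc c) x (?\<Xi> x) *v axis b 1)) / 2" for a b
    proof -
      have "?N a b = \<D> (\<lambda>x. Gc c x *v ?\<Xi> x) x (axis a 1) $ b
          - gam (Gc c) x (axis a 1) (axis b 1) \<bullet> (g c p *v \<xi> c p)"
        unfolding p(3)
        by (rule nabla1_gam[OF c p(1)]) (use differentiable_mv[OF Gd \<Xi>d] p in simp)
      also have "gam (Gc c) x (axis a 1) (axis b 1) \<bullet> (g c p *v \<xi> c p)
          = \<xi> c p \<bullet> (g c p *v gam (Gc c) x (axis a 1) (axis b 1))" by (rule sym)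
      also have "\<dots> = (axis b 1 \<bullet> (\<D> (Gc c) x (axis a 1) *v \<xi> c p) + axis a 1 \<bullet> (\<D> (Gc c) x (axis b 1) *v \<xi> c p)
            - axis a 1 \<bullet> (\<D> (Gc c) x (\<xi> c p) *v axis b 1)) / 2"
        using inner_gam[OF Gd, of "\<xi> c p"] g_sym[OF c p(1)] g_det[OF c p(1)] ip by simp
      finally show ?thesis
        unfolding D_mv[OF Gd \<Xi>d] ip by (simp add: inner_axis' inner_add_right)
    qed
    have N0: "?N a b + ?N b a = 0" for a b
      using K c p by (auto simp: killing_on_def)
    have f0: "?f (axis i 1) (axis j 1) = 0" for i j
      using N0[of i j] N[of i j] N[of j i] sym[of "axis j 1" "\<D> ?\<Xi> x (axis i 1)"]
        DGs[of "axis j 1" "axis i 1" "?\<Xi> x"] DGs[of "axis j 1" "?\<Xi> x" "axis i 1"]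
      by (simp add: field_simps)
    have "?f a b = 0"
    proof (rule bilinear_form_zero[where f = ?f])
      show "?f (axis i 1) (axis j 1) = 0" for i j by (rule f0)
      note l\<Xi> = linear_D[OF \<Xi>d]
      show "linear (?f a)" for a
        by (rule linearI) (simp_all add: linear_add[OF l\<Xi>] linear_scale[OF l\<Xi>] mv.add_right mv.scaleR_right
            inner_add_right algebra_simps)
      show "linear (\<lambda>a. ?f a b)" for b
        by (rule linearI) (simp_all add: linear_add[OF l\<Xi>] linear_scale[OF l\<Xi>] inner_add_left algebra_simps)
    qed
    then show "\<D> ?\<Xi> x a \<bullet> (Gc c x *v b) + a \<bullet> (Gc c x *v \<D> ?\<Xi> x b) + a \<bullet> (\<D> (Gc c) x (?\<Xi> x) *v b) = 0"
      unfolding ip by simp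
  qed (use smG sm\<Xi> open_coords_image[OF c R] g_sym[OF c] g_det[OF c] chart_inv_coords[OF c] in auto)
qed

lemma D_transition_zero:
  assumes "c \<in> A" "c' \<in> A" "p \<in> chart_dom c" "p \<in> chart_dom c'"
  shows "\<D> (transition c c') (coords c p) 0 = 0"
  using jacobian_D[OF assms(1,2), of p 0] assms by simp

text \<open>The zero set is open by \<open>killing_zero_D_zero\<close> and \<open>vanishing\<close>,
  and its complement in R is open by continuity. As R is connected and \<xi> is nonzero somewhere,
  there are no zeros.\<close>

lemma causal_killing_nonzero:
  assumes ck: "causal_killing_on A g R \<xi>" and R: "region R" and c: "c \<in> A" "p \<in> R" "p \<in> chart_dom c"
  shows "\<xi> c p \<noteq> 0"
proof -
  have Ro: "open R" and Rc: "connected R" using R by (auto simp: region_def)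
  have K: "killing_on A g R \<xi>" using ck by (simp add: causal_killing_on_def)
  have vec: "vector_on A R \<xi>" using K by (simp add: killing_on_def smooth_vector_field_on_def)
  \<comment> \<open>A field is a family of components, so Z asks for zero components in every chart;
    by the transformation law one chart is enough.\<close>
  define Z where "Z = {q \<in> R. \<forall>c\<in>A. q \<in> chart_dom c \<longrightarrow> \<xi> c q = 0}"
  have indep: "q \<in> Z" if "c \<in> A" "q \<in> R" "q \<in> chart_dom c" "\<xi> c q = 0" for c q
    unfolding Z_def using vector_change[OF that(1) _ vec that(2,3)] D_transition_zero[OF that(1) _ that(3)] that by auto
  have nbhd: "\<exists>N. open N \<and> q \<in> N \<and> (\<forall>q'\<in>N. q' \<in> R \<longrightarrow> (q' \<in> Z \<longleftrightarrow> q \<in> Z))" if q: "q \<in> R" for q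
  proof -
    obtain c where c: "c \<in> A" "q \<in> chart_dom c" using chart_cover by blast
    let ?\<Xi> = "\<lambda>x. \<xi> c (chart_inv c x)" and ?U = "coords c ` (chart_dom c \<inter> R)"
    interpret killing_chart "Gc c" ?\<Xi> ?U by (rule killing_chart_of[OF K Ro c(1)])
    have xU: "coords c q \<in> ?U" using c q by auto
    note inv = chart_inv_coords[OF c(1)]
    have cont: "continuous_on (chart_dom c) (coords c)" using chart_homeo[OF c(1)] by (simp add: homeomorphism_def)
    have pull: "open {q' \<in> chart_dom c. coords c q' \<in> B}" if "open B" for B
      using continuous_open_preimage[OF cont chart_open[OF c(1)] that] by (simp add: vimage_def Int_def)
    show ?thesis
    proof (cases "\<xi> c q = 0")
      case True
      obtain P where P: "invertible P" "transpose P ** g c q ** P = minkowski"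
        using lorentz_frame[OF c] by blast
      have "\<D> ?\<Xi> (coords c q) a = 0" for a
      proof (rule killing_zero_D_zero[OF killing_chart_axioms xU, of P])
        show "?\<Xi> y \<bullet> (Gc c y *v ?\<Xi> y) \<le> 0" if "y \<in> ?U" for y
          using that ck c(1) inv by (auto simp: causal_killing_on_def g_prod_def)
      qed (use P True inv c in auto)
      then obtain r where r: "r > 0" "\<forall>x\<in>ball (coords c q) r. ?\<Xi> x = 0"
        using vanishing[OF xU] True inv c(2) by auto
      have "q' \<in> Z" if "q' \<in> chart_dom c" "coords c q' \<in> ball (coords c q) r" "q' \<in> R" for q'
        using indep[OF c(1) that(3,1)] bspec[OF r(2) that(2)] inv[OF that(1)] by simp
      moreover have "q \<in> Z" using indep[OF c(1) q c(2) True] .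
      ultimately show ?thesis
        using pull[of "ball (coords c q) r"] c r(1)
        by (intro exI[of _ "{q' \<in> chart_dom c. coords c q' \<in> ball (coords c q) r}"]) auto
    next
      case False
      have "open {x \<in> ?U. ?\<Xi> x \<in> - {0}}"
        using continuous_open_preimage[OF C1_continuous[OF smooth_on_C1[OF \<Xi>]] U, of "- {0}"]
        by (simp add: vimage_def Int_def open_Compl)
      from pull[OF this] have "open {q' \<in> chart_dom c. coords c q' \<in> {x \<in> ?U. ?\<Xi> x \<in> - {0}}}" (is "open ?N") .
      moreover have "q \<in> ?N" using c(2) xU False inv[OF c(2)] by simp
      moreover have notZ: "q' \<notin> Z" if "q' \<in> ?N" for q'
      proof -
        have "q' \<in> chart_dom c" "?\<Xi> (coords c q') \<noteq> 0" using that by auto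
        then show ?thesis using c(1) inv by (auto simp: Z_def)
      qed
      ultimately show ?thesis by (intro exI[of _ ?N]) blast
    qed
  qed
  have "(\<lambda>q. q \<in> Z) constant_on R"
  proof (rule locally_constant_imp_constant[OF Rc])
    fix q assume "q \<in> R"
    then obtain N where N: "open N" "q \<in> N" "\<forall>q'\<in>N. q' \<in> R \<longrightarrow> (q' \<in> Z \<longleftrightarrow> q \<in> Z)" using nbhd by blast
    then show "\<exists>T. openin (top_of_set R) T \<and> q \<in> T \<and> (\<forall>x\<in>T. (x \<in> Z) = (q \<in> Z))"
      using \<open>q \<in> R\<close> openin_open_Int[OF N(1), of R] by (intro exI[of _ "R \<inter> N"]) blast
  qed
  moreover obtain c' p' where "c' \<in> A" "p' \<in> R" "p' \<in> chart_dom c'" "\<xi> c' p' \<noteq> 0"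
    using ck by (auto simp: causal_killing_on_def)
  ultimately have "p' \<notin> Z" "(p \<in> Z) = (p' \<in> Z)"
    using c(2) unfolding constant_on_def by (auto simp: Z_def)
  then show ?thesis using indep[OF c] by blast
qed

end

section \<open>Null frames\<close>

lemma left_inverse_matrix_unique:
  fixes A B :: "real ^ 'n ^ 'n"
  assumes "A ** B = mat 1"
  shows "matrix_inv A = B"
proof -
  have "invertible A" using assms matrix_left_right_inverse unfolding invertible_def by blast
  from matrix_inv(2)[OF this] show ?thesis
    by (metis assms matrix_mul_assoc matrix_mul_lid matrix_mul_rid)
qed

section \<open>Traces and divergences with respect to a metric in parameters\<close>

definition form_matrix :: "(real ^ 'n \<Rightarrow> real ^ 'n \<Rightarrow> real) \<Rightarrow> real ^ 'n ^ 'n" where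
  "form_matrix f = (\<chi> i j. f (axis i 1) (axis j 1))"

lemma inner_form_matrix:
  assumes "\<And>a. linear (f a)" "\<And>b. linear (\<lambda>a. f a b)"
  shows "a \<bullet> (form_matrix f *v b) = f a b"
proof -
  have "f (axis i 1) b = (form_matrix f *v b) $ i" for i
    using linear_axis_sum[OF assms(1)[of "axis i 1"], of b]
    by (simp add: form_matrix_def matrix_vector_mult_def mult.commute)
  then show ?thesis
    using linear_axis_sum[OF assms(2)[of b], of a] by (simp add: inner_vec_def)
qed

definition metric_trace :: "real ^ 'n ^ 'n \<Rightarrow> (real ^ 'n \<Rightarrow> real ^ 'n \<Rightarrow> real) \<Rightarrow> real" where
  "metric_trace q f = (\<Sum>i\<in>UNIV. \<Sum>j\<in>UNIV. matrix_inv q $ i $ j * f (axis i 1) (axis j 1))"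

lemma metric_trace_add: "metric_trace q (\<lambda>a b. f a b + h a b) = metric_trace q f + metric_trace q h"
  by (simp add: metric_trace_def sum.distrib algebra_simps)

lemma metric_trace_scale: "metric_trace q (\<lambda>a b. r * f a b) = r * metric_trace q f"
  by (simp add: metric_trace_def sum_distrib_left algebra_simps)

lemma metric_trace_eq: "metric_trace q f = trace (matrix_inv q ** transpose (form_matrix f))"
  by (simp add: metric_trace_def trace_def matrix_matrix_mult_def form_matrix_def transpose_def)

text \<open>The inverse of J^T q J is J^-1 q^-1 J^-T, and the factors J cancel under the cyclic
  trace. This is the independence of the trace from the frame.\<close>

lemma metric_trace_congruence:
  fixes J q :: "real ^ 'n ^ 'n"
  assumes q: "det q \<noteq> 0" and J: "det J \<noteq> 0"
    and f: "\<And>a. linear (f a)" "\<And>b. linear (\<lambda>a. f a b)"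
  shows "metric_trace (transpose J ** q ** J) (\<lambda>a b. f (J *v a) (J *v b)) = metric_trace q f"
proof -
  let ?J' = "matrix_inv J" and ?q' = "matrix_inv q" and ?f = "form_matrix f"
  have JJ': "J ** ?J' = mat 1" "?J' ** J = mat 1" using matrix_inv J by (auto simp: invertible_det_nz)
  have qq': "q ** ?q' = mat 1" using matrix_inv q by (auto simp: invertible_det_nz)
  have JT: "transpose J ** transpose ?J' = mat 1" "transpose ?J' ** transpose J = mat 1"
    by (metis JJ' matrix_transpose_mul transpose_mat)+
  have "(transpose J ** q ** J) ** (?J' ** ?q' ** transpose ?J') =
      transpose J ** (q ** ((J ** ?J') ** ?q')) ** transpose ?J'"
    by (simp only: matrix_mul_assoc)
  then have inv: "matrix_inv (transpose J ** q ** J) = ?J' ** ?q' ** transpose ?J'"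
    by (intro left_inverse_matrix_unique) (simp add: JJ' qq' JT)
  have "form_matrix (\<lambda>a b. f (J *v a) (J *v b)) = transpose J ** ?f ** J"
  proof -
    have "f (J *v a) (J *v b) = a \<bullet> ((transpose J ** ?f ** J) *v b)" for a b
      unfolding inner_congruence[symmetric] by (rule inner_form_matrix[OF f, symmetric])
    then show ?thesis by (simp add: form_matrix_def sandwich_nth vec_eq_iff)
  qed
  then have "metric_trace (transpose J ** q ** J) (\<lambda>a b. f (J *v a) (J *v b)) =
      trace ((?J' ** ?q' ** transpose ?J') ** (transpose J ** transpose ?f ** J))"
    unfolding metric_trace_eq inv by (simp add: matrix_transpose_mul matrix_mul_assoc)
  also have "(?J' ** ?q' ** transpose ?J') ** (transpose J ** transpose ?f ** J) =
      ?J' ** (?q' ** (transpose ?J' ** transpose J) ** transpose ?f ** J)"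
    by (simp only: matrix_mul_assoc)
  also have "trace \<dots> = trace (?q' ** transpose ?f ** (J ** ?J'))"
    unfolding JT by (subst trace_mul_sym) (simp add: matrix_mul_assoc)
  finally show ?thesis unfolding JJ' metric_trace_eq by simp
qed

lemma matrix_inv_2:
  fixes q :: "real ^ 2 ^ 2"
  assumes "det q \<noteq> 0"
  shows "matrix_inv q $ 1 $ 1 = q $ 2 $ 2 / det q" "matrix_inv q $ 2 $ 2 = q $ 1 $ 1 / det q"
    "matrix_inv q $ 1 $ 2 = - q $ 1 $ 2 / det q" "matrix_inv q $ 2 $ 1 = - q $ 2 $ 1 / det q"
  unfolding matrix_inv_nth[OF assms] by (simp_all add: det_2 axis_def)

lemma inner_mv_axis_2: "v \<bullet> (A *v axis j 1) = v $ 1 * A $ 1 $ j + v $ 2 * A $ 2 $ j" for A :: "real ^ 2 ^ 2"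
  by (simp add: matrix_vector_mult_basis column_def inner_vec_def sum_2)

lemma metric_trace_2:
  fixes q :: "real ^ 2 ^ 2"
  assumes "det q \<noteq> 0"
  shows "det q * metric_trace q f = q $ 2 $ 2 * f (axis 1 1) (axis 1 1) + q $ 1 $ 1 * f (axis 2 1) (axis 2 1)
    - q $ 1 $ 2 * f (axis 1 1) (axis 2 1) - q $ 2 $ 1 * f (axis 2 1) (axis 1 1)"
  using assms by (simp add: metric_trace_def sum_2 matrix_inv_2 field_simps)

text \<open>The divergence of \<open>X\<close> with respect to the metric \<open>q\<close> is the \<open>q\<close>-trace of half the Lie derivative of \<open>q\<close>.\<close>
lemma metric_divergence:
  fixes q :: "real ^ 2 \<Rightarrow> real ^ 2 ^ 2"
  assumes W: "open W" "u \<in> W" and sym: "\<And>v. v \<in> W \<Longrightarrow> transpose (q v) = q v"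
    and qd: "q differentiable (at u)" and X: "X differentiable (at u)" and pos: "det (q u) > 0"
  shows "divergence (\<lambda>v. sqrt (det (q v)) *\<^sub>R X v) u = sqrt (det (q u)) *
    metric_trace (q u) (\<lambda>a b. (\<D> X u a \<bullet> (q u *v b) + \<D> X u b \<bullet> (q u *v a) + a \<bullet> (\<D> q u (X u) *v b)) / 2)"
proof -
  let ?q = "q u" and ?P = "\<D> q u (X u)" and ?x = "\<lambda>i. \<D> X u (axis i 1)"
  have qD: "((\<lambda>v. q v $ i $ j) has_derivative (\<lambda>a. \<D> q u a $ i $ j)) (at u)" for i j
    by (rule bounded_linear.has_derivative[OF bounded_linear_nth_nth has_D[OF qd]])
  let ?d' = "\<lambda>a. (?q $ 1 $ 1 * \<D> q u a $ 2 $ 2 + \<D> q u a $ 1 $ 1 * ?q $ 2 $ 2)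
    - (?q $ 1 $ 2 * \<D> q u a $ 2 $ 1 + \<D> q u a $ 1 $ 2 * ?q $ 2 $ 1)"
  have detD: "((\<lambda>v. det (q v)) has_derivative ?d') (at u)"
    unfolding det_2 by (intro has_derivative_diff has_derivative_mult qD)
  have sD: "((\<lambda>v. sqrt (det (q v))) has_derivative (\<lambda>a. ?d' a * (inverse (sqrt (det ?q)) / 2))) (at u)"
    using has_derivative_compose[OF detD DERIV_real_sqrt[OF pos, unfolded has_field_derivative_def]]
    by (simp add: mult.commute)
  have symq: "?q $ 2 $ 1 = ?q $ 1 $ 2"
    using arg_cong[OF sym[OF W(2)], of "\<lambda>A. A $ 1 $ 2"] by (simp add: transpose_def)
  have symP: "?P $ 2 $ 1 = ?P $ 1 $ 2"
    using arg_cong[OF transpose_D[OF W sym qd, of "X u"], of "\<lambda>A. A $ 1 $ 2"] by (simp add: transpose_def)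
  define w where "w = sqrt (det ?q)"
  have w: "w > 0" "w * w = det ?q" using pos by (simp_all add: w_def)
  have div: "divergence (\<lambda>v. sqrt (det (q v)) *\<^sub>R X v) u = w * (?x 1 $ 1 + ?x 2 $ 2) + ?d' (X u) / (2 * w)"
    unfolding divergence_scaleR[OF differentiableI[OF sD] X] D_eq[OF sD]
    by (simp add: divergence_def sum_2 w_def field_simps)
  have ax: "axis (2 :: 2) 1 $ 1 = (0 :: real)" "axis (1 :: 2) 1 $ 2 = (0 :: real)" by (simp_all add: axis_def)
  have tr: "det ?q * metric_trace ?q (\<lambda>a b. (\<D> X u a \<bullet> (?q *v b) + \<D> X u b \<bullet> (?q *v a) + a \<bullet> (?P *v b)) / 2)
      = det ?q * (?x 1 $ 1 + ?x 2 $ 2) + ?d' (X u) / 2"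
    unfolding metric_trace_2[OF less_imp_neq[OF pos, symmetric]]
    unfolding sandwich_nth inner_mv_axis_2 det_2 symq symP by (simp add: ax field_simps)
  have w': "w * (w * s + t / (2 * w)) = det ?q * s + t / 2" for s t
    using w by (simp add: distrib_left mult.assoc[symmetric])
  \<comment> \<open>The two factors w clear the square root, their product being the
    determinant.\<close>
  have "w * (w * metric_trace ?q (\<lambda>a b. (\<D> X u a \<bullet> (?q *v b) + \<D> X u b \<bullet> (?q *v a) + a \<bullet> (?P *v b)) / 2))
      = w * divergence (\<lambda>v. sqrt (det (q v)) *\<^sub>R X v) u"
    unfolding div w' mult.assoc[symmetric] w(2) by (rule tr)
  then show ?thesis using w(1) unfolding w_def by simp
qed

text \<open>\<open>e\<close> is the differential of a parametrisation of the surface at one point;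
  \<open>pos\<close> says at once that it is injective and that its image is spacelike.\<close>

locale null_frame =
  fixes G :: "real ^ 4 ^ 4" and e :: "real ^ 2 \<Rightarrow> real ^ 4" and k k' :: "real ^ 4"
  assumes sym: "transpose G = G" and det: "det G \<noteq> 0" and e: "linear e"
    and pos: "\<And>a. a \<noteq> 0 \<Longrightarrow> e a \<bullet> (G *v e a) > 0"
    and null: "k \<bullet> (G *v k) = 0" "k' \<bullet> (G *v k') = 0" and kk': "k \<bullet> (G *v k') = -1"
    and normal: "\<And>a. k \<bullet> (G *v e a) = 0" "\<And>a. k' \<bullet> (G *v e a) = 0"
begin

lemma comm: "x \<bullet> (G *v y) = y \<bullet> (G *v x)"
  by (rule sym_matrix_inner[OF sym])

definition q :: "real ^ 2 ^ 2" where "q = form_matrix (\<lambda>a b. e a \<bullet> (G *v e b))"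

lemma q_form: "a \<bullet> (q *v b) = e a \<bullet> (G *v e b)"
  unfolding q_def
  by (rule inner_form_matrix; rule linearI)
    (simp_all add: linear_add[OF e] linear_scale[OF e] mv.add_right mv.scaleR_right inner_add_left inner_add_right)

lemma q_sym: "transpose q = q"
  by (simp add: q_def form_matrix_def transpose_def vec_eq_iff) (intro allI comm)

lemma q_pos: "a \<noteq> 0 \<Longrightarrow> a \<bullet> (q *v a) > 0"
  by (simp add: q_form pos)

lemma q_det: "det q > 0"
proof -
  have s: "q $ 2 $ 1 = q $ 1 $ 2" using arg_cong[OF q_sym, of "\<lambda>A. A $ 1 $ 2"] by (simp add: transpose_def)
  have "axis 1 1 \<noteq> (0 :: real ^ 2)" by simp
  from q_pos[OF this] have 1: "q $ 1 $ 1 > 0" by (simp add: sandwich_nth)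
  define a :: "real ^ 2" where "a = vector [- q $ 1 $ 2, q $ 1 $ 1]"
  have "a \<noteq> 0" using 1 by (auto simp: a_def vec_eq_iff forall_2)
  moreover have "a \<bullet> (q *v a) = q $ 1 $ 1 * det q"
    by (simp add: a_def inner_vec_def matrix_vector_mult_def sum_2 det_2 s algebra_simps)
  ultimately show ?thesis using q_pos[of a] 1 by (simp add: zero_less_mult_iff)
qed

text \<open>The tangential projection of x, in parameter coordinates: the covector of products with
  the frame, with its index raised by \<open>q\<close>.\<close>

definition tang :: "real ^ 4 \<Rightarrow> real ^ 2" where
  "tang x = matrix_inv q *v (\<chi> i. x \<bullet> (G *v e (axis i 1)))"

lemma tang: "e a \<bullet> (G *v e (tang x)) = x \<bullet> (G *v e a)"
proof -
  have "e a \<bullet> (G *v e (tang x)) = a \<bullet> (q *v tang x)" by (rule q_form[symmetric])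
  also have "q *v tang x = (\<chi> i. x \<bullet> (G *v e (axis i 1)))"
    unfolding tang_def using matrix_inv(1)[of q] q_det by (simp add: matrix_vector_mul_assoc invertible_det_nz)
  also have "a \<bullet> \<dots> = x \<bullet> (G *v (\<Sum>i\<in>UNIV. a $ i *\<^sub>R e (axis i 1)))"
    by (simp add: mv.sum_right mv.scaleR_right inner_sum_right) (simp add: inner_vec_def)
  also have "(\<Sum>i\<in>UNIV. a $ i *\<^sub>R e (axis i 1)) = e a" by (rule linear_axis_sum[OF e, symmetric])
  finally show ?thesis .
qed

text \<open>Pairing a vanishing combination with k', k and its own tangential part kills all four
  coefficients; injectivity in dimension 4 gives surjectivity.\<close>

lemma spanning: "\<exists>a s t. z = e a + s *\<^sub>R k + t *\<^sub>R k'"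
proof -
  define L where "L y = e (vector [y $ 1, y $ 2]) + y $ 3 *\<^sub>R k + y $ 4 *\<^sub>R k'" for y :: "real ^ 4"
  have v: "vector [a + b, c + d] = vector [a, c] + (vector [b, d] :: real ^ 2)"
    "vector [r * a, r * c] = r *\<^sub>R (vector [a, c] :: real ^ 2)" for a b c d r :: real
    by (simp_all add: vec_eq_iff forall_2)
  have L: "linear L"
    by (rule linearI) (simp_all add: L_def v linear_add[OF e] linear_scale[OF e] algebra_simps)
  have "y = 0" if "L y = 0" for y
  proof -
    let ?a = "vector [y $ 1, y $ 2] :: real ^ 2"
    have "e ?a \<bullet> (G *v L y) = e ?a \<bullet> (G *v e ?a)"
      by (simp add: L_def mv.add_right mv.scaleR_right inner_add_right comm[of "e _" k] comm[of "e _" k'] normal)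
    moreover have "k \<bullet> (G *v L y) = - y $ 4" "k' \<bullet> (G *v L y) = - y $ 3"
      by (simp_all add: L_def mv.add_right mv.scaleR_right inner_add_right normal null kk' comm[of k' k])
    ultimately have "?a = 0" "y $ 4 = 0" "y $ 3 = 0" using that pos[of ?a] by auto
    then show ?thesis by (simp add: vec_eq_iff forall_2 forall_4)
  qed
  then have "inj L" using linear_injective_0[OF L] by blast
  then have "surj L" using linear_inj_imp_surj[OF L] by blast
  then show ?thesis unfolding surj_def L_def by blast
qed

text \<open>Each null component is read off with the other null normal, the sign coming from k . k'
  = -1; the difference of the two sides is orthogonal to a spanning set.\<close>

lemma decomposition: "x = - (x \<bullet> (G *v k')) *\<^sub>R k + - (x \<bullet> (G *v k)) *\<^sub>R k' + e (tang x)" (is "x = ?y")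
proof -
  have "z \<bullet> (G *v (x - ?y)) = 0" for z
  proof -
    obtain a s t where z: "z = e a + s *\<^sub>R k + t *\<^sub>R k'" using spanning by blast
    have "e a \<bullet> (G *v (x - ?y)) = 0" "k \<bullet> (G *v (x - ?y)) = 0" "k' \<bullet> (G *v (x - ?y)) = 0"
      by (simp_all add: mv.add_right mv.diff_right mv.scaleR_right mv.minus_right inner_add_right inner_diff_right
          tang normal null kk' comm[of "e _" k] comm[of "e _" k'] comm[of k' k] comm[of "e _" x] comm[of k x] comm[of k' x])
    then show ?thesis by (simp add: z inner_add_left)
  qed
  from matrix_nondegenerate[OF det this] show ?thesis by simp
qed

text \<open>g(x, x) equals the squared length of the tangential part minus twice the product of the
  two null components.\<close>

lemma causal_decomposition:
  assumes x: "x \<bullet> (G *v x) \<le> 0"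
  shows "e (tang x) \<bullet> (G *v e (tang x)) \<le> 2 * ((x \<bullet> (G *v k')) * (x \<bullet> (G *v k)))"
proof -
  have "x \<bullet> (G *v x) = x \<bullet> (G *v (- (x \<bullet> (G *v k')) *\<^sub>R k + - (x \<bullet> (G *v k)) *\<^sub>R k' + e (tang x)))"
    using decomposition[of x] by simp
  also have "\<dots> = - 2 * ((x \<bullet> (G *v k')) * (x \<bullet> (G *v k))) + x \<bullet> (G *v e (tang x))"
    by (simp add: mv.add_right mv.scaleR_right mv.minus_right mv.diff_right inner_add_right inner_diff_right)
  finally show ?thesis using x tang[of "tang x" x] by simp
qed

lemma tang_nonneg: "0 \<le> e (tang x) \<bullet> (G *v e (tang x))"
  using pos[of "tang x"] linear_0[OF e] by (cases "tang x = 0") auto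

lemma causal_null:
  assumes x: "x \<bullet> (G *v x) \<le> 0" "x \<bullet> (G *v k) = 0"
  shows "x = - (x \<bullet> (G *v k')) *\<^sub>R k"
proof -
  have "tang x = 0" using causal_decomposition[OF x(1)] pos[of "tang x"] x(2) by force
  then show ?thesis using decomposition[of x] x(2) linear_0[OF e] by simp
qed

text \<open>By \<open>causal_decomposition\<close> the products with k and k' cannot have opposite
  signs, so a vanishing sum forces both of them, and then x, to vanish.\<close>

lemma causal_nonzero:
  assumes x: "x \<bullet> (G *v x) \<le> 0" "x \<noteq> 0"
  shows "x \<bullet> (G *v k) + x \<bullet> (G *v k') \<noteq> 0"
proof
  assume "x \<bullet> (G *v k) + x \<bullet> (G *v k') = 0"
  then have s: "x \<bullet> (G *v k') = - (x \<bullet> (G *v k))" by simp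
  have "0 \<le> - ((x \<bullet> (G *v k)) * (x \<bullet> (G *v k)))"
    using causal_decomposition[OF x(1)] tang_nonneg[of x] unfolding s by simp
  then have "(x \<bullet> (G *v k))\<^sup>2 \<le> 0" by (simp add: power2_eq_square)
  then have "x \<bullet> (G *v k) = 0" by simp
  then show False using causal_null[OF x(1)] s x(2) by simp
qed

text \<open>The product with k is thus zero or of the sign of the sum; the sum itself is nonzero for
  every nonzero causal x.\<close>

lemma causal_sign:
  assumes x: "x \<bullet> (G *v x) \<le> 0"
  shows "0 \<le> (x \<bullet> (G *v k)) * (x \<bullet> (G *v k) + x \<bullet> (G *v k'))"
  using causal_decomposition[OF x] tang_nonneg[of x] zero_le_square[of "x \<bullet> (G *v k)"]
  by (simp add: algebra_simps)

text \<open>k and the tangent vectors span the orthogonal complement of the null vector k, so B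
  vanishes on a hyperplane whose normal covector also annihilates its range.\<close>

lemma ltrace_nilpotent:
  assumes B: "linear B" "B k = 0" "\<And>a. B (e a) = 0" and range: "\<And>x. k \<bullet> (G *v B x) = 0"
  shows "ltrace B = 0"
proof (rule ltrace_eq_0[OF B(1)])
  show "G *v k \<noteq> 0" using kk' comm[of k k'] by auto
  show "(G *v k) \<bullet> B x = 0" for x using range[of x] comm[of k "B x"] by (simp add: inner_commute)
  show "B x = 0" if "x \<bullet> (G *v k) = 0" for x
    by (subst decomposition) (simp add: that linear_add[OF B(1)] linear_scale[OF B(1)] B(2,3) linear_diff[OF B(1)] linear_neg[OF B(1)])
qed

end

text \<open>A left inverse L of the derivative of F2 makes h = L o F2 a map whose derivative at
  \<tau> u is the identity, while h o \<tau> = L o F1 is differentiable. Continuity of \<tau> lets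
  its increments be replaced by those of h o \<tau> up to a small relative error.\<close>

lemma immersion_lift:
  fixes F2 :: "real ^ 'm \<Rightarrow> real ^ 'n" and \<tau> :: "'a::euclidean_space \<Rightarrow> real ^ 'm"
  assumes W: "open W" "u \<in> W" and eq: "\<And>x. x \<in> W \<Longrightarrow> F2 (\<tau> x) = F1 x"
    and F1: "F1 differentiable (at u)" and F2: "F2 differentiable (at (\<tau> u))"
    and inj: "inj (\<D> F2 (\<tau> u))" and cont: "isCont \<tau> u"
  shows "\<tau> differentiable (at u)"
proof -
  obtain L where L: "linear L" "L \<circ> \<D> F2 (\<tau> u) = id"
    using linear_injective_left_inverse[OF linear_D[OF F2] inj] by blast
  have bl: "bounded_linear L" using L(1) by (simp add: linear_conv_bounded_linear)
  define h where "h y = L (F2 y)" for y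
  define f where "f x = L (F1 x)" for x
  have hD: "(h has_derivative (\<lambda>v. v)) (at (\<tau> u))"
    using bounded_linear.has_derivative[OF bl has_D[OF F2]] L(2) unfolding h_def
    by (simp add: o_def fun_eq_iff)
  obtain f' where fD: "(f has_derivative f') (at u)"
    using bounded_linear.has_derivative[OF bl has_D[OF F1]] unfolding f_def by blast
  interpret f': bounded_linear f' using fD by (rule has_derivative_bounded_linear)
  have hf: "h (\<tau> x) = f x" if "x \<in> W" for x using eq[OF that] by (simp add: h_def f_def)
  obtain C where C: "C > 0" "\<And>v. norm (f' v) \<le> norm v * C" using f'.pos_bounded by blast
  have rem: "\<exists>d>0. \<forall>x. norm (x - u) < d \<longrightarrow> x \<in> W \<and> norm ((\<tau> x - \<tau> u) - (f x - f u)) \<le> \<epsilon> * norm (\<tau> x - \<tau> u)" if "\<epsilon> > 0" for \<epsilon>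
  proof -
    have "\<exists>d>0. \<forall>y. norm (y - \<tau> u) < d \<longrightarrow> norm (h y - h (\<tau> u) - (y - \<tau> u)) \<le> \<epsilon> * norm (y - \<tau> u)"
      using hD that unfolding has_derivative_at_alt by simp
    then obtain d1 where d1: "d1 > 0" "\<And>y. norm (y - \<tau> u) < d1 \<Longrightarrow> norm (h y - h (\<tau> u) - (y - \<tau> u)) \<le> \<epsilon> * norm (y - \<tau> u)"
      by auto
    obtain d2 where d2: "d2 > 0" "\<And>x. dist x u < d2 \<Longrightarrow> dist (\<tau> x) (\<tau> u) < d1"
      using cont d1(1) unfolding continuous_at_eps_delta by blast
    obtain d3 where d3: "d3 > 0" "ball u d3 \<subseteq> W" using W open_contains_ball by blast
    show ?thesis
    proof (intro exI[of _ "min d2 d3"] conjI allI impI)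
      fix x assume x: "norm (x - u) < min d2 d3"
      then show xW: "x \<in> W" using d3 by (auto simp: dist_norm norm_minus_commute)
      have "norm (h (\<tau> x) - h (\<tau> u) - (\<tau> x - \<tau> u)) \<le> \<epsilon> * norm (\<tau> x - \<tau> u)"
        by (rule d1(2)) (use d2(2)[of x] x in \<open>simp add: dist_norm\<close>)
      then show "norm ((\<tau> x - \<tau> u) - (f x - f u)) \<le> \<epsilon> * norm (\<tau> x - \<tau> u)"
        unfolding hf[OF xW] hf[OF W(2)] by (subst norm_minus_commute)
    qed (use d2 d3 in auto)
  qed
  have "(\<tau> has_derivative f') (at u)"
    unfolding has_derivative_at_alt
  proof (intro conjI allI impI)
    show "bounded_linear f'" by (rule f'.bounded_linear)
    fix \<epsilon> :: real assume \<epsilon>: "\<epsilon> > 0"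
    \<comment> \<open>The 1/2 lets the error be absorbed, giving |\<Delta>\<tau>| \<le> 2
      |\<Delta>f|; since |\<Delta>f| \<le> (C + 1) |\<Delta>x|, the second entry makes the error at
      most half of \<epsilon> |\<Delta>x|.\<close>
    define \<delta> where "\<delta> = min (1/2) (\<epsilon> / (4 * (C + 1)))"
    have "\<delta> \<le> \<epsilon> / (4 * (C + 1))" by (simp add: \<delta>_def)
    then have "\<delta> * (4 * (C + 1)) \<le> \<epsilon>" using C(1) by (simp add: pos_le_divide_eq)
    moreover have "\<delta> > 0" using \<epsilon> C(1) by (simp add: \<delta>_def)
    moreover have "\<delta> \<le> 1/2" unfolding \<delta>_def by (rule min.cobounded1)
    ultimately have \<delta>: "\<delta> > 0" "\<delta> \<le> 1/2" "\<delta> * (4 * (C + 1)) \<le> \<epsilon>" by auto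
    obtain d1 where d1: "d1 > 0" "\<And>x. norm (x - u) < d1 \<Longrightarrow> norm ((\<tau> x - \<tau> u) - (f x - f u)) \<le> \<delta> * norm (\<tau> x - \<tau> u)"
      using rem[OF \<delta>(1)] by blast
    have "min 1 (\<epsilon> / 2) > 0" using \<epsilon> by simp
    then obtain d2 where d2: "d2 > 0" "\<And>x. norm (x - u) < d2 \<Longrightarrow> norm (f x - f u - f' (x - u)) \<le> min 1 (\<epsilon> / 2) * norm (x - u)"
      using fD unfolding has_derivative_at_alt by meson
    show "\<exists>d>0. \<forall>y. norm (y - u) < d \<longrightarrow> norm (\<tau> y - \<tau> u - f' (y - u)) \<le> \<epsilon> * norm (y - u)"
    proof (intro exI[of _ "min d1 d2"] conjI allI impI)
      fix x assume x: "norm (x - u) < min d1 d2"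
      let ?t = "norm (\<tau> x - \<tau> u)" and ?f = "norm (f x - f u)" and ?n = "norm (x - u)"
      have a: "norm ((\<tau> x - \<tau> u) - (f x - f u)) \<le> \<delta> * ?t" using d1(2)[of x] x by simp
      have b: "norm (f x - f u - f' (x - u)) \<le> min 1 (\<epsilon> / 2) * ?n" using d2(2)[of x] x by simp
      have "?f \<le> norm (f x - f u - f' (x - u)) + norm (f' (x - u))"
        using norm_triangle_ineq[of "f x - f u - f' (x - u)" "f' (x - u)"] by simp
      moreover have "min 1 (\<epsilon> / 2) * ?n \<le> 1 * ?n" by (intro mult_right_mono) auto
      ultimately have f: "?f \<le> (C + 1) * ?n" using b C(2)[of "x - u"] by (simp add: algebra_simps)
      have "?t \<le> norm ((\<tau> x - \<tau> u) - (f x - f u)) + ?f"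
        using norm_triangle_ineq[of "(\<tau> x - \<tau> u) - (f x - f u)" "f x - f u"] by simp
      moreover have "\<delta> * ?t \<le> 1/2 * ?t" using \<delta> by (intro mult_right_mono) auto
      ultimately have t: "?t \<le> 2 * ?f" using a by simp
      have "\<delta> * ?t \<le> \<delta> * (2 * ((C + 1) * ?n))" using t f \<delta>(1) by (intro mult_left_mono) auto
      also have "\<dots> = \<delta> * (4 * (C + 1)) * ?n / 2" by (simp add: algebra_simps)
      also have "\<dots> \<le> \<epsilon> * ?n / 2" using \<delta>(3) by (intro divide_right_mono mult_right_mono) auto
      finally have c: "\<delta> * ?t \<le> \<epsilon> * ?n / 2" .
      have "\<tau> x - \<tau> u - f' (x - u) = ((\<tau> x - \<tau> u) - (f x - f u)) + (f x - f u - f' (x - u))" by simp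
      then have "norm (\<tau> x - \<tau> u - f' (x - u)) \<le> norm ((\<tau> x - \<tau> u) - (f x - f u)) + norm (f x - f u - f' (x - u))"
        using norm_triangle_ineq by metis
      moreover have "min 1 (\<epsilon> / 2) * ?n \<le> (\<epsilon> / 2) * ?n" by (intro mult_right_mono) auto
      ultimately show "norm (\<tau> x - \<tau> u - f' (x - u)) \<le> \<epsilon> * ?n" using a b c by simp
    qed (use d1 d2 in auto)
  qed
  then show ?thesis by (rule differentiableI)
qed

section \<open>Killing fields that are null on a surface\<close>

context killing_chart
begin

definition norm2 :: "real ^ 'n \<Rightarrow> real" where
  "norm2 x = \<Xi> x \<bullet> (G x *v \<Xi> x)"

lemma D_norm2:
  assumes x: "x \<in> U"
  shows "\<D> norm2 x b = 2 * (\<Xi> x \<bullet> (G x *v \<D> \<Xi> x b)) + \<Xi> x \<bullet> (\<D> G x b *v \<Xi> x)"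
  unfolding norm2_def[abs_def] D_form[OF \<Xi>d[OF x] Gd[OF x] \<Xi>d[OF x]]
  using G_commute[OF x, of "\<Xi> x" "\<D> \<Xi> x b"] by simp

lemma norm2_C1: "C1_on norm2 U"
  unfolding norm2_def[abs_def] by (intro C1_inner C1_mv smooth_on_C1 G \<Xi>)

lemma D_norm2_C1: "C1_on (\<lambda>x. \<D> norm2 x b) U"
  by (rule C1_cong[OF U, of "\<lambda>x. 2 * (\<Xi> x \<bullet> (G x *v \<D> \<Xi> x b)) + \<Xi> x \<bullet> (\<D> G x b *v \<Xi> x)"])
    (simp_all add: D_norm2 C1_add C1_mult C1_inner C1_mv smooth_on_C1[OF G] smooth_on_C1[OF \<Xi>]
      smooth_on_C1_D[OF G] smooth_on_C1_D[OF \<Xi>])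

lemma inner_Y:
  assumes x: "x \<in> U"
  shows "b \<bullet> (G x *v Y x) = - \<D> norm2 x b / 2"
  unfolding Y_def inner_M[OF x] D_norm2[OF x]
  using lie[OF x, of "\<Xi> x" b] G_commute[OF x, of "\<Xi> x" "\<D> \<Xi> x b"] by (simp add: field_simps)

text \<open>Lowered by the metric, Y is minus half a gradient, and where Y vanishes its lowered
  derivative is a multiple of a Hessian, hence symmetric. The second identity differentiates \<Xi> .
  Y = 0, which is antisymmetry of \<open>M\<close>.\<close>

lemma inner_DY:
  assumes x: "x \<in> U" and Y0: "Y x = 0"
  shows "z \<bullet> (G x *v \<D> Y x a) = a \<bullet> (G x *v \<D> Y x z)" "\<Xi> x \<bullet> (G x *v \<D> Y x a) = 0"
proof -
  have Yd: "Y differentiable (at x)" using Y_has_derivative[OF x] by (rule differentiableI)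
  have *: "z \<bullet> (G x *v \<D> Y x a) = - \<D> (\<lambda>y. \<D> norm2 y z) x a / 2" for z a
  proof -
    have cd: "(\<lambda>y. z) differentiable (at x)" by simp
    have "\<D> (\<lambda>y. z \<bullet> (G y *v Y y)) x = \<D> (\<lambda>y. - \<D> norm2 y z / 2) x"
      by (rule D_cong[OF U x inner_Y], assumption) (intro differentiable_inner differentiable_mv cd Gd x Yd)
    moreover have "\<D> (\<lambda>y. z \<bullet> (G y *v Y y)) x a = z \<bullet> (G x *v \<D> Y x a)"
      using D_form[OF cd Gd[OF x] Yd, of a] Y0 by simp
    moreover have "\<D> (\<lambda>y. - \<D> norm2 y z / 2) x a = - \<D> (\<lambda>y. \<D> norm2 y z) x a / 2"
    proof (rule D_linear[where l = "\<lambda>r. - r / 2"])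
      show "bounded_linear (\<lambda>r :: real. - r / 2)"
        using bounded_linear_minus[OF bounded_linear_divide[of 2]] by simp
    qed (rule C1_differentiable[OF D_norm2_C1 x])
    ultimately show ?thesis by simp
  qed
  show "z \<bullet> (G x *v \<D> Y x a) = a \<bullet> (G x *v \<D> Y x z)"
    unfolding * using symmetric_second_derivative_C1[OF U x norm2_C1 D_norm2_C1] by simp
  have "\<D> (\<lambda>y. \<Xi> y \<bullet> (G y *v Y y)) x = \<D> (\<lambda>y. 0 :: real) x"
    by (rule D_cong[OF U x]) (auto simp: Y_def M_self intro!: differentiable_inner differentiable_mv Gd \<Xi>d x Yd[unfolded Y_def[abs_def]])
  then show "\<Xi> x \<bullet> (G x *v \<D> Y x a) = 0"
    using D_form[OF \<Xi>d[OF x] Gd[OF x] Yd, of a] Y0 by simp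
qed

end

text \<open>\<open>ricci_killing\<close> leaves two traces, and \<open>ltrace_nilpotent\<close>
  applies to both: \<open>\<D> Y\<close> kills tangent vectors because Y vanishes along the surface,
  and the square of \<open>M\<close> kills them because \<open>M\<close> sends them to multiples of
  k, which \<open>M\<close> kills.\<close>

lemma ricci_zero_on_null_surface:
  fixes G :: "real ^ 4 \<Rightarrow> real ^ 4 ^ 4" and F :: "real ^ 2 \<Rightarrow> real ^ 4"
  assumes kc: "killing_chart G \<Xi> U" and W: "open W" "u \<in> W" and F: "smooth_on F W" "\<And>v. v \<in> W \<Longrightarrow> F v \<in> U"
    and causal: "\<And>x. x \<in> U \<Longrightarrow> \<Xi> x \<bullet> (G x *v \<Xi> x) \<le> 0"
    and null: "\<And>v. v \<in> W \<Longrightarrow> \<Xi> (F v) \<bullet> (G (F v) *v \<Xi> (F v)) = 0"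
    and normal: "\<And>v b. v \<in> W \<Longrightarrow> \<Xi> (F v) \<bullet> (G (F v) *v \<D> F v b) = 0"
    and frame: "null_frame (G (F u)) (\<D> F u) k k'"
    and k: "\<Xi> (F u) = \<alpha> *\<^sub>R k" "\<alpha> \<noteq> 0"
  shows "ltrace (\<lambda>b. riem G (F u) (\<Xi> (F u)) b (\<Xi> (F u))) = 0"
proof -
  interpret killing_chart G \<Xi> U by (rule kc)
  interpret nf: null_frame "G (F u)" "\<D> F u" k k' by (rule frame)
  let ?x = "F u" and ?\<xi> = "\<Xi> (F u)"
  have x: "?x \<in> U" using F(2)[OF W(2)] .
  note Fd = smooth_differentiable[OF F(1)]
  \<comment> \<open>\<open>norm2\<close> is at most 0 on U and equal to 0 on the surface, so the
    surface consists of maxima in an open set and the gradient vanishes there.\<close>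
  have Y0: "Y (F v) = 0" if v: "v \<in> W" for v
  proof (rule G_nondegenerate[OF F(2)[OF v]])
    fix z
    have "\<D> norm2 (F v) = (\<lambda>v. 0)"
      using differential_zero_maxmin[OF F(2)[OF v] U C1_has_D[OF norm2_C1 F(2)[OF v]]] causal null[OF v]
      by (simp add: norm2_def)
    then show "z \<bullet> (G (F v) *v Y (F v)) = 0" by (simp add: inner_Y[OF F(2)[OF v]])
  qed
  have Yx: "Y ?x = 0" by (rule Y0[OF W(2)])
  have Yd: "Y differentiable (at ?x)" using Y_has_derivative[OF x] by (rule differentiableI)
  have DYl: "linear (\<D> Y ?x)" by (rule linear_D[OF Yd])
  have Ml: "linear (M ?x)" by (rule M_linear[OF x])
  have kz: "f k = 0" if "linear f" "f ?\<xi> = 0" for f :: "real ^ 4 \<Rightarrow> real ^ 4"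
    using that k by (simp add: linear_scale)
  have DYe: "\<D> Y ?x (\<D> F u a) = 0" for a
  proof -
    have "\<D> (\<lambda>v. Y (F v)) u = \<D> (\<lambda>v. 0 :: real ^ 4) u"
      by (rule D_cong[OF W Y0 differentiable_compose_at[OF Fd[OF W(2)] Yd]])
    then show ?thesis using D_compose[OF Yd Fd[OF W(2)], of a] by simp
  qed
  have DYk: "\<D> Y ?x k = 0"
  proof (rule kz[OF DYl], rule G_nondegenerate[OF x])
    show "z \<bullet> (G ?x *v \<D> Y ?x ?\<xi>) = 0" for z
      using inner_DY(1)[OF x Yx, of z ?\<xi>] inner_DY(2)[OF x Yx, of z] by simp
  qed
  have "k \<bullet> (G ?x *v \<D> Y ?x a) = 0" for a
    using inner_DY(2)[OF x Yx, of a] k by simp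
  from nf.ltrace_nilpotent[OF DYl DYk DYe this] have tr1: "ltrace (\<D> Y ?x) = 0" .
  have Mk: "M ?x k = 0" by (rule kz[OF Ml]) (use Yx in \<open>simp add: Y_def\<close>)
  have kM: "k \<bullet> (G ?x *v M ?x a) = 0" for a
    using M_antisym[OF x, of k a] Mk by simp
  \<comment> \<open>The normality of \<Xi> is differentiated along the surface and antisymmetrised:
    the second derivatives of F drop out, so \<Xi> has no twist on tangent vectors.\<close>
  have eMe: "\<D> F u b \<bullet> (G ?x *v M ?x (\<D> F u a)) = 0" for a b
  proof -
    note Fd2 = smooth_differentiable_D[OF F(1) W(2)]
    have GF: "(\<lambda>u. G (F u)) differentiable (at u)" by (rule differentiable_compose_at[OF Fd[OF W(2)] Gd[OF x]])
    have \<Xi>F: "(\<lambda>u. \<Xi> (F u)) differentiable (at u)" by (rule differentiable_compose_at[OF Fd[OF W(2)] \<Xi>d[OF x]])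
    have *: "\<D> \<Xi> ?x (\<D> F u a) \<bullet> (G ?x *v \<D> F u b) + ?\<xi> \<bullet> (\<D> G ?x (\<D> F u a) *v \<D> F u b)
        + ?\<xi> \<bullet> (G ?x *v \<D> (\<lambda>u. \<D> F u b) u a) = 0" for a b
    proof -
      have "\<D> (\<lambda>v. \<Xi> (F v) \<bullet> (G (F v) *v \<D> F v b)) u = \<D> (\<lambda>v. 0 :: real) u"
        by (rule D_cong[OF W normal], assumption) (intro differentiable_inner differentiable_mv \<Xi>F GF Fd2)
      then show ?thesis
        using D_form[OF \<Xi>F GF Fd2, of b a] D_compose[OF \<Xi>d[OF x] Fd[OF W(2)], of a]
          D_compose[OF Gd[OF x] Fd[OF W(2)], of a] by simp
    qed
    show ?thesis
      unfolding inner_M[OF x] using *[of a b] *[of b a] symmetric_second_derivative[OF W F(1), of a b]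
      by (simp add: algebra_simps)
  qed
  have MMe: "M ?x (M ?x (\<D> F u a)) = 0" for a
  proof -
    let ?y = "M ?x (\<D> F u a)"
    have 1: "?y \<bullet> (G ?x *v \<D> F u b) = 0" for b using eMe[of b a] nf.comm[of ?y] by simp
    have 2: "?y \<bullet> (G ?x *v k) = 0" using kM[of "\<D> F u a"] nf.comm[of ?y] by simp
    have "nf.tang ?y = 0" unfolding nf.tang_def 1 by (simp add: zero_vec_def[symmetric])
    then have "?y = - (?y \<bullet> (G ?x *v k')) *\<^sub>R k"
      using nf.decomposition[of ?y] 2 linear_0[OF linear_D[OF Fd[OF W(2)]]] by simp
    then have "M ?x ?y = M ?x (- (?y \<bullet> (G ?x *v k')) *\<^sub>R k)" by (rule arg_cong)
    then show ?thesis unfolding linear_scale[OF Ml] Mk by simp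
  qed
  have "ltrace (\<lambda>b. M ?x (M ?x b)) = 0"
  proof (rule nf.ltrace_nilpotent)
    show "linear (\<lambda>b. M ?x (M ?x b))" by (rule linear_compose[OF Ml Ml, unfolded o_def])
  qed (use Mk MMe kM linear_0[OF Ml] in auto)
  then show ?thesis using ricci_killing[OF x Yx] tr1 by simp
qed

section \<open>Invariance of the expansion\<close>

lemma strain_linear:
  fixes F K :: "real ^ 'm \<Rightarrow> real ^ 'n"
  assumes "F differentiable (at u)" "K differentiable (at u)"
  shows "linear (strain G F K u a)" "linear (\<lambda>a. strain G F K u a b)"
  unfolding strain_def
  by (rule linearI; simp add: D_lin_add[OF assms(1)] D_lin_add[OF assms(2)] D_lin_scale[OF assms(1)]
      D_lin_scale[OF assms(2)] mv.add_right mv.scaleR_right inner_add_left inner_add_right field_simps)+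

locale null_normal_surface = spacetime_charts A g T
  for A :: "('p::{t2_space,second_countable_topology}, 4) chart set"
    and g :: "('p, 4) bilinear_field" and T :: "('p, 4) vector_field" +
  fixes S :: "'p set" and k k' :: "('p, 4) vector_field"
  assumes S: "closed_spacelike_surface A g S" and nn: "null_normals A g T S k k'"
begin

definition pdom :: "('p, 4) chart \<Rightarrow> (real ^ 2 \<Rightarrow> 'p) \<Rightarrow> (real ^ 2) set \<Rightarrow> (real ^ 2) set" where
  "pdom c \<psi> W = {u \<in> W. \<psi> u \<in> chart_dom c}"

abbreviation FF where "FF c \<psi> \<equiv> \<lambda>u. coords c (\<psi> u)"

lemma param_continuous: "local_param A S W \<psi> \<Longrightarrow> continuous_on W \<psi>"
  by (auto simp: local_param_def homeomorphism_def)

lemma param_open: "local_param A S W \<psi> \<Longrightarrow> open W"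
  by (auto simp: local_param_def)

lemma param_inj: "local_param A S W \<psi> \<Longrightarrow> inj_on \<psi> W"
  by (auto simp: local_param_def homeomorphism_def intro: inj_on_inverseI)

lemma param_in: "local_param A S W \<psi> \<Longrightarrow> u \<in> W \<Longrightarrow> \<psi> u \<in> S"
  unfolding local_param_def using openin_imp_subset by blast

lemma pdom_open:
  assumes "c \<in> A" "local_param A S W \<psi>" shows "open (pdom c \<psi> W)"
  using continuous_open_preimage[OF param_continuous[OF assms(2)] param_open[OF assms(2)] chart_open[OF assms(1)]]
  by (simp add: pdom_def vimage_def Int_def)

lemma FF_smooth:
  assumes "c \<in> A" "local_param A S W \<psi>" shows "smooth_on (FF c \<psi>) (pdom c \<psi> W)"
  using assms unfolding local_param_def pdom_def o_def by blast

lemma FF_inj: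
  assumes "c \<in> A" "local_param A S W \<psi>" "u \<in> pdom c \<psi> W" shows "inj (\<D> (FF c \<psi>) u)"
  using assms unfolding local_param_def pdom_def o_def by blast

lemma FF_differentiable:
  "c \<in> A \<Longrightarrow> local_param A S W \<psi> \<Longrightarrow> u \<in> pdom c \<psi> W \<Longrightarrow> FF c \<psi> differentiable (at u)"
  using smooth_differentiable[OF FF_smooth] by blast

lemma k_smooth:
  assumes "\<kappa> = k \<or> \<kappa> = k'" "c \<in> A" "local_param A S W \<psi>"
  shows "smooth_on (\<lambda>u. \<kappa> c (\<psi> u)) (pdom c \<psi> W)"
  using assms nn unfolding null_normals_def smooth_vector_field_along_def pdom_def o_def by blast

lemma k_vector: "\<kappa> = k \<or> \<kappa> = k' \<Longrightarrow> vector_on A S \<kappa>"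
  using nn by (auto simp: null_normals_def smooth_vector_field_along_def)

lemma chart_of:
  assumes "c \<in> A" "local_param A S W \<psi>" "u \<in> pdom c \<psi> W"
  shows "u \<in> W" "\<psi> u \<in> chart_dom c" "\<psi> u \<in> S" "chart_inv c (coords c (\<psi> u)) = \<psi> u"
  using assms param_in chart_inv_coords by (auto simp: pdom_def)

lemma frame_at:
  assumes "c \<in> A" "local_param A S W \<psi>" "u \<in> pdom c \<psi> W"
  shows "null_frame (g c (\<psi> u)) (\<D> (FF c \<psi>) u) (k c (\<psi> u)) (k' c (\<psi> u))"
proof (rule null_frame.intro)
  note co = chart_of[OF assms]
  let ?e = "\<D> (FF c \<psi>) u"
  show e: "linear ?e" by (rule linear_D[OF FF_differentiable[OF assms]])
  have tan: "?e v \<in> tangent_space TYPE(2) A S c (\<psi> u)" for v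
    unfolding tangent_space_def o_def using assms(2) co(1) by blast
  show "0 < ?e a \<bullet> (g c (\<psi> u) *v ?e a)" if "a \<noteq> 0" for a
  proof -
    have "?e a \<noteq> ?e 0" using that injD[OF FF_inj[OF assms], of a 0] by blast
    then have "?e a \<noteq> 0" unfolding linear_0[OF e] .
    then show ?thesis
      using S tan[of a] assms(1) co unfolding closed_spacelike_surface_def g_prod_def by blast
  qed
  have n: "future_null g T c (\<psi> u) (k c (\<psi> u))" "future_null g T c (\<psi> u) (k' c (\<psi> u))"
    "g_prod g c (\<psi> u) (k c (\<psi> u)) (k' c (\<psi> u)) = -1"
    "\<forall>v \<in> tangent_space TYPE(2) A S c (\<psi> u). g_prod g c (\<psi> u) (k c (\<psi> u)) v = 0 \<and> g_prod g c (\<psi> u) (k' c (\<psi> u)) v = 0"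
    using nn assms(1) co unfolding null_normals_def by blast+
  then show "k c (\<psi> u) \<bullet> (g c (\<psi> u) *v k c (\<psi> u)) = 0" "k' c (\<psi> u) \<bullet> (g c (\<psi> u) *v k' c (\<psi> u)) = 0"
    "k c (\<psi> u) \<bullet> (g c (\<psi> u) *v k' c (\<psi> u)) = - 1"
    by (simp_all add: future_null_def g_prod_def)
  show "k c (\<psi> u) \<bullet> (g c (\<psi> u) *v ?e a) = 0" "k' c (\<psi> u) \<bullet> (g c (\<psi> u) *v ?e a) = 0" for a
    using n(4) tan[of a] by (auto simp: g_prod_def)
qed (use g_sym[OF assms(1)] g_det[OF assms(1)] chart_of[OF assms] in auto)

lemma induced_metric_eq:
  "induced_metric g c \<psi> u = form_matrix (\<lambda>a b. \<D> (FF c \<psi>) u a \<bullet> (g c (\<psi> u) *v \<D> (FF c \<psi>) u b))"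
  by (simp add: induced_metric_def form_matrix_def g_prod_def frame_def o_def)

context
  fixes c W \<psi> u
  assumes P: "c \<in> A" "local_param A S W \<psi>" and u: "u \<in> pdom c \<psi> W"
begin

interpretation nf: null_frame "g c (\<psi> u)" "\<D> (FF c \<psi>) u" "k c (\<psi> u)" "k' c (\<psi> u)"
  by (rule frame_at[OF P u])

lemma metric_q: "induced_metric g c \<psi> u = nf.q"
  by (simp add: induced_metric_eq nf.q_def)

lemma metric_form: "a \<bullet> (induced_metric g c \<psi> u *v b) = \<D> (FF c \<psi>) u a \<bullet> (g c (\<psi> u) *v \<D> (FF c \<psi>) u b)"
  unfolding metric_q by (rule nf.q_form)

lemma metric_sym: "transpose (induced_metric g c \<psi> u) = induced_metric g c \<psi> u"
  unfolding metric_q by (rule nf.q_sym)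

lemma metric_det: "det (induced_metric g c \<psi> u) > 0"
  unfolding metric_q by (rule nf.q_det)

lemma metric_inv_sym: "matrix_inv (induced_metric g c \<psi> u) $ i $ j = matrix_inv (induced_metric g c \<psi> u) $ j $ i"
  using arg_cong[OF transpose_matrix_inv[OF metric_sym less_imp_neq[OF metric_det, symmetric]], of "\<lambda>A. A $ j $ i"]
  by (simp add: transpose_def)

text \<open>On symmetrising, the Christoffel terms that differentiate the metric along the surface
  cancel, and the one that differentiates it along \<kappa> remains.\<close>

lemma second_form_strain:
  assumes \<kappa>: "\<kappa> = k \<or> \<kappa> = k'"
  shows "(second_form g c \<psi> \<kappa> u $ i $ j + second_form g c \<psi> \<kappa> u $ j $ i) / 2 =
    strain (Gc c) (FF c \<psi>) (\<lambda>u. \<kappa> c (\<psi> u)) u (axis i 1) (axis j 1)"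
proof -
  note co = chart_of[OF P u]
  let ?x = "coords c (\<psi> u)" and ?K = "\<kappa> c (\<psi> u)" and ?e = "\<lambda>i. \<D> (FF c \<psi>) u (axis i 1)"
  let ?DK = "\<lambda>i. \<D> (\<lambda>u. \<kappa> c (\<psi> u)) u (axis i 1)"
  have gaml: "gam (Gc c) ?x v w $ a = (\<Sum>b\<in>UNIV. \<Sum>d\<in>UNIV. christoffel g c (\<psi> u) a b d * v $ b * w $ d)" for v w a
  proof -
    note l = Gc_gam_linear[OF P(1) co(2)]
    have "gam (Gc c) ?x (axis b 1) w $ a = (\<Sum>d\<in>UNIV. christoffel g c (\<psi> u) a b d * w $ d)" for b
      using linear_axis_sum[OF l(1), of "axis b 1" w] by (simp add: christoffel_gam[OF P(1) co(2)] mult.commute)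
    then show ?thesis
      using linear_axis_sum[OF l(2), of v w] by (simp add: sum_distrib_left mult_ac)
  qed
  have sf: "second_form g c \<psi> \<kappa> u $ i $ j = ?DK i \<bullet> (g c (\<psi> u) *v ?e j) + ?e j \<bullet> (g c (\<psi> u) *v gam (Gc c) ?x (?e i) ?K)" for i j
  proof -
    have "nabla_along g c \<psi> \<kappa> u i = ?DK i + gam (Gc c) ?x (?e i) ?K"
      by (simp add: nabla_along_def frame_def o_def vec_eq_iff gaml)
    then show ?thesis
      using nf.comm[of "gam (Gc c) ?x (?e i) ?K" "?e j"]
      by (simp add: second_form_def g_prod_def frame_def o_def inner_add_left)
  qed
  have gd: "Gc c differentiable (at ?x)" by (rule Gc_diff[OF P(1) co(2)])
  have ig: "z \<bullet> (g c (\<psi> u) *v gam (Gc c) ?x a b) =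
    (b \<bullet> (\<D> (Gc c) ?x a *v z) + a \<bullet> (\<D> (Gc c) ?x b *v z) - a \<bullet> (\<D> (Gc c) ?x z *v b)) / 2" for z a b
    using inner_gam[OF gd] nf.sym nf.det co(4) by simp
  have DGs: "v \<bullet> (\<D> (Gc c) ?x a *v w) = w \<bullet> (\<D> (Gc c) ?x a *v v)" for v w a
  proof (rule sym_matrix_inner[OF transpose_D[OF _ _ _ gd]])
    show "open (coords c ` chart_dom c)" using open_coords_image[OF P(1), of UNIV] by simp
    show "transpose (Gc c y) = Gc c y" if "y \<in> coords c ` chart_dom c" for y
      using that g_sym[OF P(1)] chart_inv_coords[OF P(1)] by auto
  qed (use co in auto)
  show ?thesis
    unfolding sf ig strain_def co(4)
    using DGs[of "?e i" ?K "?e j"] DGs[of ?K "?e i" "?e j"] DGs[of ?K "?e j" "?e i"]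
    by (simp add: field_simps)
qed

text \<open>The symmetric inverse metric sees only the symmetric part of the second form.\<close>

lemma expansion_strain:
  assumes \<kappa>: "\<kappa> = k \<or> \<kappa> = k'"
  shows "expansion g c \<psi> \<kappa> u =
    metric_trace (induced_metric g c \<psi> u) (strain (Gc c) (FF c \<psi>) (\<lambda>u. \<kappa> c (\<psi> u)) u)"
proof -
  let ?m = "matrix_inv (induced_metric g c \<psi> u)" and ?s = "second_form g c \<psi> \<kappa> u"
  have "(\<Sum>i\<in>UNIV. \<Sum>j\<in>UNIV. ?m $ i $ j * ?s $ j $ i) = (\<Sum>j\<in>UNIV. \<Sum>i\<in>UNIV. ?m $ i $ j * ?s $ j $ i)"
    by (rule sum.swap)
  also have "\<dots> = expansion g c \<psi> \<kappa> u"
    unfolding expansion_def by (intro sum.cong refl) (metis metric_inv_sym)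
  finally have "(\<Sum>i\<in>UNIV. \<Sum>j\<in>UNIV. ?m $ i $ j * ((?s $ i $ j + ?s $ j $ i) / 2)) = expansion g c \<psi> \<kappa> u"
    by (simp add: distrib_left add_divide_distrib sum.distrib sum_divide_distrib[symmetric] expansion_def)
  then show ?thesis unfolding metric_trace_def second_form_strain[OF \<kappa>] by simp
qed

end

lemma expansion_chart_change:
  assumes c: "c \<in> A" "c' \<in> A" and P: "local_param A S W \<psi>" and u: "u \<in> pdom c \<psi> W" "u \<in> pdom c' \<psi> W"
    and \<kappa>: "\<kappa> = k \<or> \<kappa> = k'"
  shows "\<D> (FF c' \<psi>) u a = \<D> (transition c c') (coords c (\<psi> u)) (\<D> (FF c \<psi>) u a)"
    and "induced_metric g c' \<psi> u = induced_metric g c \<psi> u"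
    and "strain (Gc c') (FF c' \<psi>) (\<lambda>u. \<kappa> c' (\<psi> u)) u a b = strain (Gc c) (FF c \<psi>) (\<lambda>u. \<kappa> c (\<psi> u)) u a b"
proof -
  let ?T = "transition c c'" and ?V = "coords c ` (chart_dom c \<inter> chart_dom c')"
  define W0 where "W0 = pdom c \<psi> W \<inter> pdom c' \<psi> W"
  have W0: "open W0" "u \<in> W0" using pdom_open[OF c(1) P] pdom_open[OF c(2) P] u by (auto simp: W0_def)
  have V: "open ?V" by (rule open_coords_image[OF c(1) chart_open[OF c(2)]])
  have T: "smooth_on ?T ?V" using st c by (simp add: spacetime_def smooth_atlas_def)
  have inW: "\<psi> v \<in> chart_dom c" "\<psi> v \<in> chart_dom c'" "\<psi> v \<in> S" if "v \<in> W0" for v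
  proof -
    have "v \<in> pdom c \<psi> W" "v \<in> pdom c' \<psi> W" using that by (simp_all add: W0_def)
    then show "\<psi> v \<in> chart_dom c" "\<psi> v \<in> chart_dom c'" "\<psi> v \<in> S"
      using chart_of[OF c(1) P] chart_of[OF c(2) P] by simp_all
  qed
  have FV: "coords c (\<psi> v) \<in> ?V" if "v \<in> W0" for v using inW[OF that] by blast
  have F': "FF c' \<psi> v = ?T (FF c \<psi> v)" if "v \<in> W0" for v
    using inW[OF that] chart_inv_coords[OF c(1)] by (simp add: transition_def)
  note Fd = FF_differentiable[OF c(1) P u(1)]
  note Td = smooth_differentiable[OF T FV[OF W0(2)]]
  have "\<D> (\<lambda>v. ?T (FF c \<psi> v)) u = \<D> (FF c' \<psi>) u"
    by (rule D_cong[OF W0 F'[symmetric] differentiable_compose_at[OF Fd Td]])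
  then show D: "\<D> (FF c' \<psi>) u a = \<D> ?T (coords c (\<psi> u)) (\<D> (FF c \<psi>) u a)" for a
    using D_compose[OF Td Fd, of a] by simp
  show "induced_metric g c' \<psi> u = induced_metric g c \<psi> u"
    unfolding induced_metric_eq D metric_change[OF c inW(1,2)[OF W0(2)]] ..
  show "strain (Gc c') (FF c' \<psi>) (\<lambda>u. \<kappa> c' (\<psi> u)) u a b = strain (Gc c) (FF c \<psi>) (\<lambda>u. \<kappa> c (\<psi> u)) u a b"
  proof (rule strain_chart_change[OF V W0 FV T Fd])
    show "(\<lambda>u. \<kappa> c (\<psi> u)) differentiable (at u)"
      by (rule smooth_differentiable[OF k_smooth[OF \<kappa> c(1) P] u(1)])
    show "Gc c differentiable (at (coords c (\<psi> u)))" using Gc_diff[OF c(1)] inW W0(2) by blast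
    show "Gc c' differentiable (at (?T (coords c (\<psi> u))))"
      unfolding F'[OF W0(2), symmetric] using Gc_diff[OF c(2)] inW W0(2) by blast
    show "transpose (Gc c' (?T (coords c (\<psi> u)))) = Gc c' (?T (coords c (\<psi> u)))"
      unfolding F'[OF W0(2), symmetric] using g_sym[OF c(2)] chart_inv_coords[OF c(2)] inW[OF W0(2)] by simp
    fix x a b assume "x \<in> ?V"
    then obtain p where p: "p \<in> chart_dom c" "p \<in> chart_dom c'" "x = coords c p" by auto
    then show "a \<bullet> (Gc c x *v b) = \<D> ?T x a \<bullet> (Gc c' (?T x) *v \<D> ?T x b)"
      using metric_change[OF c p(1,2), of a b] chart_inv_coords[OF c(1)] chart_inv_coords[OF c(2)]
      by (simp add: transition_def)
  next
    fix v assume v: "v \<in> W0"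
    show "FF c' \<psi> v = ?T (FF c \<psi> v)" by (rule F'[OF v])
    show "\<kappa> c' (\<psi> v) = \<D> ?T (FF c \<psi> v) (\<kappa> c (\<psi> v))"
      by (rule vector_change[OF c k_vector[OF \<kappa>] inW(3,1,2)[OF v]])
  qed
qed

text \<open>Parametrisations are homeomorphisms onto relatively open pieces of S, so the transition
  map is a priori just continuous; \<open>immersion_lift\<close> makes it differentiable.\<close>

lemma param_transition:
  fixes \<psi> \<psi>' :: "real ^ 2 \<Rightarrow> 'p"
  assumes P: "local_param A S W \<psi>" and P': "local_param A S W' \<psi>'" and c: "c \<in> A"
    and u: "u \<in> pdom c \<psi> W" and u': "u' \<in> W'" "\<psi> u = \<psi>' u'"
  defines "\<tau> \<equiv> \<lambda>v. inv_into W' \<psi>' (\<psi> v)"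
  shows "\<tau> u = u'" "open {v \<in> W. \<psi> v \<in> \<psi>' ` W'}" "\<tau> differentiable (at u)"
    "\<And>v. v \<in> W \<Longrightarrow> \<psi> v \<in> \<psi>' ` W' \<Longrightarrow> \<tau> v \<in> W' \<and> \<psi>' (\<tau> v) = \<psi> v"
proof -
  note uW = chart_of[OF c P u]
  show \<tau>u: "\<tau> u = u'" unfolding \<tau>_def using u' param_inj[OF P'] by (simp add: inv_into_f_f)
  show \<tau>: "\<tau> v \<in> W' \<and> \<psi>' (\<tau> v) = \<psi> v" if "v \<in> W" "\<psi> v \<in> \<psi>' ` W'" for v
    using that by (simp add: \<tau>_def inv_into_into f_inv_into_f)
  let ?U = "{v \<in> W. \<psi> v \<in> \<psi>' ` W'}"
  obtain O' where O': "open O'" "\<psi>' ` W' = S \<inter> O'"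
    using P' by (auto simp: local_param_def openin_open)
  have "?U = W \<inter> \<psi> -` O'" using O'(2) param_in[OF P] by auto
  then show oU: "open ?U"
    using continuous_open_preimage[OF param_continuous[OF P] param_open[OF P] O'(1)] by simp
  obtain h' where h': "homeomorphism W' (\<psi>' ` W') \<psi>' h'" using P' by (auto simp: local_param_def)
  have "continuous_on ?U (\<lambda>v. h' (\<psi> v))"
  proof (rule continuous_on_compose2[of "\<psi>' ` W'" h'])
    show "continuous_on (\<psi>' ` W') h'" using h' by (simp add: homeomorphism_def)
    show "continuous_on ?U \<psi>" by (rule continuous_on_subset[OF param_continuous[OF P]]) auto
  qed auto
  moreover have "h' (\<psi> v) = \<tau> v" if "v \<in> ?U" for v
    using \<tau> that homeomorphism_apply1[OF h'] by (metis (mono_tags, lifting) mem_Collect_eq)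
  ultimately have "continuous_on ?U \<tau>" by (rule continuous_on_eq)
  moreover have uU: "u \<in> ?U" using uW u' by auto
  ultimately have cont: "isCont \<tau> u" using oU by (simp add: continuous_on_eq_continuous_at)
  have u'd: "u' \<in> pdom c \<psi>' W'" using u' uW by (simp add: pdom_def)
  show "\<tau> differentiable (at u)"
  proof (rule immersion_lift[OF oU uU _ FF_differentiable[OF c P u], of "FF c \<psi>'"])
    show "FF c \<psi>' (\<tau> v) = FF c \<psi> v" if "v \<in> ?U" for v using \<tau> that by simp
  qed (use FF_differentiable[OF c P' u'd] FF_inj[OF c P' u'd] cont \<tau>u in auto)
qed

text \<open>Two representations are compared in two moves: change the chart with \<psi> fixed, then
  change the parametrisation with the chart \<open>c'\<close> fixed.\<close>

lemma rep_change:
  assumes P: "c \<in> A" "local_param A S W \<psi>" "u \<in> pdom c \<psi> W"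
    and P': "c' \<in> A" "local_param A S W' \<psi>'" "u' \<in> pdom c' \<psi>' W'" and eq: "\<psi> u = \<psi>' u'"
  obtains J where "((\<lambda>v. inv_into W' \<psi>' (\<psi> v)) has_derivative (*v) J) (at u)" "det J \<noteq> 0"
    "induced_metric g c \<psi> u = transpose J ** induced_metric g c' \<psi>' u' ** J"
    "\<And>\<kappa>. \<kappa> = k \<or> \<kappa> = k' \<Longrightarrow> expansion g c \<psi> \<kappa> u = expansion g c' \<psi>' \<kappa> u'"
    "\<And>a. \<D> (FF c' \<psi>) u a = \<D> (transition c c') (coords c (\<psi> u)) (\<D> (FF c \<psi>) u a)"
    "\<And>a. \<D> (FF c' \<psi>) u a = \<D> (FF c' \<psi>') u' (J *v a)"
proof -
  have uc': "u \<in> pdom c' \<psi> W" using chart_of[OF P] chart_of[OF P'] eq by (simp add: pdom_def)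
  have u'W: "u' \<in> W'" using P'(3) by (simp add: pdom_def)
  define \<tau> where "\<tau> v = inv_into W' \<psi>' (\<psi> v)" for v
  note tr = param_transition[OF P(2) P'(2,1) uc' u'W eq, folded \<tau>_def]
  define J where "J = matrix (\<D> \<tau> u)"
  have J: "\<D> \<tau> u = (*v) J" unfolding J_def using linear_D[OF tr(3)] by (simp add: matrix_works fun_eq_iff)
  define U where "U = pdom c' \<psi> W \<inter> {v \<in> W. \<psi> v \<in> \<psi>' ` W'}"
  have U: "open U" "u \<in> U"
    using pdom_open[OF P'(1) P(2)] tr(2) uc' eq u'W by (auto simp: U_def pdom_def)
  have \<tau>U: "\<psi> v = \<psi>' (\<tau> v)" if "v \<in> U" for v using tr(4) that by (auto simp: U_def)
  have Fd: "FF c' \<psi>' differentiable (at (\<tau> u))" unfolding tr(1) by (rule FF_differentiable[OF P'])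
  have DF: "\<D> (FF c' \<psi>) u a = \<D> (FF c' \<psi>') u' (J *v a)" for a
  proof -
    have "\<D> (\<lambda>v. FF c' \<psi>' (\<tau> v)) u = \<D> (FF c' \<psi>) u"
      by (rule D_cong[OF U _ differentiable_compose_at[OF tr(3) Fd]]) (use \<tau>U in auto)
    then show ?thesis using D_compose[OF Fd tr(3), of a] by (simp add: J tr(1))
  qed
  let ?q = "induced_metric g c \<psi> u" and ?q' = "induced_metric g c' \<psi>' u'"
  note A1 = expansion_chart_change[OF P(1) P'(1) P(2,3) uc']
  have q: "?q = transpose J ** ?q' ** J"
  proof -
    have "?q = induced_metric g c' \<psi> u" using A1(2)[of k] by simp
    moreover have "a \<bullet> (induced_metric g c' \<psi> u *v b) = a \<bullet> ((transpose J ** ?q' ** J) *v b)" for a b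
      unfolding metric_form[OF P'(1) P(2) uc'] inner_congruence[symmetric] metric_form[OF P'] DF eq ..
    ultimately show ?thesis by (simp add: vec_eq_iff sandwich_nth[symmetric])
  qed
  have dJ: "det J \<noteq> 0" using metric_det[OF P] unfolding q by (auto simp: det_mul)
  have ex: "expansion g c \<psi> \<kappa> u = expansion g c' \<psi>' \<kappa> u'" if \<kappa>: "\<kappa> = k \<or> \<kappa> = k'" for \<kappa>
  proof -
    have Kd: "(\<lambda>u. \<kappa> c' (\<psi>' u)) differentiable (at (\<tau> u))"
      unfolding tr(1) by (rule smooth_differentiable[OF k_smooth[OF \<kappa> P'(1,2)] P'(3)])
    have "strain (Gc c) (FF c \<psi>) (\<lambda>u. \<kappa> c (\<psi> u)) u a b
        = strain (Gc c') (FF c' \<psi>') (\<lambda>u. \<kappa> c' (\<psi>' u)) u' (J *v a) (J *v b)" for a b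
      unfolding A1(3)[OF \<kappa>, symmetric]
      using strain_reparametrize[OF U tr(3) Fd Kd, of "FF c' \<psi>" "\<lambda>u. \<kappa> c' (\<psi> u)" "Gc c'" a b] \<tau>U J tr(1) by simp
    then have "metric_trace ?q (strain (Gc c) (FF c \<psi>) (\<lambda>u. \<kappa> c (\<psi> u)) u)
      = metric_trace (transpose J ** ?q' ** J) (\<lambda>a b. strain (Gc c') (FF c' \<psi>') (\<lambda>u. \<kappa> c' (\<psi>' u)) u' (J *v a) (J *v b))"
      unfolding q metric_trace_def by simp
    also have "\<dots> = metric_trace ?q' (strain (Gc c') (FF c' \<psi>') (\<lambda>u. \<kappa> c' (\<psi>' u)) u')"
      using metric_det[OF P'] Fd Kd unfolding tr(1)
      by (intro metric_trace_congruence dJ strain_linear) auto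
    finally show ?thesis unfolding expansion_strain[OF P \<kappa>] expansion_strain[OF P' \<kappa>] .
  qed
  show thesis
    by (rule that[OF _ dJ q ex A1(1)[OF disjI1[OF refl]] DF]) (use has_D[OF tr(3)] J in \<open>simp_all add: \<tau>_def[abs_def]\<close>)
qed

end

section \<open>The causal Killing field on a marginally trapped surface\<close>

lemma C1_local:
  assumes "\<And>x. x \<in> U \<Longrightarrow> \<exists>V. open V \<and> x \<in> V \<and> C1_on f V"
  shows "C1_on f U"
  unfolding C1_on_def
proof (intro conjI ballI allI)
  show "f differentiable (at x)" if "x \<in> U" for x
    using assms[OF that] C1_differentiable by blast
  show "continuous_on U (\<lambda>x. \<D> f x v)" for v
  proof (rule continuous_at_imp_continuous_on, rule ballI)
    fix x assume "x \<in> U"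
    then obtain V where "open V" "x \<in> V" "C1_on f V" using assms by blast
    then show "isCont (\<lambda>x. \<D> f x v) x"
      using C1_continuous_D[of f V v] by (simp add: continuous_on_eq_continuous_at)
  qed
qed

lemma max_square_derivative: "((\<lambda>t::real. (max 0 t)\<^sup>2) has_real_derivative 2 * max 0 t) (at t)"
proof -
  consider "t < 0" | "t > 0" | "t = 0" by linarith
  then show ?thesis
  proof cases
    case 1
    have "((\<lambda>t::real. 0) has_real_derivative 0) (at t)" by simp
    then have "((\<lambda>t::real. (max 0 t)\<^sup>2) has_real_derivative 0) (at t)"
      by (rule has_field_derivative_transform_within_open[where S = "{..<0}"]) (use 1 in auto)
    then show ?thesis using 1 by simp
  next
    case 2
    have "((\<lambda>t::real. t\<^sup>2) has_real_derivative 2 * t) (at t)" by (auto intro!: derivative_eq_intros)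
    then have "((\<lambda>t::real. (max 0 t)\<^sup>2) has_real_derivative 2 * t) (at t)"
      by (rule has_field_derivative_transform_within_open[where S = "{0<..}"]) (use 2 in auto)
    then show ?thesis using 2 by simp
  next
    case 3
    have "((\<lambda>h::real. (max 0 h)\<^sup>2 / h) \<longlongrightarrow> 0) (at 0)"
    proof (rule Lim_null_comparison)
      show "\<forall>\<^sub>F h::real in at 0. norm ((max 0 h)\<^sup>2 / h) \<le> norm h"
        by (rule always_eventually) (auto simp: max_def power2_eq_square)
      show "((\<lambda>h::real. norm h) \<longlongrightarrow> 0) (at 0)" by (intro tendsto_eq_intros) auto
    qed
    then show ?thesis using 3 by (simp add: DERIV_def)
  qed
qed

context spacetime_charts
begin

text \<open>Squaring the positive part makes it C1 across the boundary of the ball, which is all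
  that \<open>closed_surface_divergence\<close> asks of a partition of unity.\<close>

definition bump :: "('p, 4) chart \<Rightarrow> real ^ 4 \<Rightarrow> real \<Rightarrow> 'p \<Rightarrow> real" where
  "bump c x r p = (if p \<in> chart_dom c then (max 0 (r\<^sup>2 - (coords c p - x) \<bullet> (coords c p - x)))\<^sup>2 else 0)"

lemma bump_nonneg: "0 \<le> bump c x r p"
  by (simp add: bump_def)

lemma bump_nonzero: "r > 0 \<Longrightarrow> bump c x r p \<noteq> 0 \<longleftrightarrow> p \<in> chart_dom c \<and> coords c p \<in> ball x r"
proof -
  assume r: "r > 0"
  have "(r\<^sup>2 - (y - x) \<bullet> (y - x) > 0) = (y \<in> ball x r)" for y
  proof -
    have "(y - x) \<bullet> (y - x) = (dist x y)\<^sup>2" unfolding dist_norm norm_minus_commute[of x y] by (simp add: power2_norm_eq_inner)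
    moreover have "(dist x y)\<^sup>2 < r\<^sup>2 \<longleftrightarrow> dist x y < r"
      using power_mono_iff[of r "dist x y" 2] r by (simp add: not_le[symmetric])
    ultimately show ?thesis by simp
  qed
  note * = this
  have "bump c x r p \<noteq> 0 \<longleftrightarrow> p \<in> chart_dom c \<and> 0 < r\<^sup>2 - (coords c p - x) \<bullet> (coords c p - x)"
    by (auto simp add: bump_def max_def)
  then show ?thesis unfolding * .
qed

lemma chart_ball_compact:
  assumes c: "c \<in> A" and r: "cball x r \<subseteq> coords c ` chart_dom c"
  shows "compact {p \<in> chart_dom c. coords c p \<in> cball x r}"
proof -
  have "{p \<in> chart_dom c. coords c p \<in> cball x r} = chart_inv c ` cball x r"
  proof (intro set_eqI iffI)
    fix p assume "p \<in> {p \<in> chart_dom c. coords c p \<in> cball x r}"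
    then show "p \<in> chart_inv c ` cball x r"
      using chart_inv_coords[OF c, of p] by (auto intro!: image_eqI[of _ _ "coords c p"])
  next
    fix p assume "p \<in> chart_inv c ` cball x r"
    then obtain y where y: "y \<in> cball x r" "p = chart_inv c y" by auto
    then obtain q where "q \<in> chart_dom c" "y = coords c q" using r by blast
    then show "p \<in> {p \<in> chart_dom c. coords c p \<in> cball x r}" using y chart_inv_coords[OF c] by simp
  qed
  moreover have "continuous_on (cball x r) (chart_inv c)"
    by (rule continuous_on_subset[OF homeomorphism_cont2[OF chart_homeo[OF c]] r])
  ultimately show ?thesis using compact_continuous_image[OF _ compact_cball] by simp
qed

text \<open>Inside the domain of c this is composition with a transition map. At other points, the
  closed coordinate ball is compact, hence closed in the Hausdorff manifold, and the function is
  zero on its open complement.\<close>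

lemma bump_C1:
  assumes c: "c \<in> A" "c' \<in> A" and r: "r > 0" "cball x r \<subseteq> coords c ` chart_dom c"
  shows "C1_on (\<lambda>y. bump c x r (chart_inv c' y)) (coords c' ` chart_dom c')"
proof (rule C1_local)
  fix y assume "y \<in> coords c' ` chart_dom c'"
  then obtain p where p: "p \<in> chart_dom c'" "y = coords c' p" by blast
  let ?K = "{p \<in> chart_dom c. coords c p \<in> cball x r}"
  show "\<exists>V. open V \<and> y \<in> V \<and> C1_on (\<lambda>y. bump c x r (chart_inv c' y)) V"
  proof (cases "p \<in> chart_dom c")
    case True
    let ?V = "coords c' ` (chart_dom c' \<inter> chart_dom c)"
    let ?b = "\<lambda>z. (max 0 (r\<^sup>2 - (z - x) \<bullet> (z - x)))\<^sup>2"
    have V: "open ?V" by (rule open_coords_image[OF c(2) chart_open[OF c(1)]])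
    have tr: "smooth_on (transition c' c) ?V"
      using st c by (simp add: spacetime_def smooth_atlas_def)
    have cid: "C1_on (\<lambda>z :: real ^ 4. z) UNIV"
      by (rule C1_onI[where f' = "\<lambda>x v. v"]) auto
    have b: "C1_on ?b UNIV"
    proof (rule C1_real_compose[where f = "\<lambda>t. (max 0 t)\<^sup>2"])
      show "C1_on (\<lambda>z. r\<^sup>2 - (z - x) \<bullet> (z - x)) UNIV" by (intro C1_diff C1_inner C1_const cid)
    qed (rule max_square_derivative, intro continuous_intros)
    have "C1_on (\<lambda>y. ?b (transition c' c y)) ?V"
      by (rule C1_compose[OF b smooth_on_C1[OF tr]]) simp
    then have "C1_on (\<lambda>y. bump c x r (chart_inv c' y)) ?V"
    proof (rule C1_cong[OF V])
      fix z assume "z \<in> ?V"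
      then obtain q where q: "q \<in> chart_dom c'" "q \<in> chart_dom c" "z = coords c' q" by blast
      then show "?b (transition c' c z) = bump c x r (chart_inv c' z)"
        using chart_inv_coords[OF c(2) q(1)] by (simp add: transition_def bump_def)
    qed
    then show ?thesis using V True p by blast
  next
    case False
    let ?V = "coords c' ` (chart_dom c' \<inter> - ?K)"
    have V: "open ?V"
      by (rule open_coords_image[OF c(2)]) (intro open_Compl compact_imp_closed chart_ball_compact c r)
    have "C1_on (\<lambda>y. bump c x r (chart_inv c' y)) ?V"
    proof (rule C1_cong[OF V C1_const[of 0]])
      fix z assume "z \<in> ?V"
      then obtain q where q: "q \<in> chart_dom c'" "q \<notin> ?K" "z = coords c' q" by blast
      have "bump c x r q = 0"
      proof (rule ccontr)
        assume "bump c x r q \<noteq> 0"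
        then show False using bump_nonzero[OF r(1)] q(2) by auto
      qed
      then show "0 = bump c x r (chart_inv c' z)" using q chart_inv_coords[OF c(2) q(1)] by simp
    qed
    then show ?thesis using V False p by blast
  qed
qed

end

section \<open>Null components and tangential part of the Killing field on the surface\<close>

locale killing_mts = null_normal_surface A g T S k k'
  for A :: "('p::{t2_space,second_countable_topology}, 4) chart set"
    and g :: "('p, 4) bilinear_field" and T :: "('p, 4) vector_field" and S k k' +
  fixes R :: "'p set" and \<xi> :: "('p, 4) vector_field"
  assumes R: "region R" and ck: "causal_killing_on A g R \<xi>" and SR: "S \<subseteq> R" and conn: "connected S"
    and \<Theta>: "\<And>c \<psi> W u. c \<in> A \<Longrightarrow> local_param A S W \<psi> \<Longrightarrow> u \<in> pdom c \<psi> W \<Longrightarrow> expansion g c \<psi> k u = 0"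
    and \<Theta>': "\<And>c \<psi> W u. c \<in> A \<Longrightarrow> local_param A S W \<psi> \<Longrightarrow> u \<in> pdom c \<psi> W \<Longrightarrow> expansion g c \<psi> k' u \<noteq> 0"
begin

abbreviation XI where "XI c \<equiv> \<lambda>x. \<xi> c (chart_inv c x)"

lemma Ro: "open R"
  using R by (simp add: region_def)

lemma killing: "killing_on A g R \<xi>"
  using ck by (simp add: causal_killing_on_def)

lemma \<xi>_vector: "vector_on A S \<xi>"
  using killing SR by (auto simp: killing_on_def smooth_vector_field_on_def vector_on_def)

lemma \<xi>_causal: "c \<in> A \<Longrightarrow> p \<in> R \<Longrightarrow> p \<in> chart_dom c \<Longrightarrow> \<xi> c p \<bullet> (g c p *v \<xi> c p) \<le> 0"
  using ck unfolding causal_killing_on_def g_prod_def by blast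

lemma XI_chart: "c \<in> A \<Longrightarrow> killing_chart (Gc c) (XI c) (coords c ` (chart_dom c \<inter> R))"
  by (rule killing_chart_of[OF killing Ro])

definition xi_dot where "xi_dot \<kappa> c p = \<xi> c p \<bullet> (g c p *v \<kappa> c p)"

lemma xi_dot_change:
  assumes "\<kappa> = k \<or> \<kappa> = k'" "c \<in> A" "c' \<in> A" "p \<in> S" "p \<in> chart_dom c" "p \<in> chart_dom c'"
  shows "xi_dot \<kappa> c p = xi_dot \<kappa> c' p"
  unfolding xi_dot_def metric_change[OF assms(2,3,5,6)]
    vector_change[OF assms(2,3) \<xi>_vector assms(4-6)] vector_change[OF assms(2,3) k_vector[OF assms(1)] assms(4-6)] ..

definition vol where "vol c \<psi> u = sqrt (det (induced_metric g c \<psi> u))"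

text \<open>X in parameter coordinates. Its product with the area factor \<open>vol\<close> is the
  vector density to which \<open>closed_surface_divergence\<close> applies.\<close>

definition tpart where "tpart c \<psi> u = null_frame.tang (g c (\<psi> u)) (\<D> (FF c \<psi>) u) (\<xi> c (\<psi> u))"

text \<open>
  Nowhere zero, hence of constant sign on the surface; and \<open>div X = - \<beta> \<Theta>'\<close>, where \<open>\<beta> = - xi_dot k\<close>, has
  this sign wherever it does not vanish.
\<close>
definition sign_fn where "sign_fn c \<psi> u = expansion g c \<psi> k' u * (xi_dot k c (\<psi> u) + xi_dot k' c (\<psi> u))"

context
  fixes c W and \<psi> :: "real ^ 2 \<Rightarrow> 'p"
  assumes P: "c \<in> A" "local_param A S W \<psi>"
begin

lemma FF_in: "u \<in> pdom c \<psi> W \<Longrightarrow> coords c (\<psi> u) \<in> coords c ` (chart_dom c \<inter> R)"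
  using chart_of[OF P] SR by blast

lemma g_C1: "C1_on (\<lambda>u. g c (\<psi> u)) (pdom c \<psi> W)"
proof (rule C1_cong[OF pdom_open[OF P]])
  show "C1_on (\<lambda>u. Gc c (FF c \<psi> u)) (pdom c \<psi> W)"
    by (rule C1_compose[OF smooth_on_C1[OF Gc_smooth[OF P(1)]] smooth_on_C1[OF FF_smooth[OF P]]])
      (use chart_of[OF P] in blast)
qed (simp add: chart_of[OF P])

lemma \<xi>_C1: "C1_on (\<lambda>u. \<xi> c (\<psi> u)) (pdom c \<psi> W)"
proof (rule C1_cong[OF pdom_open[OF P]])
  interpret killing_chart "Gc c" "XI c" "coords c ` (chart_dom c \<inter> R)" by (rule XI_chart[OF P(1)])
  show "C1_on (\<lambda>u. XI c (FF c \<psi> u)) (pdom c \<psi> W)"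
    by (rule C1_compose[OF smooth_on_C1[OF \<Xi>] smooth_on_C1[OF FF_smooth[OF P]]]) (use FF_in in blast)
qed (simp add: chart_of[OF P])

lemma metric_C1: "C1_on (induced_metric g c \<psi>) (pdom c \<psi> W)"
  unfolding induced_metric_eq[abs_def] form_matrix_def
  by (intro C1_vec C1_inner C1_mv g_C1 smooth_on_C1_D[OF FF_smooth[OF P]])

lemma metric_inv_C1: "C1_on (\<lambda>u. matrix_inv (induced_metric g c \<psi> u) $ i $ j) (pdom c \<psi> W)"
  by (rule C1_matrix_inv[OF pdom_open[OF P] metric_C1]) (use metric_det[OF P] in force)

lemma xi_dot_C1: "\<kappa> = k \<or> \<kappa> = k' \<Longrightarrow> C1_on (\<lambda>u. xi_dot \<kappa> c (\<psi> u)) (pdom c \<psi> W)"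
  unfolding xi_dot_def by (intro C1_inner C1_mv g_C1 \<xi>_C1 smooth_on_C1[OF k_smooth] P)

lemma vol_C1: "C1_on (vol c \<psi>) (pdom c \<psi> W)"
  unfolding vol_def[abs_def] by (intro C1_sqrt C1_det C1_nth metric_C1 metric_det[OF P])

lemma tpart_eq:
  assumes u: "u \<in> pdom c \<psi> W"
  shows "tpart c \<psi> u = matrix_inv (induced_metric g c \<psi> u) *v
     (\<chi> i. \<xi> c (\<psi> u) \<bullet> (g c (\<psi> u) *v \<D> (FF c \<psi>) u (axis i 1)))"
  unfolding tpart_def null_frame.tang_def[OF frame_at[OF P u]] metric_q[OF P u] ..

lemma tpart_C1: "C1_on (tpart c \<psi>) (pdom c \<psi> W)"
proof (rule C1_cong[OF pdom_open[OF P]])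
  have "C1_on (\<lambda>u. \<chi> i j. matrix_inv (induced_metric g c \<psi> u) $ i $ j) (pdom c \<psi> W)"
    by (intro C1_vec metric_inv_C1)
  then show "C1_on (\<lambda>u. matrix_inv (induced_metric g c \<psi> u) *v
     (\<chi> i. \<xi> c (\<psi> u) \<bullet> (g c (\<psi> u) *v \<D> (FF c \<psi>) u (axis i 1)))) (pdom c \<psi> W)"
    by (intro C1_mv C1_vec C1_inner g_C1 \<xi>_C1 smooth_on_C1_D[OF FF_smooth[OF P]]) simp
qed (simp add: tpart_eq)

lemma expansion_continuous:
  assumes \<kappa>: "\<kappa> = k \<or> \<kappa> = k'"
  shows "continuous_on (pdom c \<psi> W) (expansion g c \<psi> \<kappa>)"
proof -
  have K: "C1_on (\<lambda>u. \<kappa> c (\<psi> u)) (pdom c \<psi> W)" by (rule smooth_on_C1[OF k_smooth[OF \<kappa> P]])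
  have DG: "continuous_on (pdom c \<psi> W) (\<lambda>u. \<D> (Gc c) (coords c (\<psi> u)) (\<kappa> c (\<psi> u)))"
    by (rule C1_continuous_D_joint[OF smooth_on_C1[OF Gc_smooth[OF P(1)]]
          C1_continuous[OF smooth_on_C1[OF FF_smooth[OF P]]] C1_continuous[OF K]])
      (use chart_of[OF P] in blast)
  have "continuous_on (pdom c \<psi> W) (\<lambda>u. (\<D> (\<lambda>u. \<kappa> c (\<psi> u)) u a \<bullet> (g c (\<psi> u) *v \<D> (FF c \<psi>) u b)
     + \<D> (\<lambda>u. \<kappa> c (\<psi> u)) u b \<bullet> (g c (\<psi> u) *v \<D> (FF c \<psi>) u a)
     + \<D> (FF c \<psi>) u a \<bullet> (\<D> (Gc c) (coords c (\<psi> u)) (\<kappa> c (\<psi> u)) *v \<D> (FF c \<psi>) u b)) / 2)" for a b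
    by (intro continuous_intros mv.continuous_on C1_continuous[OF g_C1] C1_continuous_D[OF K] DG
        C1_continuous_D[OF smooth_on_C1[OF FF_smooth[OF P]]]) auto
  then have st: "continuous_on (pdom c \<psi> W) (\<lambda>u. strain (Gc c) (FF c \<psi>) (\<lambda>u. \<kappa> c (\<psi> u)) u a b)" for a b
    by (rule continuous_on_eq) (simp add: strain_def chart_of[OF P])
  have "continuous_on (pdom c \<psi> W)
      (\<lambda>u. metric_trace (induced_metric g c \<psi> u) (strain (Gc c) (FF c \<psi>) (\<lambda>u. \<kappa> c (\<psi> u)) u))"
    unfolding metric_trace_def by (intro continuous_intros st C1_continuous[OF metric_inv_C1])
  then show ?thesis by (rule continuous_on_eq) (simp add: expansion_strain[OF P _ \<kappa>])
qed

lemma sign_fn_continuous: "continuous_on (pdom c \<psi> W) (sign_fn c \<psi>)"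
  unfolding sign_fn_def[abs_def]
  by (intro continuous_intros expansion_continuous C1_continuous[OF xi_dot_C1]) auto

lemma \<xi>_nonzero: "u \<in> pdom c \<psi> W \<Longrightarrow> \<xi> c (\<psi> u) \<noteq> 0"
  using causal_killing_nonzero[OF ck R P(1)] chart_of[OF P] SR by blast

lemma \<xi>_causal_at: "u \<in> pdom c \<psi> W \<Longrightarrow> \<xi> c (\<psi> u) \<bullet> (g c (\<psi> u) *v \<xi> c (\<psi> u)) \<le> 0"
  using \<xi>_causal[OF P(1)] chart_of[OF P] SR by blast

lemma sign_fn_nonzero:
  assumes u: "u \<in> pdom c \<psi> W" shows "sign_fn c \<psi> u \<noteq> 0"
  using null_frame.causal_nonzero[OF frame_at[OF P u] \<xi>_causal_at[OF u] \<xi>_nonzero[OF u]] \<Theta>'[OF P u]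
  by (simp add: sign_fn_def xi_dot_def)

lemma \<xi>_decomposition:
  assumes u: "u \<in> pdom c \<psi> W"
  shows "\<xi> c (\<psi> u) = - xi_dot k' c (\<psi> u) *\<^sub>R k c (\<psi> u) + - xi_dot k c (\<psi> u) *\<^sub>R k' c (\<psi> u) + \<D> (FF c \<psi>) u (tpart c \<psi> u)"
  using null_frame.decomposition[OF frame_at[OF P u], of "\<xi> c (\<psi> u)"] unfolding xi_dot_def tpart_def .

text \<open>Killing's equation restricted to tangent vectors, by
  \<open>strain_ambient\<close>.\<close>

lemma strain_\<xi>:
  assumes u: "u \<in> pdom c \<psi> W"
  shows "strain (Gc c) (FF c \<psi>) (\<lambda>u. \<xi> c (\<psi> u)) u a b = 0"
proof -
  interpret killing_chart "Gc c" "XI c" "coords c ` (chart_dom c \<inter> R)" by (rule XI_chart[OF P(1)])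
  note x = FF_in[OF u]
  have "strain (Gc c) (FF c \<psi>) (\<lambda>u. \<xi> c (\<psi> u)) u a b = strain (Gc c) (FF c \<psi>) (\<lambda>u. XI c (FF c \<psi> u)) u a b"
    by (rule strain_cong[OF pdom_open[OF P] u _ C1_differentiable[OF \<xi>_C1 u]]) (simp add: chart_of[OF P])
  also have "\<dots> = 0"
    unfolding strain_ambient[OF FF_differentiable[OF P u] \<Xi>d[OF x]]
    using lie[OF x, of "\<D> (FF c \<psi>) u a" "\<D> (FF c \<psi>) u b"] G_commute[OF x, of "\<D> (FF c \<psi>) u a" "\<D> (XI c) (coords c (\<psi> u)) (\<D> (FF c \<psi>) u b)"]
    by simp
  finally show ?thesis .
qed

text \<open>This is the trace of \<open>strain_\<xi>\<close>, split along
  \<open>\<xi>_decomposition\<close>: the k term drops by \<open>\<Theta>\<close>, the k' term gives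
  its expansion, and the tangential term gives the divergence by
  \<open>metric_divergence\<close>.\<close>

lemma divergence_tpart:
  assumes u: "u \<in> pdom c \<psi> W"
  shows "divergence (\<lambda>u. vol c \<psi> u *\<^sub>R tpart c \<psi> u) u = vol c \<psi> u * (xi_dot k c (\<psi> u) * expansion g c \<psi> k' u)"
proof -
  let ?G = "Gc c" and ?F = "FF c \<psi>" and ?q = "induced_metric g c \<psi>"
  let ?k = "\<lambda>u. k c (\<psi> u)" and ?k' = "\<lambda>u. k' c (\<psi> u)" and ?X = "tpart c \<psi>"
  let ?\<alpha> = "\<lambda>u. - xi_dot k' c (\<psi> u)" and ?\<beta> = "\<lambda>u. - xi_dot k c (\<psi> u)"
  note co = chart_of[OF P u]
  interpret nf: null_frame "g c (\<psi> u)" "\<D> ?F u" "?k u" "?k' u" by (rule frame_at[OF P u])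
  have Gd: "?G differentiable (at (?F u))" by (rule Gc_diff[OF P(1) co(2)])
  have kd: "?k differentiable (at u)" "?k' differentiable (at u)"
    using smooth_differentiable[OF k_smooth[OF _ P] u] by auto
  have Xd: "?X differentiable (at u)" by (rule C1_differentiable[OF tpart_C1 u])
  have sd: "?\<alpha> differentiable (at u)" "?\<beta> differentiable (at u)"
    using C1_differentiable[OF xi_dot_C1 u] by (auto intro: differentiable_minus)
  have DXd: "(\<lambda>u. \<D> ?F u (?X u)) differentiable (at u)"
    by (rule differentiable_D_apply[OF pdom_open[OF P] u _ FF_smooth[OF P] differentiable_ident Xd])
  define tg where "tg a b = (\<D> ?X u a \<bullet> (?q u *v b) + \<D> ?X u b \<bullet> (?q u *v a) + a \<bullet> (\<D> ?q u (?X u) *v b)) / 2" for a b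
  have qd: "?q differentiable (at u)" by (rule C1_differentiable[OF metric_C1 u])
  have s3: "strain ?G ?F (\<lambda>u. \<D> ?F u (?X u)) u a b = tg a b" for a b
  proof -
    have d: "\<D> (\<lambda>u. \<D> ?F u a \<bullet> (?G (?F u) *v \<D> ?F u b)) u (?X u) = a \<bullet> (\<D> ?q u (?X u) *v b)"
    proof -
      have cd: "(\<lambda>u. a) differentiable (at u)" "(\<lambda>u. b) differentiable (at u)" by simp_all
      have "\<D> (\<lambda>u. a \<bullet> (?q u *v b)) u = \<D> (\<lambda>u. \<D> ?F u a \<bullet> (?G (?F u) *v \<D> ?F u b)) u"
        by (rule D_cong[OF pdom_open[OF P] u])
          (simp_all add: metric_form[OF P] chart_of[OF P] differentiable_inner[OF cd(1) differentiable_mv[OF qd cd(2)]])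
      then show ?thesis using D_form[OF cd(1) qd cd(2), of "?X u"] by simp
    qed
    have sy: "transpose (?G (?F u)) = ?G (?F u)" using nf.sym co(4) by simp
    show ?thesis
      unfolding strain_tangential[OF pdom_open[OF P] u FF_smooth[OF P] Xd Gd sy] d tg_def
      by (simp add: co(4) metric_form[OF P u])
  qed
  have s12: "strain ?G ?F (\<lambda>u. ?\<alpha> u *\<^sub>R ?k u) u a b = ?\<alpha> u * strain ?G ?F ?k u a b"
    "strain ?G ?F (\<lambda>u. ?\<beta> u *\<^sub>R ?k' u) u a b = ?\<beta> u * strain ?G ?F ?k' u a b" for a b
    by (rule strain_scaleR_normal[where F = ?F, OF sd(1) kd(1) Gd], simp add: co(4) nf.normal,
        rule strain_scaleR_normal[where F = ?F, OF sd(2) kd(2) Gd], simp add: co(4) nf.normal)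
  have "?\<alpha> u * strain ?G ?F ?k u a b + ?\<beta> u * strain ?G ?F ?k' u a b + tg a b = 0" for a b
  proof -
    have "strain ?G ?F (\<lambda>u. \<xi> c (\<psi> u)) u a b =
        strain ?G ?F (\<lambda>u. ?\<alpha> u *\<^sub>R ?k u + ?\<beta> u *\<^sub>R ?k' u + \<D> ?F u (?X u)) u a b"
      by (rule strain_cong[OF pdom_open[OF P] u \<xi>_decomposition C1_differentiable[OF \<xi>_C1 u]])
    also have "\<dots> = strain ?G ?F (\<lambda>u. ?\<alpha> u *\<^sub>R ?k u + ?\<beta> u *\<^sub>R ?k' u) u a b + tg a b"
      unfolding s3[symmetric]
      by (rule strain_add[where F = ?F, OF differentiable_add[OF differentiable_scaleR'[OF sd(1) kd(1)] differentiable_scaleR'[OF sd(2) kd(2)]] DXd Gd])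
    also have "strain ?G ?F (\<lambda>u. ?\<alpha> u *\<^sub>R ?k u + ?\<beta> u *\<^sub>R ?k' u) u a b =
        ?\<alpha> u * strain ?G ?F ?k u a b + ?\<beta> u * strain ?G ?F ?k' u a b"
      unfolding strain_add[where F = ?F, OF differentiable_scaleR'[OF sd(1) kd(1)] differentiable_scaleR'[OF sd(2) kd(2)] Gd] s12 ..
    finally show ?thesis using strain_\<xi>[OF u] by simp
  qed
  then have "metric_trace (?q u) (\<lambda>a b. ?\<alpha> u * strain ?G ?F ?k u a b + ?\<beta> u * strain ?G ?F ?k' u a b + tg a b) = 0"
    by (simp add: metric_trace_def)
  then have "?\<alpha> u * expansion g c \<psi> k u + ?\<beta> u * expansion g c \<psi> k' u + metric_trace (?q u) tg = 0"
    unfolding metric_trace_add metric_trace_scale by (simp add: expansion_strain[OF P u])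
  then have tr: "metric_trace (?q u) tg = xi_dot k c (\<psi> u) * expansion g c \<psi> k' u"
    by (simp add: \<Theta>[OF P u])
  show ?thesis
    unfolding vol_def
    using metric_divergence[OF pdom_open[OF P] u metric_sym[OF P] qd Xd metric_det[OF P u]] tr
    unfolding tg_def by simp
qed

end

end

context killing_mts
begin

lemma sign_fn_change:
  assumes "c \<in> A" "local_param A S W \<psi>" "u \<in> pdom c \<psi> W"
    and "c' \<in> A" "local_param A S W' \<psi>'" "u' \<in> pdom c' \<psi>' W'" and eq: "\<psi> u = \<psi>' u'"
  shows "sign_fn c \<psi> u = sign_fn c' \<psi>' u'"
proof -
  note co = chart_of[OF assms(1-3)] and co' = chart_of[OF assms(4-6), folded eq]
  have "expansion g c \<psi> k' u = expansion g c' \<psi>' k' u'" using rep_change[OF assms] by blast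
  moreover have "xi_dot \<kappa> c (\<psi> u) = xi_dot \<kappa> c' (\<psi> u)" if "\<kappa> = k \<or> \<kappa> = k'" for \<kappa>
    by (rule xi_dot_change[OF that assms(1,4) co(3,2) co'(2)])
  ultimately show ?thesis by (simp add: sign_fn_def eq)
qed

lemma param_at:
  assumes "p \<in> S" "c \<in> A" "p \<in> chart_dom c"
  obtains W \<psi> u where "local_param A S W (\<psi> :: real ^ 2 \<Rightarrow> 'p)" "u \<in> pdom c \<psi> W" "\<psi> u = p"
proof -
  have "\<exists>W (\<psi> :: real ^ 2 \<Rightarrow> 'p). local_param A S W \<psi> \<and> p \<in> \<psi> ` W"
    using S assms(1) unfolding closed_spacelike_surface_def submanifold_def by blast
  then obtain W u and \<psi> :: "real ^ 2 \<Rightarrow> 'p" where r: "local_param A S W \<psi>" "u \<in> W" "\<psi> u = p" by blast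
  show thesis by (rule that[OF r(1) _ r(3)]) (use r assms in \<open>simp add: pdom_def\<close>)
qed

text \<open>\<open>sign_fn\<close> is continuous and nonzero in every representation and, by
  \<open>sign_fn_change\<close>, depends only on the point; connectedness of S fixes its sign
  s.\<close>

lemma sign_fn_constant:
  obtains s :: real where "s \<noteq> 0"
    "\<And>c W \<psi> u. c \<in> A \<Longrightarrow> local_param A S W \<psi> \<Longrightarrow> u \<in> pdom c \<psi> W \<Longrightarrow> 0 < s * sign_fn c \<psi> u"
proof -
  define P where "P p \<longleftrightarrow> (\<exists>c W \<psi> u. c \<in> A \<and> local_param A S W \<psi> \<and> u \<in> pdom c \<psi> W \<and> \<psi> u = p \<and> 0 < sign_fn c \<psi> u)" for p
  have P: "P (\<psi> u) \<longleftrightarrow> 0 < sign_fn c \<psi> u" if "c \<in> A" "local_param A S W \<psi>" "u \<in> pdom c \<psi> W" for c W \<psi> u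
  proof
    assume "P (\<psi> u)"
    then obtain c' W' \<psi>' u' where r: "c' \<in> A" "local_param A S W' \<psi>'" "u' \<in> pdom c' \<psi>' W'" "\<psi>' u' = \<psi> u" "0 < sign_fn c' \<psi>' u'"
      unfolding P_def by blast
    then show "0 < sign_fn c \<psi> u" using sign_fn_change[OF that r(1-3)] by simp
  next
    assume "0 < sign_fn c \<psi> u"
    then show "P (\<psi> u)" unfolding P_def using that by blast
  qed
  have "P constant_on S"
  proof (rule locally_constant_imp_constant[OF conn])
    fix p assume p: "p \<in> S"
    obtain c where c: "c \<in> A" "p \<in> chart_dom c" using chart_cover by blast
    obtain W \<psi> u where r: "local_param A S W (\<psi> :: real ^ 2 \<Rightarrow> 'p)" "u \<in> pdom c \<psi> W" "\<psi> u = p"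
      using param_at[OF p c] .
    let ?D = "pdom c \<psi> W"
    define N where "N = {v \<in> ?D. sign_fn c \<psi> v * sign_fn c \<psi> u \<in> {0<..}}"
    have "continuous_on ?D (\<lambda>v. sign_fn c \<psi> v * sign_fn c \<psi> u)"
      by (intro continuous_intros sign_fn_continuous[OF c(1) r(1)])
    from continuous_open_preimage[OF this pdom_open[OF c(1) r(1)], of "{0<..}"]
    have N: "open N" by (simp add: N_def vimage_def Int_def)
    obtain h where h: "homeomorphism W (\<psi> ` W) \<psi> h" and op: "openin (top_of_set S) (\<psi> ` W)"
      using r(1) by (auto simp: local_param_def)
    have NW: "N \<subseteq> W" by (auto simp: N_def pdom_def)
    have "openin (top_of_set W) N" using N NW by (simp add: openin_open_eq param_open[OF r(1)])
    from homeomorphism_imp_open_map[OF h this] op have o: "openin (top_of_set S) (\<psi> ` N)"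
      by (rule openin_trans)
    have "u \<in> N" using r(2) sign_fn_nonzero[OF c(1) r(1,2)] by (auto simp add: N_def zero_less_mult_iff)
    then have "p \<in> \<psi> ` N" using r(3) by blast
    moreover have "P (\<psi> v) = P p" if v: "v \<in> N" for v
    proof -
      have vD: "v \<in> ?D" and "0 < sign_fn c \<psi> v * sign_fn c \<psi> u" using v by (auto simp: N_def)
      then show ?thesis
        unfolding r(3)[symmetric] P[OF c(1) r(1) vD] P[OF c(1) r(1,2)] by (auto simp: zero_less_mult_iff)
    qed
    ultimately show "\<exists>T. openin (top_of_set S) T \<and> p \<in> T \<and> (\<forall>x\<in>T. P x = P p)"
      using o by (intro exI[of _ "\<psi> ` N"]) blast
  qed
  then obtain b where b: "\<And>p. p \<in> S \<Longrightarrow> P p = b" unfolding constant_on_def by blast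
  show thesis
  proof (rule that[of "if b then 1 else -1"])
    fix c W \<psi> u assume r: "c \<in> A" "local_param A S W \<psi>" "u \<in> pdom c \<psi> W"
    show "0 < (if b then 1 else -1) * sign_fn c \<psi> u"
      using b[OF chart_of(3)[OF r]] P[OF r] sign_fn_nonzero[OF r] by auto
  qed simp
qed

text \<open>The tangential part is determined by its products with tangent vectors, so its
  coordinates are transformed by J, while \<open>vol\<close> scales by |det J|; the absolute value
  covers transitions that reverse orientation.\<close>

lemma tpart_change:
  assumes r: "c \<in> A" "local_param A S W \<psi>" "u \<in> pdom c \<psi> W"
    and r': "c' \<in> A" "local_param A S W' \<psi>'" "u' \<in> pdom c' \<psi>' W'" and eq: "\<psi> u = \<psi>' u'"
  shows "\<exists>J. ((\<lambda>v. inv_into W' \<psi>' (\<psi> v)) has_derivative (*v) J) (at u) \<and>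
    J *v (vol c \<psi> u *\<^sub>R tpart c \<psi> u) = \<bar>det J\<bar> *\<^sub>R (vol c' \<psi>' u' *\<^sub>R tpart c' \<psi>' u')"
proof -
  note co = chart_of[OF r] and co' = chart_of[OF r', folded eq]
  let ?q = "induced_metric g c \<psi> u" and ?q' = "induced_metric g c' \<psi>' u'"
  obtain J where J: "((\<lambda>v. inv_into W' \<psi>' (\<psi> v)) has_derivative (*v) J) (at u)" "det J \<noteq> 0"
    "?q = transpose J ** ?q' ** J"
    "\<And>\<kappa>. \<kappa> = k \<or> \<kappa> = k' \<Longrightarrow> expansion g c \<psi> \<kappa> u = expansion g c' \<psi>' \<kappa> u'"
    "\<And>a. \<D> (FF c' \<psi>) u a = \<D> (transition c c') (coords c (\<psi> u)) (\<D> (FF c \<psi>) u a)"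
    "\<And>a. \<D> (FF c' \<psi>) u a = \<D> (FF c' \<psi>') u' (J *v a)"
    by (rule rep_change[OF r r' eq], rule that)
  interpret nf: null_frame "g c (\<psi> u)" "\<D> (FF c \<psi>) u" "k c (\<psi> u)" "k' c (\<psi> u)" by (rule frame_at[OF r])
  interpret nf': null_frame "g c' (\<psi>' u')" "\<D> (FF c' \<psi>') u'" "k c' (\<psi>' u')" "k' c' (\<psi>' u')" by (rule frame_at[OF r'])
  \<comment> \<open>The difference is orthogonal to the whole image of J, hence to itself, and the
    induced metric is positive definite.\<close>
  define d where "d = J *v tpart c \<psi> u - tpart c' \<psi>' u'"
  have *: "(J *v a) \<bullet> (?q' *v d) = 0" for a
  proof -
    have "(J *v a) \<bullet> (?q' *v (J *v tpart c \<psi> u)) = a \<bullet> (?q *v tpart c \<psi> u)"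
      unfolding J(3) by (rule inner_congruence)
    also have "\<dots> = \<xi> c (\<psi> u) \<bullet> (g c (\<psi> u) *v \<D> (FF c \<psi>) u a)"
      unfolding metric_form[OF r] tpart_def by (rule nf.tang)
    also have "\<dots> = \<xi> c' (\<psi> u) \<bullet> (g c' (\<psi> u) *v \<D> (FF c' \<psi>') u' (J *v a))"
      unfolding metric_change[OF r(1) r'(1) co(2) co'(2)] J(5)[symmetric] J(6)
        vector_change[OF r(1) r'(1) \<xi>_vector co(3,2) co'(2), symmetric] ..
    also have "\<dots> = (J *v a) \<bullet> (?q' *v tpart c' \<psi>' u')"
      unfolding metric_form[OF r'] tpart_def eq by (rule nf'.tang[symmetric])
    finally show ?thesis by (simp add: d_def mv.diff_right inner_diff_right)
  qed
  have "J *v (matrix_inv J *v d) = d"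
    using matrix_inv(1)[of J] J(2) by (simp add: matrix_vector_mul_assoc invertible_det_nz)
  then have "d \<bullet> (?q' *v d) = 0" using *[of "matrix_inv J *v d"] by simp
  then have "d = 0" using nf'.q_pos[of d] unfolding metric_q[OF r'] by force
  then have t: "J *v tpart c \<psi> u = tpart c' \<psi>' u'" by (simp add: d_def)
  have "det ?q = (det J)\<^sup>2 * det ?q'" unfolding J(3) by (simp add: det_mul power2_eq_square)
  then have v: "vol c \<psi> u = \<bar>det J\<bar> * vol c' \<psi>' u'" by (simp add: vol_def real_sqrt_mult)
  show ?thesis using J(1) by (intro exI[of _ J]) (simp add: mv.scaleR_right t v)
qed

text \<open>The closed coordinate ball is taken in the ambient manifold, so that \<open>bump\<close>
  gives globally defined functions, and so small that its part in S lies in one parametrised piece.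
  The data form one tuple, to be chosen for all points at once.\<close>

lemma bump_neighbourhood:
  assumes p: "p \<in> S"
  shows "\<exists>t. case t of (c, W, \<psi> :: real ^ 2 \<Rightarrow> 'p, r) \<Rightarrow> c \<in> A \<and> local_param A S W \<psi> \<and> p \<in> chart_dom c \<and> r > 0 \<and>
    cball (coords c p) r \<subseteq> coords c ` chart_dom c \<and>
    (\<forall>q\<in>chart_dom c. coords c q \<in> cball (coords c p) r \<longrightarrow> q \<in> S \<longrightarrow> q \<in> \<psi> ` W)"
proof -
  obtain c where c: "c \<in> A" "p \<in> chart_dom c" using chart_cover by blast
  obtain W \<psi> u where r: "local_param A S W (\<psi> :: real ^ 2 \<Rightarrow> 'p)" "u \<in> pdom c \<psi> W" "\<psi> u = p"
    using param_at[OF p c] .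
  obtain O' where O': "open O'" "\<psi> ` W = S \<inter> O'"
    using r(1) by (auto simp: local_param_def openin_open)
  have "p \<in> \<psi> ` W" using r(2,3) by (auto simp: pdom_def)
  then have "coords c p \<in> coords c ` (chart_dom c \<inter> O')" using c(2) O'(2) by blast
  then obtain e where e: "e > 0" "cball (coords c p) e \<subseteq> coords c ` (chart_dom c \<inter> O')"
    using open_coords_image[OF c(1) O'(1)] open_contains_cball by blast
  have "q \<in> \<psi> ` W" if q: "q \<in> chart_dom c" "coords c q \<in> cball (coords c p) e" "q \<in> S" for q
  proof -
    obtain q' where "q' \<in> chart_dom c" "q' \<in> O'" "coords c q = coords c q'" using e(2) q(2) by blast
    then have "q = q'" using chart_inv_coords[OF c(1)] q(1) by metis
    then show ?thesis using O'(2) q(3) \<open>q' \<in> O'\<close> by blast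
  qed
  moreover have "cball (coords c p) e \<subseteq> coords c ` chart_dom c" using e(2) by blast
  ultimately show ?thesis using c r(1) e(1) by (intro exI[of _ "(c, W, \<psi>, e)"]) simp
qed

text \<open>
  The divergence of the tangential part of the Killing field integrates to zero, and has one sign.
\<close>
lemma xi_dot_zero:
  assumes c0: "c0 \<in> A" and p0: "p0 \<in> S" "p0 \<in> chart_dom c0"
  shows "xi_dot k c0 p0 = 0"
proof -
  obtain t where t: "\<forall>p\<in>S. case t p of (c, W, \<psi> :: real ^ 2 \<Rightarrow> 'p, r) \<Rightarrow> c \<in> A \<and> local_param A S W \<psi> \<and> p \<in> chart_dom c \<and> r > 0 \<and>
    cball (coords c p) r \<subseteq> coords c ` chart_dom c \<and>
    (\<forall>q\<in>chart_dom c. coords c q \<in> cball (coords c p) r \<longrightarrow> q \<in> S \<longrightarrow> q \<in> \<psi> ` W)"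
    using bchoice[of S] bump_neighbourhood by meson
  define cc where "cc p = fst (t p)" for p
  define WW where "WW p = fst (snd (t p))" for p
  define ps where "ps p = fst (snd (snd (t p)))" for p
  define rr where "rr p = snd (snd (snd (t p)))" for p
  have tp: "cc p \<in> A" "local_param A S (WW p) (ps p)" "p \<in> chart_dom (cc p)" "rr p > 0"
    "cball (coords (cc p) p) (rr p) \<subseteq> coords (cc p) ` chart_dom (cc p)"
    "\<And>q. q \<in> chart_dom (cc p) \<Longrightarrow> coords (cc p) q \<in> cball (coords (cc p) p) (rr p) \<Longrightarrow> q \<in> S \<Longrightarrow> q \<in> ps p ` WW p"
    if "p \<in> S" for p
    using bspec[OF t that] by (auto simp: cc_def WW_def ps_def rr_def split: prod.splits)
  define bb where "bb p = bump (cc p) (coords (cc p) p) (rr p)" for p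
  define KK where "KK p = {q \<in> chart_dom (cc p). coords (cc p) q \<in> cball (coords (cc p) p) (rr p)}" for p
  define NN where "NN p = {q \<in> chart_dom (cc p). coords (cc p) q \<in> ball (coords (cc p) p) (rr p)}" for p
  have NN: "open (NN p)" "p \<in> NN p" if "p \<in> S" for p
  proof -
    have "continuous_on (chart_dom (cc p)) (coords (cc p))"
      using chart_homeo[OF tp(1)[OF that]] by (simp add: homeomorphism_def)
    from continuous_open_preimage[OF this chart_open[OF tp(1)[OF that]] open_ball]
    show "open (NN p)" by (simp add: NN_def vimage_def Int_def)
    show "p \<in> NN p" using tp(3,4)[OF that] by (simp add: NN_def)
  qed
  have bb: "bb p q \<noteq> 0 \<longleftrightarrow> q \<in> NN p" "0 \<le> bb p q" "NN p \<subseteq> KK p" if "p \<in> S" for p q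
    using bump_nonzero[OF tp(4)[OF that]] bump_nonneg by (auto simp: bb_def NN_def KK_def)
  have "compact S" using S by (simp add: closed_spacelike_surface_def)
  then obtain I where I: "I \<subseteq> S" "finite I" "S \<subseteq> (\<Union>p\<in>I. NN p)"
    by (rule compactE_image[of S S NN]) (use NN in auto)
  define sb where "sb q = (\<Sum>p\<in>I. bb p q)" for q
  have sb: "sb q > 0" if "q \<in> S" for q
  proof -
    have "q \<in> (\<Union>p\<in>I. NN p)" using I(3) that by blast
    then obtain p where p: "p \<in> I" "q \<in> NN p" by blast
    then have "bb p q > 0" using bb(1,2)[of p q] I(1) by fastforce
    moreover have "bb p q \<le> sb q" unfolding sb_def
      by (rule member_le_sum) (use p I bb in auto)
    ultimately show ?thesis by linarith
  qed
  \<comment> \<open>Since \<open>sb\<close> is positive on S, this is a partition of unity along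
    S.\<close>
  define \<phi> where "\<phi> p q = bb p q / sb q" for p q
  define D where "D p = pdom (cc p) (ps p) (WW p)" for p
  obtain s where s: "s \<noteq> 0" "\<And>c W \<psi> u. c \<in> A \<Longrightarrow> local_param A S W \<psi> \<Longrightarrow> u \<in> pdom c \<psi> W \<Longrightarrow> 0 < s * sign_fn c \<psi> u"
    using sign_fn_constant by blast
  \<comment> \<open>The factor s makes all divergences nonnegative.\<close>
  define Z where "Z p u = s *\<^sub>R (vol (cc p) (ps p) u *\<^sub>R tpart (cc p) (ps p) u)" for p u
  define K where "K p = {u \<in> WW p. ps p u \<in> KK p}" for p
  have IS: "p \<in> S" if "p \<in> I" for p using I(1) that by blast
  have DS: "ps p u \<in> S" if "p \<in> I" "u \<in> D p" for p u
    using chart_of(3)[OF tp(1,2)[OF IS[OF that(1)]] that(2)[unfolded D_def]] .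
  have divZ: "divergence (Z p) u = s * (vol (cc p) (ps p) u * (xi_dot k (cc p) (ps p u) * expansion g (cc p) (ps p) k' u))"
    if p: "p \<in> I" and u: "u \<in> D p" for p u
  proof -
    note P = tp(1,2)[OF IS[OF p]]
    have "(\<lambda>u. vol (cc p) (ps p) u *\<^sub>R tpart (cc p) (ps p) u) differentiable (at u)"
      by (rule C1_differentiable[OF C1_scaleR[OF vol_C1[OF P] tpart_C1[OF P]] u[unfolded D_def]])
    then have "divergence (Z p) u = s * divergence (\<lambda>u. vol (cc p) (ps p) u *\<^sub>R tpart (cc p) (ps p) u) u"
      unfolding Z_def[abs_def] by (subst divergence_scaleR) simp_all
    then show ?thesis by (simp add: divergence_tpart[OF P u[unfolded D_def]])
  qed
  have volpos: "vol (cc p) (ps p) u > 0" if p: "p \<in> I" and u: "u \<in> D p" for p u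
    using metric_det[OF tp(1,2)[OF IS[OF p]] u[unfolded D_def]] by (simp add: vol_def)
  have zero: "divergence (Z p) u = 0" if p: "p \<in> I" and u: "u \<in> D p" and nz: "\<phi> p (ps p u) \<noteq> 0" for p u
  proof (rule closed_surface_divergence[where I = I and W = D and \<psi> = ps and Z = Z and K = K and \<phi> = \<phi>, OF I(2) _ _ _ _ _ _ _ _ _ _ _ _ p u nz])
    fix i assume i: "i \<in> I"
    note P = tp(1,2)[OF IS[OF i]]
    show "open (D i)" unfolding D_def by (rule pdom_open[OF P])
    show "inj_on (ps i) (D i)"
      using inj_on_subset[OF param_inj[OF P(2)]] by (auto simp: D_def pdom_def)
    show "C1_on (Z i) (D i)"
      unfolding Z_def[abs_def] D_def by (intro C1_scaleR C1_const vol_C1[OF P] tpart_C1[OF P])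
    show "K i \<subseteq> D i" by (auto simp: K_def D_def pdom_def KK_def)
    show "compact (K i)"
    proof -
      obtain h where h: "homeomorphism (WW i) (ps i ` WW i) (ps i) h" using P(2) by (auto simp: local_param_def)
      have KK: "compact (KK i)" unfolding KK_def by (rule chart_ball_compact[OF P(1) tp(5)[OF IS[OF i]]])
      have sub: "S \<inter> KK i \<subseteq> ps i ` WW i" using tp(6)[OF IS[OF i]] by (auto simp: KK_def)
      \<comment> \<open>The inverse parametrisation presents \<open>K i\<close> as a continuous
        image of a compact subset of S.\<close>
      have "K i = h ` (S \<inter> KK i)"
      proof (intro set_eqI iffI)
        fix u assume "u \<in> K i"
        then have "u \<in> WW i" "ps i u \<in> KK i" by (auto simp: K_def)
        then show "u \<in> h ` (S \<inter> KK i)"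
          using homeomorphism_apply1[OF h, of u] param_in[OF P(2)] by (auto intro!: image_eqI[of _ _ "ps i u"])
      next
        fix u assume "u \<in> h ` (S \<inter> KK i)"
        then obtain q where q: "q \<in> S \<inter> KK i" "u = h q" by blast
        then obtain v where "v \<in> WW i" "q = ps i v" using sub by blast
        then show "u \<in> K i" using q homeomorphism_apply1[OF h, of v] by (simp add: K_def)
      qed
      moreover have "compact (S \<inter> KK i)"
        using \<open>compact S\<close> KK by (intro compact_Int)
      moreover have "continuous_on (S \<inter> KK i) h"
        by (rule continuous_on_subset[OF homeomorphism_cont2[OF h] sub])
      ultimately show ?thesis by (simp add: compact_continuous_image)
    qed
    show "0 \<le> \<phi> i q" for q
      unfolding \<phi>_def sb_def by (intro divide_nonneg_nonneg sum_nonneg bb(2) IS i)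
    show "(\<Sum>j\<in>I. \<phi> j (ps i u)) = 1" if "u \<in> D i" for u
    proof -
      have "(\<Sum>j\<in>I. \<phi> j (ps i u)) = sb (ps i u) / sb (ps i u)"
        by (simp add: \<phi>_def sb_def sum_divide_distrib[symmetric])
      then show ?thesis using sb[OF DS[OF i that]] by simp
    qed
    show "0 \<le> divergence (Z i) u" if u: "u \<in> D i" for u
    proof -
      let ?e = "expansion g (cc i) (ps i) k' u" and ?a = "xi_dot k (cc i) (ps i u)" and ?b = "xi_dot k' (cc i) (ps i u)"
      have pos: "0 < s * (?e * (?a + ?b))" using s(2)[OF P u[unfolded D_def]] by (simp add: sign_fn_def)
      \<comment> \<open>Multiplying with \<open>pos\<close> gives 0 \<le> s a e (a + b)^2, where the
        square is positive; this isolates the sign of s a e, the divergence up to the positive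
        factor \<open>vol\<close>.\<close>
      have "0 \<le> ?a * (?a + ?b)"
        using null_frame.causal_sign[OF frame_at[OF P u[unfolded D_def]] \<xi>_causal_at[OF P u[unfolded D_def]]]
        by (simp add: xi_dot_def)
      then have "0 \<le> (s * (?e * (?a + ?b))) * (?a * (?a + ?b))" using pos by simp
      then have "0 \<le> (s * (?a * ?e)) * (?a + ?b)\<^sup>2" by (simp add: power2_eq_square mult_ac)
      moreover have "(?a + ?b)\<^sup>2 > 0" using pos by auto
      ultimately have "0 \<le> s * (?a * ?e)" by (simp add: zero_le_mult_iff)
      then have "0 \<le> vol (cc i) (ps i) u * (s * (?a * ?e))" using volpos[OF i u] by simp
      then show ?thesis unfolding divZ[OF i u] by (simp add: mult_ac)
    qed
    fix j assume j: "j \<in> I"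
    note Pj = tp(1,2)[OF IS[OF j]]
    show "ps j u \<in> ps i ` K i" if u: "u \<in> D j" "\<phi> i (ps j u) \<noteq> 0" for u
    proof -
      have "ps j u \<in> KK i" using u(2) bb(1,3)[OF IS[OF i]] by (auto simp: \<phi>_def)
      then obtain v where "v \<in> WW i" "ps j u = ps i v" using tp(6)[OF IS[OF i]] DS[OF j u(1)] by (auto simp: KK_def)
      then show ?thesis using \<open>ps j u \<in> KK i\<close> by (auto simp: K_def)
    qed
    show "C1_on (\<lambda>u. \<phi> i (ps j u)) (D j)"
    proof -
      have b: "C1_on (\<lambda>u. bb l (ps j u)) (D j)" if l: "l \<in> I" for l
      proof -
        have "C1_on (\<lambda>u. bb l (chart_inv (cc j) (FF (cc j) (ps j) u))) (D j)"
          unfolding bb_def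
          by (rule C1_compose[OF bump_C1[OF tp(1)[OF IS[OF l]] Pj(1) tp(4,5)[OF IS[OF l]]] smooth_on_C1[OF FF_smooth[OF Pj], folded D_def]])
            (auto simp: D_def pdom_def)
        then show ?thesis
        proof (rule C1_cong[rotated])
          show "open (D j)" unfolding D_def by (rule pdom_open[OF Pj])
          show "bb l (chart_inv (cc j) (FF (cc j) (ps j) u)) = bb l (ps j u)" if "u \<in> D j" for u
            using chart_of(4)[OF Pj that[unfolded D_def]] by simp
        qed
      qed
      show ?thesis unfolding \<phi>_def sb_def
        by (intro C1_divide C1_sum b i) (use sb[OF DS[OF j]] in \<open>force simp: sb_def\<close>)+
    qed
    show "open {u \<in> D i. ps i u \<in> ps j ` D j}"
    proof -
      obtain O' where O': "open O'" "ps j ` WW j = S \<inter> O'"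
        using Pj(2) by (auto simp: local_param_def openin_open)
      have "{u \<in> D i. ps i u \<in> ps j ` D j} = D i \<inter> ps i -` (O' \<inter> chart_dom (cc j))"
      proof (intro set_eqI iffI)
        fix u assume "u \<in> {u \<in> D i. ps i u \<in> ps j ` D j}"
        then show "u \<in> D i \<inter> ps i -` (O' \<inter> chart_dom (cc j))" using O'(2) by (auto simp: D_def pdom_def)
      next
        fix u assume u: "u \<in> D i \<inter> ps i -` (O' \<inter> chart_dom (cc j))"
        then have "ps i u \<in> ps j ` WW j" using O'(2) DS[OF i] by blast
        then show "u \<in> {u \<in> D i. ps i u \<in> ps j ` D j}" using u by (auto simp: D_def pdom_def)
      qed
      moreover have "open (D i)" unfolding D_def by (rule pdom_open[OF P])
      moreover have "continuous_on (D i) (ps i)"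
        by (rule continuous_on_subset[OF param_continuous[OF P(2)]]) (auto simp: D_def pdom_def)
      ultimately show ?thesis
        using continuous_open_preimage open_Int[OF O'(1) chart_open[OF Pj(1)]] by metis
    qed
    note ov = this
    fix u v assume u: "u \<in> D i" and v: "v \<in> D j" and eq: "ps i u = ps j v"
    obtain J where J: "((\<lambda>v. inv_into (WW j) (ps j) (ps i v)) has_derivative (*v) J) (at u)"
      "J *v (vol (cc i) (ps i) u *\<^sub>R tpart (cc i) (ps i) u) = \<bar>det J\<bar> *\<^sub>R (vol (cc j) (ps j) v *\<^sub>R tpart (cc j) (ps j) v)"
      using tpart_change[OF P u[unfolded D_def] Pj v[unfolded D_def] eq] by blast
    \<comment> \<open>\<open>D j\<close> is \<open>WW j\<close> cut down to one chart; on the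
      overlap the two inverses agree by injectivity.\<close>
    have "((\<lambda>u. inv_into (D j) (ps j) (ps i u)) has_derivative (*v) J) (at u)"
    proof (rule has_derivative_transform_within_open[OF J(1) ov])
      show "u \<in> {u \<in> D i. ps i u \<in> ps j ` D j}" using u v eq by auto
      fix w assume "w \<in> {u \<in> D i. ps i u \<in> ps j ` D j}"
      then obtain z where z: "z \<in> D j" "ps i w = ps j z" by blast
      have inj: "inj_on (ps j) (WW j)" by (rule param_inj[OF Pj(2)])
      have "D j \<subseteq> WW j" by (auto simp: D_def pdom_def)
      then show "inv_into (WW j) (ps j) (ps i w) = inv_into (D j) (ps j) (ps i w)"
        using z inv_into_f_f[OF inj, of z] inv_into_f_f[OF inj_on_subset[OF inj], of "D j" z] by auto
    qed
    moreover have "J *v Z i u = \<bar>det (matrix ((*v) J))\<bar> *\<^sub>R Z j v"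
      unfolding Z_def mv.scaleR_right[of _ s] J(2) by simp
    ultimately show "\<exists>D'. ((\<lambda>u. inv_into (D j) (ps j) (ps i u)) has_derivative D') (at u) \<and>
        D' (Z i u) = \<bar>det (matrix D')\<bar> *\<^sub>R Z j v" by blast
  qed
  obtain p where p: "p \<in> I" "p0 \<in> NN p" using I(3) p0(1) by blast
  then have "p0 \<in> KK p" using bb(3)[OF IS[OF p(1)]] by blast
  then obtain u where u: "u \<in> WW p" "p0 = ps p u" using tp(6)[OF IS[OF p(1)]] p0(1) by (auto simp: KK_def)
  have uD: "u \<in> D p" using u \<open>p0 \<in> KK p\<close> by (simp add: D_def pdom_def KK_def)
  have "\<phi> p (ps p u) \<noteq> 0" using bb(1)[OF IS[OF p(1)]] p(2) sb[OF p0(1)] u(2) by (simp add: \<phi>_def)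
  \<comment> \<open>The divergence is the product of s, \<open>vol\<close>, \<Theta>' and
    \<open>xi_dot k\<close>, and the first three factors are nonzero.\<close>
  from zero[OF p(1) uD this] have "xi_dot k (cc p) p0 = 0"
    using divZ[OF p(1) uD] s(1) volpos[OF p(1) uD] \<Theta>'[OF tp(1,2)[OF IS[OF p(1)]] uD[unfolded D_def]] u(2) by simp
  moreover have "p0 \<in> chart_dom (cc p)" using \<open>p0 \<in> KK p\<close> by (simp add: KK_def)
  ultimately show ?thesis using xi_dot_change[of k c0 "cc p" p0] c0 p0 tp(1)[OF IS[OF p(1)]] by simp
qed

end

section \<open>Vanishing of the energy flux\<close>

context killing_mts
begin

text \<open>By \<open>xi_dot_zero\<close> the field is \<alpha> k with \<alpha> nonzero. Its strain
  vanishes and, k being normal, equals \<alpha> times that of k; together with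
  \<open>\<Theta>\<close> this removes the shear.\<close>

lemma energy_flux_zero:
  assumes P: "c \<in> A" "local_param A S W \<psi>" and u: "u \<in> pdom c \<psi> W"
  shows "energy_flux g c \<psi> k u = 0"
proof -
  let ?\<alpha> = "\<lambda>u. - xi_dot k' c (\<psi> u)" and ?F = "FF c \<psi>" and ?k = "\<lambda>u. k c (\<psi> u)"
  note co = chart_of[OF P]
  have xi0: "xi_dot k c (\<psi> v) = 0" if "v \<in> pdom c \<psi> W" for v
    by (rule xi_dot_zero[OF P(1) co(3,2)[OF that]])
  have \<xi>: "\<xi> c (\<psi> v) = ?\<alpha> v *\<^sub>R ?k v" if v: "v \<in> pdom c \<psi> W" for v
    using null_frame.causal_null[OF frame_at[OF P v] \<xi>_causal_at[OF P v]] xi0[OF v] by (simp add: xi_dot_def)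
  have \<alpha>: "?\<alpha> u \<noteq> 0" using \<xi>[OF u] \<xi>_nonzero[OF P u] by auto
  interpret nf: null_frame "g c (\<psi> u)" "\<D> ?F u" "?k u" "k' c (\<psi> u)" by (rule frame_at[OF P u])
  have Gd: "Gc c differentiable (at (?F u))" by (rule Gc_diff[OF P(1) co(2)[OF u]])
  have kd: "?k differentiable (at u)" using smooth_differentiable[OF k_smooth[OF _ P] u] by auto
  have \<alpha>d: "?\<alpha> differentiable (at u)"
    using C1_differentiable[OF xi_dot_C1[OF P] u] by (auto intro: differentiable_minus)
  have strain0: "strain (Gc c) ?F ?k u a b = 0" for a b
  proof -
    have "strain (Gc c) ?F (\<lambda>u. \<xi> c (\<psi> u)) u a b = strain (Gc c) ?F (\<lambda>u. ?\<alpha> u *\<^sub>R ?k u) u a b"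
      by (rule strain_cong[OF pdom_open[OF P] u \<xi> C1_differentiable[OF \<xi>_C1[OF P] u]])
    also have "\<dots> = ?\<alpha> u * strain (Gc c) ?F ?k u a b"
      by (rule strain_scaleR_normal[where F = ?F, OF \<alpha>d kd Gd]) (simp add: co(4)[OF u] nf.normal)
    finally show ?thesis using strain_\<xi>[OF P u] \<alpha> by simp
  qed
  have shear0: "shear g c \<psi> k u $ i $ j = 0" for i j
    using second_form_strain[OF P u, of k i j] strain0 by (simp add: shear_def \<Theta>[OF P u])
  have "ltrace (\<lambda>b. riem (Gc c) (?F u) (XI c (?F u)) b (XI c (?F u))) = 0"
  proof (rule ricci_zero_on_null_surface[OF XI_chart[OF P(1)] pdom_open[OF P] u FF_smooth[OF P] FF_in[OF P]])
    show "null_frame (Gc c (?F u)) (\<D> ?F u) (?k u) (k' c (\<psi> u))"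
      unfolding co(4)[OF u] by (rule nf.null_frame_axioms)
    show "XI c (?F u) = ?\<alpha> u *\<^sub>R ?k u" unfolding co(4)[OF u] by (rule \<xi>[OF u])
    show "?\<alpha> u \<noteq> 0" by (rule \<alpha>)
    show "XI c x \<bullet> (Gc c x *v XI c x) \<le> 0" if "x \<in> coords c ` (chart_dom c \<inter> R)" for x
    proof -
      obtain p where p: "p \<in> chart_dom c" "p \<in> R" "x = coords c p" using \<open>x \<in> _\<close> by blast
      show ?thesis using \<xi>_causal[OF P(1) p(2,1)] chart_inv_coords[OF P(1) p(1)] p(3) by simp
    qed
    fix v assume v: "v \<in> pdom c \<psi> W"
    interpret nv: null_frame "g c (\<psi> v)" "\<D> ?F v" "?k v" "k' c (\<psi> v)" by (rule frame_at[OF P v])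
    show "XI c (?F v) \<bullet> (Gc c (?F v) *v XI c (?F v)) = 0"
      unfolding co(4)[OF v] \<xi>[OF v] by (simp add: mv.minus_right mv.scaleR_right nv.null)
    show "XI c (?F v) \<bullet> (Gc c (?F v) *v \<D> ?F v b) = 0" for b
      unfolding co(4)[OF v] \<xi>[OF v] by (simp add: nv.normal)
  qed
  then have "\<xi> c (\<psi> u) \<bullet> (ricci g c (\<psi> u) *v \<xi> c (\<psi> u)) = 0"
    unfolding ricci_riem[OF P(1) co(2)[OF u]] co(4)[OF u] .
  \<comment> \<open>Here R(\<xi>, \<xi>) is \<alpha>^2 R(k, k).\<close>
  then have "?k u \<bullet> (ricci g c (\<psi> u) *v ?k u) = 0"
    unfolding \<xi>[OF u] using \<alpha> by (simp add: mv.minus_right mv.scaleR_right)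
  then show ?thesis by (simp add: energy_flux_def shear0)
qed

end

theorem proposition2:
  fixes A :: "('p::{t2_space,second_countable_topology}, 4) chart set"
    and g :: "('p, 4) bilinear_field"
    and T :: "('p, 4) vector_field"
    and R :: "'p set"
  assumes "spacetime A g T"
    and "region R"
    and "\<exists>\<xi>. causal_killing_on A g R \<xi>"
  shows "(\<forall>H L S. dynamical_horizon_segment A g T H L \<and> S \<in> L \<longrightarrow> \<not> S \<subseteq> R) \<and>
         (\<forall>H L. dynamical_horizon_segment A g T H L \<longrightarrow> \<not> H \<subseteq> R)"
proof -
  obtain \<xi> where \<xi>: "causal_killing_on A g R \<xi>" using assms(3) by blast
  have leaf: "\<not> S \<subseteq> R" if dh: "dynamical_horizon_segment A g T H L" and SL: "S \<in> L" for H L S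
  proof
    assume SR: "S \<subseteq> R"
    have "\<exists>k k'. mts A g T S k k' \<and> (\<forall>(c, \<psi>, u) \<in> surface_rep A S. expansion g c \<psi> k' u \<noteq> 0) \<and>
        \<not> (\<forall>(c, \<psi>, u) \<in> surface_rep A S. energy_flux g c \<psi> k u = 0)"
      using dh SL unfolding dynamical_horizon_segment_def by blast
    then obtain k k' where k: "mts A g T S k k'" "\<forall>(c, \<psi>, u) \<in> surface_rep A S. expansion g c \<psi> k' u \<noteq> 0"
      "\<not> (\<forall>(c, \<psi>, u) \<in> surface_rep A S. energy_flux g c \<psi> k u = 0)" by blast
    interpret null_normal_surface A g T S k k'
      by unfold_locales (use assms(1) k(1) in \<open>simp_all add: mts_def\<close>)
    have rep: "(c, \<psi>, u) \<in> surface_rep A S" if "c \<in> A" "local_param A S W \<psi>" "u \<in> pdom c \<psi> W" for c \<psi> u W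
      using that unfolding surface_rep_def pdom_def by blast
    interpret killing_mts A g T S k k' R \<xi>
    proof
      show "connected S" using dh SL by (simp add: dynamical_horizon_segment_def foliation_by_surfaces_def)
      show "expansion g c \<psi> k u = 0" if "c \<in> A" "local_param A S W \<psi>" "u \<in> pdom c \<psi> W" for c \<psi> W u
        using k(1) bspec[OF _ rep[OF that]] by (auto simp: mts_def)
      show "expansion g c \<psi> k' u \<noteq> 0" if "c \<in> A" "local_param A S W \<psi>" "u \<in> pdom c \<psi> W" for c \<psi> W u
        using bspec[OF k(2) rep[OF that]] by simp
    qed (use assms(2) \<xi> SR in auto)
    have "energy_flux g c \<psi> k u = 0" if "(c, \<psi>, u) \<in> surface_rep A S" for c \<psi> u
    proof -
      obtain W where "c \<in> A" "local_param A S W \<psi>" "u \<in> pdom c \<psi> W"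
        using \<open>(c, \<psi>, u) \<in> _\<close> unfolding surface_rep_def pdom_def by blast
      then show ?thesis by (rule energy_flux_zero)
    qed
    then have "\<forall>(c, \<psi>, u) \<in> surface_rep A S. energy_flux g c \<psi> k u = 0" by blast
    with k(3) show False ..
  qed
  have "\<not> H \<subseteq> R" if dh: "dynamical_horizon_segment A g T H L" for H L
  proof -
    have "H \<noteq> {}" "partition_on H L"
      using dh by (simp_all add: dynamical_horizon_segment_def foliation_by_surfaces_def)
    \<comment> \<open>A nonempty H contains a leaf, which reduces the second claim to the
      first.\<close>
    then obtain S where "S \<in> L" "S \<subseteq> H" unfolding partition_on_def by (metis Sup_upper ex_in_conv Union_empty)
    then show ?thesis using leaf[OF dh] by blast
  qed
  with leaf show ?thesis by blast
qed

end
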